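(* Let $s,k\ge 0$ be integers and let $G=G(s,k)$ be a path-friendship graph with $s$ triangles and $k$ paths. If $H$ is a graph that is $L$-cospectral with $G$, then $H$ is a path-friendship graph (with $s$ triangles and $k$ paths).
   Context: All graphs are finite and simple. The Laplacian matrix of a graph is $L(G)=D(G)-A(G)$, where $A(G)$ is the adjacency matrix and $D(G)$ the diagonal matrix of vertex degrees. Two graphs are $L$-cospectral if their Laplacian matrices have the same multiset of eigenvalues. The friendship graph $F_s$ consists of $s$ triangles sharing exactly one common vertex (its center). A path-friendship graph $G(s,k)$ is obtained by taking $F_s$ and $k$ paths (each with at least one edge) and identifying the center of $F_s$ with one endpoint of each of the $k$ paths; so it consists of $s$ triangles and $k$ pendant paths all sharing one common vertex. (The notation $G(s,k)$ denotes any such graph; the path lengths are not specified.) *)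

theory Defs
  imports
    "Graph_Theory.Pair_Digraph"
    "Graph_Theory.Digraph_Isomorphism"
    "Jordan_Normal_Form.Char_Poly"
    "HOL-Computational_Algebra.Fundamental_Theorem_Algebra"
begin

text \<open>
  A finite simple graph is a \<^locale>\<open>pair_graph\<close>: a finite, loop-free, symmetric set of
  ordered pairs, each edge being represented by its two orientations. The degree of a vertex is
  therefore its \<^const>\<open>out_degree\<close>.
\<close>

definition adjacency_mat :: "'a pair_pre_digraph \<Rightarrow> 'a list \<Rightarrow> real mat" where
  "adjacency_mat G vs =
     mat (length vs) (length vs) (\<lambda>(i, j). if (vs ! i, vs ! j) \<in> parcs G then 1 else 0)"

definition degree_mat :: "'a pair_pre_digraph \<Rightarrow> 'a list \<Rightarrow> real mat" where
  "degree_mat G vs =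
     mat (length vs) (length vs)
       (\<lambda>(i, j). if i = j then real (out_degree (with_proj G) (vs ! i)) else 0)"

definition laplacian_mat :: "'a pair_pre_digraph \<Rightarrow> 'a list \<Rightarrow> real mat" where
  "laplacian_mat G vs = degree_mat G vs - adjacency_mat G vs"

definition vertex_enum :: "'a pair_pre_digraph \<Rightarrow> 'a list" where
  "vertex_enum G = (SOME vs. distinct vs \<and> set vs = pverts G)"

text \<open>
  The multiset of eigenvalues, with algebraic multiplicities. The characteristic polynomial is
  taken over the complex numbers, where it splits, so no eigenvalue is lost by definition. The
  choice of the enumeration of the vertices is irrelevant, see \<open>laplacian_spectrum_eq\<close> below.
\<close>

definition laplacian_spectrum :: "'a pair_pre_digraph \<Rightarrow> complex multiset" where
  "laplacian_spectrum G =
     proots (char_poly (map_mat complex_of_real (laplacian_mat G (vertex_enum G))))"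

definition L_cospectral :: "'a pair_pre_digraph \<Rightarrow> 'b pair_pre_digraph \<Rightarrow> bool" where
  "L_cospectral G H \<longleftrightarrow> laplacian_spectrum G = laplacian_spectrum H"

text \<open>
  \<open>Tri i False\<close> and \<open>Tri i True\<close> are the two non-central vertices of the \<open>i\<close>-th triangle,
  and \<open>Pth j m\<close> with \<open>m \<ge> 1\<close> is the vertex at distance \<open>m\<close> from the center on the \<open>j\<close>-th path.
\<close>

datatype pf_vertex = Center | Tri nat bool | Pth nat nat

definition friendship_graph :: "nat \<Rightarrow> pf_vertex pair_pre_digraph" where
  "friendship_graph s =
     \<lparr> pverts = insert Center {Tri i b | i b. i < s},
       parcs = symcl ({(Center, Tri i b) | i b. i < s} \<union> {(Tri i False, Tri i True) | i. i < s}) \<rparr>"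

text \<open>The endpoint number 0 of every path is identified with the center.\<close>

definition path_vertex :: "nat \<Rightarrow> nat \<Rightarrow> pf_vertex" where
  "path_vertex j m = (if m = 0 then Center else Pth j m)"

definition pendant_path :: "nat \<Rightarrow> nat \<Rightarrow> pf_vertex pair_pre_digraph" where
  "pendant_path j l =
     \<lparr> pverts = {path_vertex j m | m. m \<le> l},
       parcs = symcl {(path_vertex j m, path_vertex j (Suc m)) | m. m < l} \<rparr>"

text \<open>The list \<open>ls\<close> contains the lengths (numbers of edges) of the paths.\<close>

definition path_friendship_graph :: "nat \<Rightarrow> nat list \<Rightarrow> pf_vertex pair_pre_digraph" where
  "path_friendship_graph s ls =
     \<lparr> pverts = pverts (friendship_graph s) \<union> (\<Union>j<length ls. pverts (pendant_path j (ls ! j))),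
       parcs = parcs (friendship_graph s) \<union> (\<Union>j<length ls. parcs (pendant_path j (ls ! j))) \<rparr>"

definition is_path_friendship :: "nat \<Rightarrow> nat \<Rightarrow> 'a pair_pre_digraph \<Rightarrow> bool" where
  "is_path_friendship s k G \<longleftrightarrow>
     (\<exists>ls. length ls = k \<and> (\<forall>l\<in>set ls. 1 \<le> l) \<and>
        digraph_iso (with_proj (path_friendship_graph s ls)) (with_proj G))"

lemma pair_graph_path_friendship_graph: "pair_graph (path_friendship_graph s ls)"
proof -
  let ?G = "path_friendship_graph s ls"
  have "{Tri i b | i b. i < s} = (\<lambda>(i, b). Tri i b) ` ({..<s} \<times> UNIV)"
    by auto
  moreover have "finite ((\<lambda>(i, b). Tri i b) ` ({..<s} \<times> UNIV))"
    by simp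
  ultimately have tri: "finite {Tri i b | i b. i < s}"
    by (rule ssubst)
  have path: "finite {path_vertex j m | m. m \<le> l}" for j l
    by simp
  have fin: "finite (pverts ?G)"
    using tri path by (simp add: path_friendship_graph_def friendship_graph_def pendant_path_def)
  have ends: "fst e \<in> pverts ?G \<and> snd e \<in> pverts ?G \<and> fst e \<noteq> snd e" if "e \<in> parcs ?G" for e
  proof -
    from that consider "e \<in> parcs (friendship_graph s)"
      | j where "j < length ls" "e \<in> parcs (pendant_path j (ls ! j))"
      by (auto simp: path_friendship_graph_def)
    then show ?thesis
    proof cases
      case 1
      then show ?thesis
        by (auto simp: path_friendship_graph_def friendship_graph_def symcl_def)
    next
      case 2
      then obtain m where m: "m < ls ! j"
        "e = (path_vertex j m, path_vertex j (Suc m)) \<or> e = (path_vertex j (Suc m), path_vertex j m)"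
        by (auto simp: pendant_path_def symcl_def)
      have "path_vertex j i \<in> pverts ?G" if "i \<le> ls ! j" for i
        using 2(1) that by (auto simp: path_friendship_graph_def pendant_path_def)
      moreover have "path_vertex j m \<noteq> path_vertex j (Suc m)"
        by (simp add: path_vertex_def)
      ultimately show ?thesis
        using m by auto
    qed
  qed
  have "parcs ?G \<subseteq> pverts ?G \<times> pverts ?G"
    using ends by (auto simp: mem_Times_iff)
  then have "finite (parcs ?G)"
    using fin by (meson finite_SigmaI finite_subset)
  moreover have "sym (symcl R)" for R :: "pf_vertex rel"
    by (force simp: symcl_def sym_def)
  then have "sym (parcs ?G)"
    by (auto simp: path_friendship_graph_def friendship_graph_def pendant_path_def
          intro!: sym_Un sym_UNION)
  ultimately show ?thesis
    using fin ends by unfold_locales (auto simp: symmetric_def)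
qed

lemma char_poly_reindex:
  fixes f :: "'a \<Rightarrow> 'a \<Rightarrow> 'b :: comm_ring_1"
  assumes vs: "distinct vs" and ws: "distinct ws" and eq: "set vs = set ws"
  shows "char_poly (mat (length vs) (length vs) (\<lambda>(i, j). f (vs ! i) (vs ! j))) =
         char_poly (mat (length ws) (length ws) (\<lambda>(i, j). f (ws ! i) (ws ! j)))"
    (is "char_poly ?A = char_poly ?B")
proof -
  define n where "n = length vs"
  have n: "length vs = n" "length ws = n"
    using assms by (auto simp: n_def) (metis distinct_card)
  define P where
    "P xs ys = mat n n (\<lambda>(i, j). if xs ! i = ys ! j then 1 else (0 :: 'b))" for xs ys :: "'a list"
  have pick: "(\<Sum>k = 0..<n. (if xs ! i = ys ! k then 1 else 0) * g (ys ! k)) = g (xs ! i)"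
    if "distinct ys" "length xs = n" "length ys = n" "set xs = set ys" "i < n"
    for xs ys i and g :: "'a \<Rightarrow> 'b"
  proof -
    have "(\<Sum>k = 0..<n. (if xs ! i = ys ! k then 1 else 0) * g (ys ! k)) =
          (\<Sum>y\<in>set ys. (if xs ! i = y then 1 else 0) * g y)"
      by (rule sum.reindex_bij_betw[OF bij_betw_nth]) (use that in auto)
    also have "\<dots> = (\<Sum>y\<in>set ys. if y = xs ! i then g y else 0)"
      by (intro sum.cong) auto
    also have "\<dots> = g (xs ! i)"
      using that nth_mem[of i xs] by simp
    finally show ?thesis .
  qed
  have PP: "P xs ys * P ys xs = 1\<^sub>m n"
    if "distinct xs" "distinct ys" "length xs = n" "length ys = n" "set xs = set ys" for xs ys
  proof (rule eq_matI)
    fix i j assume "i < dim_row (1\<^sub>m n :: 'b mat)" "j < dim_col (1\<^sub>m n :: 'b mat)"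
    then have ij: "i < n" "j < n" by auto
    then show "(P xs ys * P ys xs) $$ (i, j) = 1\<^sub>m n $$ (i, j)"
      using that pick[of ys xs i "\<lambda>y. if y = xs ! j then 1 else 0"]
      by (simp add: P_def scalar_prod_def nth_eq_iff_index_eq)
  qed (auto simp: P_def)
  have PB: "P vs ws * ?B = mat n n (\<lambda>(i, j). f (vs ! i) (ws ! j))" (is "_ = ?C")
  proof (rule eq_matI)
    fix i j assume "i < dim_row ?C" "j < dim_col ?C"
    then show "(P vs ws * ?B) $$ (i, j) = ?C $$ (i, j)"
      using assms n pick[of ws vs i "\<lambda>y. f y (ws ! j)"]
      by (simp add: P_def scalar_prod_def)
  qed (auto simp: P_def n)
  have "?A = P vs ws * ?B * P ws vs"
    unfolding PB
  proof (rule eq_matI)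
    fix i j assume "i < dim_row (?C * P ws vs)" "j < dim_col (?C * P ws vs)"
    then have ij: "i < n" "j < n" by (auto simp: P_def)
    have "(?C * P ws vs) $$ (i, j) = (\<Sum>k = 0..<n. f (vs ! i) (ws ! k) * (if ws ! k = vs ! j then 1 else 0))"
      using ij by (simp add: P_def scalar_prod_def)
    also have "\<dots> = (\<Sum>k = 0..<n. (if vs ! j = ws ! k then 1 else 0) * f (vs ! i) (ws ! k))"
      by (intro sum.cong) auto
    also have "\<dots> = f (vs ! i) (vs ! j)"
      using assms n ij pick[of ws vs j "\<lambda>y. f (vs ! i) y"] by simp
    finally show "?A $$ (i, j) = (?C * P ws vs) $$ (i, j)"
      using ij n by simp
  qed (auto simp: P_def n)
  then have "similar_mat_wit ?A ?B (P vs ws) (P ws vs)"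
    using PP[of vs ws] PP[of ws vs] assms n
    by (intro similar_mat_witI[where n = n]) (auto simp: P_def)
  then show ?thesis
    by (intro char_poly_similar) (auto simp: similar_mat_def)
qed

lemma laplacian_spectrum_eq:
  assumes "distinct vs" "set vs = pverts G"
  shows "laplacian_spectrum G =
    proots (char_poly (map_mat complex_of_real (laplacian_mat G vs)))"
proof -
  define f where "f u v = complex_of_real
    ((if u = v then real (out_degree (with_proj G) u) else 0) - (if (u, v) \<in> parcs G then 1 else 0))"
    for u v
  have L: "map_mat complex_of_real (laplacian_mat G xs) =
      mat (length xs) (length xs) (\<lambda>(i, j). f (xs ! i) (xs ! j))" if "distinct xs" for xs
    by (rule eq_matI)
      (use that in \<open>auto simp: laplacian_mat_def degree_mat_def adjacency_mat_def f_def
        nth_eq_iff_index_eq\<close>)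
  have "distinct (vertex_enum G) \<and> set (vertex_enum G) = pverts G"
    unfolding vertex_enum_def by (rule someI[of _ vs]) (use assms in simp)
  then show ?thesis
    using assms char_poly_reindex[of "vertex_enum G" vs f] by (simp add: laplacian_spectrum_def L)
qed

end

theory Submission
  imports Defs "Jordan_Normal_Form.Schur_Decomposition"
begin

text \<open>
  The Laplacian spectrum determines the number \<open>n\<close> of vertices, the traces of \<open>L\<close>, \<open>L\<^sup>2\<close>, \<open>L\<^sup>3\<close>, and
  the determinant \<open>\<tau>\<close> of the reduced Laplacian, which is nonzero iff the graph is connected. With
  \<open>D = 2s + k\<close> and \<open>t\<close> the number of triangles of \<open>H\<close>, the traces say that \<open>H\<close> has \<open>n - 1 + s\<close> edges and
  \<open>\<Sum> (d - 1)(d - 2) = (D - 1)(D - 2)\<close> and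
  \<open>\<Sum> (d - 1)(d - 2)(d - 3) - 6 t = (D - 1)(D - 2)(D - 3) - 6 s\<close>.
  If some vertex has degree \<open>D\<close>, all other degrees are \<open>1\<close> or \<open>2\<close> and \<open>t = s\<close>, so \<open>H\<close> consists of cycles
  and paths through that vertex, and the number of edges forces all cycles to be triangles.
  Otherwise all degrees are less than \<open>D\<close>, the cubic sum is at most \<open>(D - 4)(D - 1)(D - 2)\<close>, and
  \<open>(D - 1)(D - 2) \<le> 6 (s - t) \<le> 3 D\<close> leaves three cases:
  \<^item> \<open>D = 4\<close>, \<open>s = 1\<close>, \<open>t = 0\<close>: both graphs are unicyclic and \<open>\<tau>\<close> is the length of the cycle, which
    is \<open>3\<close> for \<open>G\<close> and at least \<open>4\<close> for \<open>H\<close>.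
  \<^item> \<open>D = 4\<close>, \<open>s = 2\<close>: here \<open>n = 5\<close> is an eigenvalue of \<open>G\<close>, but \<open>H\<close> has a leaf and its complement is
    connected.
  \<^item> \<open>D = 5\<close>, \<open>s = 2\<close>, \<open>t = 0\<close>: \<open>G\<close> has exactly one eigenvalue that is at least \<open>4\<close>, while \<open>H\<close> has two
    vertices of degree \<open>4\<close>, hence two such eigenvalues; so \<open>det (4 I - L)\<close> is negative for \<open>G\<close>, but not for \<open>H\<close>.
\<close>

section \<open>Determinants of matrices indexed by finite sets\<close>

text \<open>Statements about the order of eigenvalues are turned into signs of determinants. A Schur
  complement over vertices on which the quadratic form is positive definite keeps the sign of the
  determinant; what remains lives on one or two exceptional vertices, where test vectors decide.
  Vertices are eliminated one at a time, hence determinants indexed by finite sets rather than by an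
  enumeration.

  In the good case the edge count acts as a count of leaves: there are exactly \<open>k\<close>, so
  pruning leaf by leaf uses up the paths and ends with a center of degree \<open>2 s\<close> whose
  neighbours all lie in the \<open>s\<close> triangles. A longer cycle through the center has no
  room left. The isomorphism is rebuilt by putting the leaves back.

  In the unicyclic case a lower bound suffices for \<open>H\<close>: three tree edges on its cycle
  are exhibited, and the edge outside the tree is the fourth.\<close>

definition mat_on :: "'a list \<Rightarrow> ('a \<Rightarrow> 'a \<Rightarrow> 'b) \<Rightarrow> 'b mat" where
  "mat_on vs f = mat (length vs) (length vs) (\<lambda>(i, j). f (vs ! i) (vs ! j))"

definition set_det :: "'a set \<Rightarrow> ('a \<Rightarrow> 'a \<Rightarrow> 'b :: comm_ring_1) \<Rightarrow> 'b" where
  "set_det S f = det (mat_on (SOME vs. distinct vs \<and> set vs = S) f)"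

lemma mat_on_carrier [simp]: "mat_on vs f \<in> carrier_mat (length vs) (length vs)"
  by (simp add: mat_on_def)

lemma sum_nth_distinct:
  assumes "distinct vs"
  shows "(\<Sum>i = 0..<length vs. g (vs ! i)) = sum g (set vs)"
  by (rule sum.reindex_bij_betw[OF bij_betw_nth]) (use assms in auto)

lemma det_char_poly:
  fixes A :: "'b :: comm_ring_1 mat"
  assumes A: "A \<in> carrier_mat n n"
  shows "det A = (- 1) ^ n * poly (char_poly A) 0"
proof -
  have "poly (char_poly A) 0 = det ((- 1) \<cdot>\<^sub>m A)"
    unfolding char_poly_def
    by (rule poly_det_cong[of _ n]) (use A in \<open>auto simp: char_poly_matrix_def\<close>)
  also have "\<dots> = (- 1) ^ n * det A"
    using A by simp
  finally show ?thesis
    by (simp flip: power_mult_distrib add: mult.assoc[symmetric])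
qed

text \<open>Two enumerations of \<open>S\<close> have the same characteristic polynomial by
  \<open>char_poly_reindex\<close>, and the determinant is its constant term up to a sign depending
  on the size.\<close>

lemma set_det_eq:
  fixes f :: "'a \<Rightarrow> 'a \<Rightarrow> 'b :: comm_ring_1"
  assumes "distinct vs" "set vs = S"
  shows "set_det S f = det (mat_on vs f)"
proof -
  define ws where "ws = (SOME vs. distinct vs \<and> set vs = S)"
  have ws: "distinct ws" "set ws = S"
    using someI[of "\<lambda>vs. distinct vs \<and> set vs = S" vs] assms by (auto simp: ws_def)
  have len: "length ws = length vs"
    using ws assms by (metis distinct_card)
  have "char_poly (mat_on ws f) = char_poly (mat_on vs f)"
    unfolding mat_on_def using ws assms by (intro char_poly_reindex) auto
  then show ?thesis
    using det_char_poly[OF mat_on_carrier, of ws f] det_char_poly[OF mat_on_carrier, of vs f] len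
    by (simp add: set_det_def ws_def)
qed

lemma set_det_cong:
  assumes "\<And>i j. i \<in> S \<Longrightarrow> j \<in> S \<Longrightarrow> f i j = g i j" "finite S"
  shows "set_det S f = set_det S g"
proof -
  obtain vs where vs: "distinct vs" "set vs = S"
    using finite_distinct_list[OF assms(2)] by blast
  have "mat_on vs f = mat_on vs g"
    by (rule eq_matI) (use assms vs in \<open>auto simp: mat_on_def\<close>)
  then show ?thesis
    by (simp add: set_det_eq[OF vs])
qed

lemma set_det_empty [simp]: "set_det {} f = 1"
  using set_det_eq[of "[]" "{}" f] by (simp add: mat_on_def)

lemma mat_on_mult:
  assumes "distinct vs"
  shows "mat_on vs f * mat_on vs g = mat_on vs (\<lambda>i j. \<Sum>k\<in>set vs. f i k * g k j)"
proof (rule eq_matI)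
  fix i j assume "i < dim_row (mat_on vs (\<lambda>i j. \<Sum>k\<in>set vs. f i k * g k j))"
    "j < dim_col (mat_on vs (\<lambda>i j. \<Sum>k\<in>set vs. f i k * g k j))"
  then have "i < length vs" "j < length vs"
    by (auto simp: mat_on_def)
  then show "(mat_on vs f * mat_on vs g) $$ (i, j) = mat_on vs (\<lambda>i j. \<Sum>k\<in>set vs. f i k * g k j) $$ (i, j)"
    using sum_nth_distinct[OF assms, of "\<lambda>k. f (vs ! i) k * g k (vs ! j)"]
    by (simp add: mat_on_def scalar_prod_def)
qed (auto simp: mat_on_def)

lemma set_det_mult:
  assumes "finite S"
  shows "set_det S (\<lambda>i j. \<Sum>k\<in>S. f i k * g k j) = set_det S f * set_det S g"
proof -
  obtain vs where vs: "distinct vs" "set vs = S"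
    using finite_distinct_list[OF assms] by blast
  then have "mat_on vs (\<lambda>i j. \<Sum>k\<in>S. f i k * g k j) = mat_on vs f * mat_on vs g"
    using mat_on_mult[OF vs(1), of f g] by simp
  then show ?thesis
    by (simp add: set_det_eq[OF vs] det_mult[OF mat_on_carrier mat_on_carrier])
qed

lemma set_det_transpose:
  assumes "finite S"
  shows "set_det S (\<lambda>i j. f j i) = set_det S f"
proof -
  obtain vs where vs: "distinct vs" "set vs = S"
    using finite_distinct_list[OF assms] by blast
  have "mat_on vs (\<lambda>i j. f j i) = transpose_mat (mat_on vs f)"
    by (rule eq_matI) (auto simp: mat_on_def)
  then show ?thesis
    by (simp add: set_det_eq[OF vs] det_transpose[OF mat_on_carrier])
qed

text \<open>Sorting by \<open>r\<close> makes the matrix upper triangular. A rank function, unlike a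
  fixed order, covers both elementary matrices (two ranks) and trees (the depth).\<close>

lemma set_det_triangular:
  fixes r :: "'a \<Rightarrow> nat"
  assumes "finite S" and "\<And>i j. i \<in> S \<Longrightarrow> j \<in> S \<Longrightarrow> i \<noteq> j \<Longrightarrow> f i j \<noteq> 0 \<Longrightarrow> r i < r j"
  shows "set_det S f = (\<Prod>i\<in>S. f i i)"
proof -
  obtain us where us: "distinct us" "set us = S"
    using finite_distinct_list[OF assms(1)] by blast
  define vs where "vs = sort_key r us"
  have vs: "distinct vs" "set vs = S"
    using us by (auto simp: vs_def)
  have sorted: "sorted (map r vs)"
    by (simp add: vs_def)
  have "upper_triangular (mat_on vs f)"
  proof (rule upper_triangularI)
    fix i j assume ij: "j < i" "i < dim_row (mat_on vs f)"
    then have l: "i < length vs" "j < length vs"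
      by (auto simp: mat_on_def)
    have "r (vs ! j) \<le> r (vs ! i)"
      using sorted l ij(1) by (metis length_map less_imp_le nth_map sorted_nth_mono)
    moreover have "vs ! i \<noteq> vs ! j"
      using vs(1) l ij(1) by (simp add: nth_eq_iff_index_eq)
    ultimately show "mat_on vs f $$ (i, j) = 0"
      using assms(2)[of "vs ! i" "vs ! j"] l vs(2) by (force simp: mat_on_def)
  qed
  then have "det (mat_on vs f) = prod_list (diag_mat (mat_on vs f))"
    using det_upper_triangular mat_on_carrier by blast
  also have "diag_mat (mat_on vs f) = map (\<lambda>v. f v v) vs"
    by (rule nth_equalityI) (auto simp: diag_mat_def mat_on_def)
  also have "prod_list \<dots> = (\<Prod>i\<in>S. f i i)"
    using vs prod.distinct_set_conv_list[of vs "\<lambda>v. f v v"] by simp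
  finally show ?thesis
    by (simp add: set_det_eq[OF vs])
qed

lemma set_det_insert_zero_column:
  fixes f :: "'a \<Rightarrow> 'a \<Rightarrow> 'b :: idom"
  assumes "finite S" "l \<notin> S" "\<And>i. i \<in> S \<Longrightarrow> f i l = 0"
  shows "set_det (insert l S) f = f l l * set_det S f"
proof -
  obtain vs where vs: "distinct vs" "set vs = S"
    using finite_distinct_list[OF assms(1)] by blast
  define n where "n = length vs"
  have "mat_on (l # vs) f = four_block_mat (mat 1 1 (\<lambda>_. f l l)) (mat 1 n (\<lambda>(_, j). f l (vs ! j)))
      (0\<^sub>m n 1) (mat_on vs f)"
    by (rule eq_matI)
      (use assms(3) vs in \<open>auto simp: mat_on_def n_def nth_Cons' less_Suc_eq_0_disj\<close>)
  also have "det \<dots> = det (mat 1 1 (\<lambda>_. f l l)) * det (mat_on vs f)"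
    by (rule det_four_block_mat_lower_left_zero[where n = 1 and m = n]) (auto simp: n_def mat_on_def)
  also have "det (mat 1 1 (\<lambda>_. f l l)) = f l l"
    by (simp add: det_single)
  finally show ?thesis
    using set_det_eq[of "l # vs" "insert l S" f] set_det_eq[OF vs, of f] vs assms(2) by simp
qed

text \<open>One step of Gaussian elimination: the matrix \<open>E\<close>, of determinant 1,
  subtracts multiples of row \<open>l\<close> from the other rows, so that the product
  \<open>g\<close> has a zero column below the pivot.\<close>

lemma set_det_schur:
  fixes f :: "'a \<Rightarrow> 'a \<Rightarrow> 'b :: field"
  assumes S: "finite S" "l \<notin> S" and nz: "f l l \<noteq> 0"
  shows "set_det (insert l S) f = f l l * set_det S (\<lambda>i j. f i j - f i l * f l j / f l l)"
proof -
  define E where "E i j = (if i = j then 1 else if j = l then - f i l / f l l else 0)" for i j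
  define g where "g i j = (if i = l then f l j else f i j - f i l * f l j / f l l)" for i j
  let ?T = "insert l S"
  have T: "finite ?T" using S by simp
  have "set_det ?T (\<lambda>i j. E j i) = (\<Prod>i\<in>?T. E i i)"
    by (rule set_det_triangular[OF T, where r = "\<lambda>i. if i = l then 0 else 1"])
      (auto simp: E_def split: if_splits)
  then have E: "set_det ?T E = 1"
    using set_det_transpose[OF T, of E] by (simp add: E_def)
  have "set_det ?T g = set_det ?T (\<lambda>i j. \<Sum>k\<in>?T. E i k * f k j)"
  proof (rule set_det_cong[OF _ T])
    fix i j assume i: "i \<in> ?T" and "j \<in> ?T"
    have "(\<Sum>k\<in>S. E i k * f k j) = (\<Sum>k\<in>S. if k = i then f k j else 0)"
      using S by (intro sum.cong) (auto simp: E_def)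
    also have "\<dots> = (if i \<in> S then f i j else 0)"
      using S by simp
    finally show "g i j = (\<Sum>k\<in>?T. E i k * f k j)"
      using S i by (auto simp: g_def E_def)
  qed
  also have "\<dots> = set_det ?T f"
    using set_det_mult[OF T, of E f] E by simp
  finally have "set_det ?T f = set_det ?T g" by simp
  also have "\<dots> = g l l * set_det S g"
    by (rule set_det_insert_zero_column) (use S nz in \<open>auto simp: g_def\<close>)
  also have "set_det S g = set_det S (\<lambda>i j. f i j - f i l * f l j / f l l)"
    by (rule set_det_cong) (use S in \<open>auto simp: g_def\<close>)
  finally show ?thesis by (simp add: g_def)
qed

lemma set_det_eq_0_iff:
  fixes f :: "'a \<Rightarrow> 'a \<Rightarrow> 'b :: field"
  assumes "finite S"
  shows "set_det S f = 0 \<longleftrightarrow> (\<exists>x. (\<exists>i\<in>S. x i \<noteq> 0) \<and> (\<forall>i\<in>S. (\<Sum>j\<in>S. f i j * x j) = 0))"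
proof -
  obtain vs where vs: "distinct vs" "set vs = S"
    using finite_distinct_list[OF assms] by blast
  let ?n = "length vs"
  have mult: "(mat_on vs f *\<^sub>v v) $ i = (\<Sum>j\<in>S. f (vs ! i) j * x j)"
    if "i < ?n" "dim_vec v = ?n" "\<And>j. j < ?n \<Longrightarrow> x (vs ! j) = v $ j" for v x i
  proof -
    have "(mat_on vs f *\<^sub>v v) $ i = (\<Sum>j = 0..<?n. f (vs ! i) (vs ! j) * v $ j)"
      using that(1,2) by (simp add: mat_on_def scalar_prod_def)
    also have "\<dots> = (\<Sum>j = 0..<?n. f (vs ! i) (vs ! j) * x (vs ! j))"
      using that(3) by (intro sum.cong) auto
    finally show ?thesis
      using sum_nth_distinct[OF vs(1), of "\<lambda>j. f (vs ! i) j * x j"] vs(2) by simp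
  qed
  have "set_det S f = 0 \<longleftrightarrow> (\<exists>v. v \<in> carrier_vec ?n \<and> v \<noteq> 0\<^sub>v ?n \<and> mat_on vs f *\<^sub>v v = 0\<^sub>v ?n)"
    using set_det_eq[OF vs, of f] det_0_iff_vec_prod_zero_field[OF mat_on_carrier, of vs f] by simp
  also have "\<dots> \<longleftrightarrow> (\<exists>x. (\<exists>i\<in>S. x i \<noteq> 0) \<and> (\<forall>i\<in>S. (\<Sum>j\<in>S. f i j * x j) = 0))"
  proof (intro iffI; elim exE conjE)
    fix v assume v: "v \<in> carrier_vec ?n" "v \<noteq> 0\<^sub>v ?n" "mat_on vs f *\<^sub>v v = 0\<^sub>v ?n"
    define x where "x a = v $ (THE j. j < ?n \<and> vs ! j = a)" for a
    have x: "x (vs ! j) = v $ j" if "j < ?n" for j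
    proof -
      have "(THE i. i < ?n \<and> vs ! i = vs ! j) = j"
        using that nth_eq_iff_index_eq[OF vs(1)] by (intro the_equality) blast+
      then show ?thesis by (simp add: x_def)
    qed
    obtain j where j: "j < ?n" "v $ j \<noteq> 0"
      using v(1,2) unfolding vec_eq_iff by auto
    have "(\<Sum>j\<in>S. f i j * x j) = 0" if i: "i \<in> S" for i
    proof -
      obtain k where k: "k < ?n" "i = vs ! k"
        using i vs(2) by (auto simp: in_set_conv_nth)
      have "(\<Sum>j\<in>S. f i j * x j) = (mat_on vs f *\<^sub>v v) $ k"
        unfolding k(2) by (rule mult[OF k(1) _ x, symmetric]) (use v(1) in auto)
      then show ?thesis
        using v(3) k(1) by simp
    qed
    moreover have "vs ! j \<in> S" "x (vs ! j) \<noteq> 0"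
      using j nth_mem[OF j(1)] vs(2) x[OF j(1)] by simp_all
    ultimately show "\<exists>x. (\<exists>i\<in>S. x i \<noteq> 0) \<and> (\<forall>i\<in>S. (\<Sum>j\<in>S. f i j * x j) = 0)"
      by blast
  next
    fix x assume x: "\<exists>i\<in>S. x i \<noteq> 0" "\<forall>i\<in>S. (\<Sum>j\<in>S. f i j * x j) = 0"
    let ?v = "vec ?n (\<lambda>i. x (vs ! i))"
    obtain i where "i < ?n" "x (vs ! i) \<noteq> 0"
      using x(1) vs(2) by (auto simp: in_set_conv_nth)
    then have "?v \<noteq> 0\<^sub>v ?n"
      by (auto simp: vec_eq_iff)
    moreover have "mat_on vs f *\<^sub>v ?v = 0\<^sub>v ?n"
    proof (rule eq_vecI)
      fix i assume "i < dim_vec (0\<^sub>v ?n :: 'b vec)"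
      then show "(mat_on vs f *\<^sub>v ?v) $ i = 0\<^sub>v ?n $ i"
        using mult[of i ?v x] x(2) vs(2) nth_mem[of i vs] by simp
    qed (simp add: mat_on_def)
    ultimately show "\<exists>v. v \<in> carrier_vec ?n \<and> v \<noteq> 0\<^sub>v ?n \<and> mat_on vs f *\<^sub>v v = 0\<^sub>v ?n"
      by (intro exI[of _ ?v]) simp
  qed
  finally show ?thesis .
qed

text \<open>The matrix determinant lemma. The factor \<open>t\<close> makes the induction work:
  eliminating \<open>l\<close> yields a matrix of the same shape with
  \<open>t / (1 + t * (y l * y l))\<close> in place of \<open>t\<close>, and
  \<open>0 \<le> t\<close> keeps the pivot positive.\<close>

lemma set_det_identity_plus_rank_one:
  fixes y :: "'a \<Rightarrow> real"
  assumes "finite S" "0 \<le> t"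
  shows "set_det S (\<lambda>i j. (if i = j then 1 else 0) + t * (y i * y j)) = 1 + t * (\<Sum>i\<in>S. (y i)\<^sup>2)"
  using assms
proof (induction S arbitrary: t rule: finite_induct)
  case (insert l S)
  let ?a = "1 + t * (y l * y l)"
  have a: "?a > 0"
    using insert.prems by (smt (verit) mult_nonneg_nonneg zero_le_square)
  have "set_det (insert l S) (\<lambda>i j. (if i = j then 1 else 0) + t * (y i * y j)) =
      ?a * set_det S (\<lambda>i j. (if i = j then 1 else 0) + t * (y i * y j) -
        ((if i = l then 1 else 0) + t * (y i * y l)) * ((if l = j then 1 else 0) + t * (y l * y j)) / ?a)"
    using set_det_schur[OF insert.hyps, of "\<lambda>i j. (if i = j then 1 else 0) + t * (y i * y j)"] a by simp
  also have "set_det S (\<lambda>i j. (if i = j then 1 else 0) + t * (y i * y j) -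
        ((if i = l then 1 else 0) + t * (y i * y l)) * ((if l = j then 1 else 0) + t * (y l * y j)) / ?a) =
      set_det S (\<lambda>i j. (if i = j then 1 else 0) + t / ?a * (y i * y j))"
  proof (rule set_det_cong[OF _ insert.hyps(1)])
    fix i j assume "i \<in> S" "j \<in> S"
    then have "i \<noteq> l" "j \<noteq> l"
      using insert.hyps by auto
    moreover have "t * (y i * y j) - t * (y i * y l) * (t * (y l * y j)) / ?a = t / ?a * (y i * y j)"
      using a by (simp add: field_simps)
    ultimately show "(if i = j then 1 else 0) + t * (y i * y j) -
        ((if i = l then 1 else 0) + t * (y i * y l)) * ((if l = j then 1 else 0) + t * (y l * y j)) / ?a =
        (if i = j then 1 else 0) + t / ?a * (y i * y j)"
      by simp
  qed
  also have "\<dots> = 1 + t / ?a * (\<Sum>i\<in>S. (y i)\<^sup>2)"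
    using insert.prems a by (intro insert.IH) simp
  finally have "set_det (insert l S) (\<lambda>i j. (if i = j then 1 else 0) + t * (y i * y j)) =
      ?a * (1 + t / ?a * (\<Sum>i\<in>S. (y i)\<^sup>2))" .
  also have "\<dots> = ?a + t * (\<Sum>i\<in>S. (y i)\<^sup>2)"
    using a by (simp add: distrib_left)
  finally show ?case
    using insert.hyps by (simp add: power2_eq_square distrib_left)
qed simp

section \<open>Symmetric matrices and quadratic forms\<close>

definition quad_form :: "'a set \<Rightarrow> ('a \<Rightarrow> 'a \<Rightarrow> real) \<Rightarrow> ('a \<Rightarrow> real) \<Rightarrow> real" where
  "quad_form S f x = (\<Sum>i\<in>S. \<Sum>j\<in>S. f i j * x i * x j)"

lemma quad_form_insert:
  assumes "finite S" "l \<notin> S" and sym: "\<forall>i\<in>S. f i l = f l i"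
  shows "quad_form (insert l S) f x =
    f l l * (x l)\<^sup>2 + 2 * x l * (\<Sum>j\<in>S. f l j * x j) + quad_form S f x"
proof -
  have "(\<Sum>i\<in>S. f i l * x i * x l) = x l * (\<Sum>i\<in>S. f l i * x i)"
    unfolding sum_distrib_left by (intro sum.cong) (auto simp: sym)
  moreover have "(\<Sum>j\<in>S. f l j * x l * x j) = x l * (\<Sum>i\<in>S. f l i * x i)"
    unfolding sum_distrib_left by (intro sum.cong) auto
  ultimately show ?thesis
    using assms(1,2) by (simp add: quad_form_def sum.distrib power2_eq_square)
qed

text \<open>Completing the square in the variable that is eliminated.\<close>

lemma quad_form_schur:
  assumes "finite S" "l \<notin> S" "\<forall>i\<in>S. f i l = f l i" and nz: "f l l \<noteq> 0"
  shows "quad_form (insert l S) f x =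
    f l l * (x l + (\<Sum>j\<in>S. f l j * x j) / f l l)\<^sup>2 +
    quad_form S (\<lambda>i j. f i j - f i l * f l j / f l l) x"
proof -
  let ?\<sigma> = "\<Sum>j\<in>S. f l j * x j"
  have "(\<Sum>i\<in>S. \<Sum>j\<in>S. f i l * f l j / f l l * x i * x j) = (\<Sum>i\<in>S. \<Sum>j\<in>S. (f l i * x i) * (f l j * x j) / f l l)"
    using assms(3) by (intro sum.cong) auto
  also have "\<dots> = ?\<sigma> * ?\<sigma> / f l l"
    by (simp add: sum_product sum_divide_distrib)
  finally have "quad_form S (\<lambda>i j. f i j - f i l * f l j / f l l) x = quad_form S f x - ?\<sigma> * ?\<sigma> / f l l"
    by (simp add: quad_form_def left_diff_distrib sum_subtractf)
  then show ?thesis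
    using nz by (simp add: quad_form_insert[where f = f, OF assms(1-3)] power2_sum)
      (simp add: power2_eq_square algebra_simps)
qed

definition pos_def_on :: "'a set \<Rightarrow> ('a \<Rightarrow> 'a \<Rightarrow> real) \<Rightarrow> bool" where
  "pos_def_on S f \<longleftrightarrow> (\<forall>x. (\<exists>i\<in>S. x i \<noteq> 0) \<longrightarrow> quad_form S f x > 0)"

definition symmetric_on :: "'a set \<Rightarrow> ('a \<Rightarrow> 'a \<Rightarrow> 'b) \<Rightarrow> bool" where
  "symmetric_on S f \<longleftrightarrow> (\<forall>i\<in>S. \<forall>j\<in>S. f i j = f j i)"

lemma quad_form_cong:
  "(\<And>i. i \<in> S \<Longrightarrow> x i = y i) \<Longrightarrow> quad_form S f x = quad_form S f y"
  unfolding quad_form_def by (intro sum.cong refl) auto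

lemma pos_def_on_diag:
  assumes "finite S" "l \<notin> S" "pos_def_on (insert l S) f"
  shows "f l l > 0"
proof -
  have "quad_form (insert l S) f (\<lambda>i. if i = l then 1 else 0) = (\<Sum>i\<in>insert l S. if i = l then f l l else 0)"
    unfolding quad_form_def using assms(1) by (intro sum.cong) (auto simp: if_distrib cong: if_cong)
  then have "quad_form (insert l S) f (\<lambda>i. if i = l then 1 else 0) = f l l"
    using assms(1) by simp
  then show ?thesis
    using assms(3) unfolding pos_def_on_def
    by (metis (mono_tags, lifting) insertI1 zero_neq_one)
qed

text \<open>Choosing the value at \<open>l\<close> so that the completed square vanishes, the Schur
  complement at \<open>x\<close> becomes the original form at the extended vector
  \<open>x'\<close>.\<close>

lemma pos_def_on_schur:
  assumes S: "finite S" "l \<notin> S" and sym: "\<forall>i\<in>S. f i l = f l i"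
    and pd: "pos_def_on (insert l S) f"
  shows "pos_def_on S (\<lambda>i j. f i j - f i l * f l j / f l l)"
  unfolding pos_def_on_def
proof (intro allI impI)
  fix x assume x: "\<exists>i\<in>S. x i \<noteq> (0 :: real)"
  have nz: "f l l \<noteq> 0"
    using pos_def_on_diag[OF S pd] by simp
  define x' where "x' = x(l := - (\<Sum>j\<in>S. f l j * x j) / f l l)"
  have "(\<Sum>j\<in>S. f l j * x' j) = (\<Sum>j\<in>S. f l j * x j)"
    using S by (intro sum.cong) (auto simp: x'_def)
  then have "quad_form (insert l S) f x' = quad_form S (\<lambda>i j. f i j - f i l * f l j / f l l) x'"
    by (simp add: quad_form_schur[where f = f, OF S sym nz]) (simp add: x'_def)
  also have "\<dots> = quad_form S (\<lambda>i j. f i j - f i l * f l j / f l l) x"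
    using S by (intro quad_form_cong) (auto simp: x'_def)
  finally have "quad_form S (\<lambda>i j. f i j - f i l * f l j / f l l) x = quad_form (insert l S) f x'" ..
  moreover have "\<exists>i\<in>insert l S. x' i \<noteq> 0"
    using x S by (auto simp: x'_def)
  ultimately show "0 < quad_form S (\<lambda>i j. f i j - f i l * f l j / f l l) x"
    using pd by (simp add: pos_def_on_def)
qed

text \<open>Eliminating \<open>S\<close> leaves a symmetric form on \<open>T\<close> whose value at \<open>x\<close> is the minimum of the
  original form over all extensions of \<open>x\<close> to \<open>S\<close>.\<close>

lemma set_det_eliminate_pos_def:
  assumes "finite S" "finite T" "S \<inter> T = {}" "symmetric_on (S \<union> T) f" "pos_def_on S f"
  shows "\<exists>a g. a > 0 \<and> symmetric_on T g \<and> set_det (S \<union> T) f = a * set_det T g \<and>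
    (\<forall>x. quad_form T g x \<le> quad_form (S \<union> T) f x)"
  using assms(1,3,4,5)
proof (induction S arbitrary: f rule: finite_induct)
  case empty
  then show ?case by (intro exI[of _ "1 :: real"] exI[of _ f]) simp
next
  case (insert l S)
  let ?U = "S \<union> T"
  let ?h = "\<lambda>i j. f i j - f i l * f l j / f l l"
  have U: "finite ?U" "l \<notin> ?U"
    using insert.hyps insert.prems(1) assms(2) by auto
  have sym: "\<forall>i\<in>?U. f i l = f l i"
    using insert.prems(2) unfolding symmetric_on_def by blast
  have pos: "f l l > 0"
    using pos_def_on_diag[OF insert.hyps insert.prems(3)] .
  have "symmetric_on ?U ?h"
    unfolding symmetric_on_def
  proof (intro ballI)
    fix i j assume ij: "i \<in> ?U" "j \<in> ?U"
    have eqs: "f i j = f j i" "f i l = f l i" "f j l = f l j"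
      using insert.prems(2) sym ij unfolding symmetric_on_def by blast+
    have "f i l * f l j = f j l * f l i"
      unfolding eqs(2,3) by (rule mult.commute)
    then show "?h i j = ?h j i"
      using eqs(1) by (simp only:)
  qed
  moreover have "pos_def_on S ?h"
    using sym by (intro pos_def_on_schur[OF insert.hyps _ insert.prems(3)]) blast
  ultimately obtain a g where ag: "a > 0" "symmetric_on T g" "set_det ?U ?h = a * set_det T g"
    "\<And>x. quad_form T g x \<le> quad_form ?U ?h x"
  proof -
    have "S \<inter> T = {}" using insert.prems(1) by blast
    from insert.IH[OF this \<open>symmetric_on ?U ?h\<close> \<open>pos_def_on S ?h\<close>] show thesis
      using that by blast
  qed
  have nz: "f l l \<noteq> 0" using pos by simp
  have "quad_form T g x \<le> quad_form (insert l ?U) f x" for x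
  proof -
    have "0 \<le> f l l * (x l + (\<Sum>j\<in>?U. f l j * x j) / f l l)\<^sup>2"
      using pos by simp
    then show ?thesis
      unfolding quad_form_schur[where f = f, OF U sym nz] using ag(4)[of x] by linarith
  qed
  moreover have "set_det (insert l ?U) f = (f l l * a) * set_det T g"
    unfolding set_det_schur[where f = f, OF U nz] ag(3) by (rule mult.assoc[symmetric])
  moreover have "f l l * a > 0"
    using ag(1) pos by simp
  ultimately show ?case
    using ag(2) unfolding Un_insert_left by blast
qed

lemma set_det_pos_def:
  assumes "finite S" "symmetric_on S f" "pos_def_on S f"
  shows "set_det S f > 0"
  using set_det_eliminate_pos_def[of S "{}" f] assms by auto

lemma set_det_single [simp]: "set_det {a} f = f a a"
  using set_det_eq[of "[a]" "{a}" f] by (simp add: mat_on_def det_single)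

text \<open>Eliminating \<open>S\<close> leaves a single entry \<open>g c c\<close>, up to a
  positive factor. The reduced form is a lower bound for the original one, so the negative direction
  forces \<open>g c c < 0\<close>.\<close>

lemma set_det_one_negative_direction:
  assumes "finite S" "c \<notin> S" "symmetric_on (insert c S) f" "pos_def_on S f" "quad_form (insert c S) f x < 0"
  shows "set_det (insert c S) f < 0"
proof -
  obtain a g where g: "a > 0" "set_det (insert c S) f = a * g c c" "quad_form {c} g x < 0"
  proof -
    obtain a g where g: "a > 0" "set_det (S \<union> {c}) f = a * set_det {c} g"
      "\<forall>x. quad_form {c} g x \<le> quad_form (S \<union> {c}) f x"
      using set_det_eliminate_pos_def[of S "{c}" f] assms(1-4)
      by (auto simp only: Un_insert_right Un_empty_right finite.intros Int_insert_right Int_empty_right if_False)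
    then show thesis
      using that[of a g] assms(5) order.strict_trans1[of "quad_form {c} g x" "quad_form (insert c S) f x" 0]
      by simp
  qed
  then have "g c c * (x c)\<^sup>2 < 0"
    by (simp add: quad_form_def power2_eq_square mult.assoc)
  then have "g c c < 0"
    by (simp add: mult_less_0_iff)
  then show ?thesis
    using g by (simp add: mult_pos_neg)
qed

text \<open>Eliminating \<open>S\<close> leaves a symmetric 2 x 2 matrix. By \<open>ext\<close> its
  form is nonpositive at every pair of values, so it is negative semidefinite and has a nonnegative
  determinant.\<close>

lemma set_det_two_nonpositive_directions:
  assumes "finite S" "u \<notin> S" "w \<notin> S" "u \<noteq> w" "symmetric_on (insert u (insert w S)) f" "pos_def_on S f"
    and ext: "\<And>p q. \<exists>x. x u = p \<and> x w = q \<and> quad_form (insert u (insert w S)) f x \<le> 0"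
  shows "set_det (insert u (insert w S)) f \<ge> 0"
proof -
  have U: "S \<union> {u, w} = insert u (insert w S)" by auto
  obtain a g where g: "a > 0" "symmetric_on {u, w} g" "set_det (insert u (insert w S)) f = a * set_det {u, w} g"
    "\<And>x. quad_form {u, w} g x \<le> quad_form (insert u (insert w S)) f x"
  proof -
    have "finite {u, w}" "S \<inter> {u, w} = {}"
      using assms(2,3) by auto
    from set_det_eliminate_pos_def[OF assms(1) this, unfolded U, OF assms(5,6)] show thesis
      using that by blast
  qed
  have sym: "g w u = g u w"
    using g(2) unfolding symmetric_on_def by blast
  have nonpos: "g u u * p\<^sup>2 + 2 * g u w * p * q + g w w * q\<^sup>2 \<le> 0" for p q
  proof -
    obtain x where "x u = p" "x w = q" "quad_form (insert u (insert w S)) f x \<le> 0"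
      using ext by blast
    then show ?thesis
      using g(4)[of x] assms(4) sym by (simp add: quad_form_def power2_eq_square algebra_simps)
  qed
  have "set_det {u, w} g \<ge> 0"
  proof (cases "g u u = 0")
    case True
    have "g u w = 0"
    proof (rule ccontr)
      assume "g u w \<noteq> 0"
      \<comment> \<open>With \<open>g u u = 0\<close> the form is affine in \<open>p\<close> for
        \<open>q = 1\<close>; this \<open>p\<close> gives it the value 1.\<close>
      then show False
        using nonpos[of "(1 - g w w) / (2 * g u w)" 1] True by simp
    qed
    then show ?thesis
      using True sym assms(4) set_det_insert_zero_column[of "{w}" u g] by simp
  next
    case False
    then have neg: "g u u < 0"
      using nonpos[of 1 0] by simp
    \<comment> \<open>At \<open>(- g u w, g u u)\<close> the form equals \<open>g u u\<close> times
      the determinant.\<close>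
    have "g u u * (g u u * g w w - g u w * g u w) \<le> 0"
      using nonpos[of "- g u w" "g u u"] by (simp add: power2_eq_square algebra_simps)
    then have "g u u * g w w - g u w * g u w \<ge> 0"
      using neg by (simp add: mult_le_0_iff)
    then show ?thesis
      using False sym assms(4) set_det_schur[of "{w}" u g] by (simp add: right_diff_distrib)
  qed
  then show ?thesis
    using g(1,3) by simp
qed

section \<open>Power sums of the spectrum\<close>

lemma proots_prod_list_linear: "proots (\<Prod>a\<leftarrow>as. [:- a, 1:]) = mset (as :: complex list)"
proof (induction as)
  case (Cons a as)
  have "(\<Prod>a\<leftarrow>as. [:- a, 1:]) \<noteq> 0"
    by (auto simp: prod_list_zero_iff)
  then have "proots ([:- a, 1:] * (\<Prod>a\<leftarrow>as. [:- a, 1:])) = proots [:- a, 1:] + proots (\<Prod>a\<leftarrow>as. [:- a, 1:])"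
    by (intro proots_mult) auto
  then show ?case
    using Cons by simp
qed simp

lemma char_poly_eq_prod_proots:
  fixes A :: "complex mat"
  assumes "A \<in> carrier_mat n n"
  shows "char_poly A = (\<Prod>a\<in>#proots (char_poly A). [:- a, 1:])"
proof -
  obtain as where "char_poly A = (\<Prod>a\<leftarrow>as. [:- a, 1:])"
    using char_poly_factorized[OF assms] by blast
  then show ?thesis
    using proots_prod_list_linear[of as] by (metis mset_map prod_mset_prod_list)
qed

definition mat_trace :: "'b :: comm_ring_1 mat \<Rightarrow> 'b" where
  "mat_trace A = (\<Sum>i = 0..<dim_row A. A $$ (i, i))"

lemma mat_trace_mult_commute:
  assumes "A \<in> carrier_mat n n" "B \<in> carrier_mat n n"
  shows "mat_trace (A * B) = mat_trace (B * A)"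
proof -
  have "mat_trace (A * B) = (\<Sum>i = 0..<n. \<Sum>j = 0..<n. A $$ (i, j) * B $$ (j, i))"
    using assms by (simp add: mat_trace_def scalar_prod_def)
  also have "\<dots> = (\<Sum>j = 0..<n. \<Sum>i = 0..<n. B $$ (j, i) * A $$ (i, j))"
    by (subst sum.swap) (simp add: mult.commute)
  also have "\<dots> = mat_trace (B * A)"
    using assms by (simp add: mat_trace_def scalar_prod_def)
  finally show ?thesis .
qed

lemma mat_trace_similar:
  assumes "similar_mat_wit A B P Q"
  shows "mat_trace A = mat_trace B"
proof -
  define n where "n = dim_row A"
  note w = similar_mat_witD[OF n_def assms]
  have "mat_trace A = mat_trace (P * (B * Q))"
    using w by (simp add: assoc_mult_mat[of _ n n _ n _ n])
  also have "\<dots> = mat_trace ((B * Q) * P)"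
    using w by (intro mat_trace_mult_commute[of _ n]) auto
  also have "(B * Q) * P = B"
    using w by (simp add: assoc_mult_mat[of _ n n _ n _ n])
  finally show ?thesis .
qed

lemma upper_triangular_power:
  fixes B :: "'b :: comm_ring_1 mat"
  assumes "upper_triangular B" "B \<in> carrier_mat n n"
  shows "upper_triangular (B ^\<^sub>m k) \<and> (\<forall>i<n. (B ^\<^sub>m k) $$ (i, i) = (B $$ (i, i)) ^ k)"
proof (induction k)
  case 0
  then show ?case using assms by auto
next
  case (Suc k)
  have c: "B ^\<^sub>m k \<in> carrier_mat n n"
    using assms by simp
  have entry: "(B ^\<^sub>m Suc k) $$ (i, j) = (\<Sum>l = 0..<n. (B ^\<^sub>m k) $$ (i, l) * B $$ (l, j))"
    if "i < n" "j < n" for i j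
    using that assms c by (simp add: scalar_prod_def)
  have zero: "(B ^\<^sub>m k) $$ (i, l) * B $$ (l, j) = 0" if "i < n" "l < n" "l < i \<or> j < l" for i j l
    using that Suc assms c by (auto simp: upper_triangular_def)
  have "(B ^\<^sub>m Suc k) $$ (i, j) = 0" if "j < i" "i < n" for i j
    unfolding entry[OF that(2) less_trans[OF that]] using that zero[OF that(2)]
    by (intro sum.neutral ballI) (metis atLeastLessThan_iff less_trans linorder_neqE_nat)
  moreover have "(B ^\<^sub>m Suc k) $$ (i, i) = (B $$ (i, i)) ^ Suc k" if "i < n" for i
  proof -
    have "(\<Sum>l = 0..<n. (B ^\<^sub>m k) $$ (i, l) * B $$ (l, i)) =
        (\<Sum>l = 0..<n. if l = i then (B ^\<^sub>m k) $$ (i, i) * B $$ (i, i) else 0)"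
      using zero[OF that] by (intro sum.cong refl) (metis atLeastLessThan_iff linorder_neqE_nat)
    then show ?thesis
      using that Suc entry[OF that that] by (simp add: mult.commute)
  qed
  ultimately show ?case
    using assms c by (auto simp: upper_triangular_def)
qed

text \<open>By Schur triangularization \<open>A\<close> is similar to a triangular matrix with the
  eigenvalues on its diagonal. Powers respect the similarity and act entrywise on this
  diagonal.\<close>

lemma mat_trace_power_eq_sum_proots:
  fixes A :: "complex mat"
  assumes A: "A \<in> carrier_mat n n"
  shows "mat_trace (A ^\<^sub>m k) = (\<Sum>a\<in>#proots (char_poly A). a ^ k)"
proof -
  obtain as where as: "char_poly A = (\<Prod>a\<leftarrow>as. [:- a, 1:])"
    using char_poly_factorized[OF A] by blast
  obtain B P Q where "schur_decomposition A as = (B, P, Q)"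
    by (metis prod_cases3)
  then have B: "similar_mat_wit A B P Q" "upper_triangular B" "diag_mat B = as"
    using schur_decomposition[OF A as] by auto
  have cB: "B \<in> carrier_mat n n"
    using similar_mat_witD2[OF A B(1)] by simp
  have "mat_trace (A ^\<^sub>m k) = mat_trace (B ^\<^sub>m k)"
    using mat_trace_similar[OF similar_mat_wit_pow[OF B(1)]] .
  also have "\<dots> = (\<Sum>i = 0..<n. (B $$ (i, i)) ^ k)"
    unfolding mat_trace_def using upper_triangular_power[OF B(2) cB, of k] cB by (intro sum.cong) auto
  also have "\<dots> = (\<Sum>a\<leftarrow>as. a ^ k)"
    unfolding B(3)[symmetric] diag_mat_def using cB by (simp add: sum_list_sum_nth atLeast0LessThan)
  also have "\<dots> = (\<Sum>a\<in>#mset as. a ^ k)"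
    by (metis mset_map sum_mset_sum_list)
  finally show ?thesis
    by (simp add: as proots_prod_list_linear)
qed

lemma mat_trace_mat_on:
  assumes "distinct vs"
  shows "mat_trace (mat_on vs f) = (\<Sum>v\<in>set vs. f v v)"
  using sum_nth_distinct[OF assms, of "\<lambda>v. f v v"] by (simp add: mat_trace_def mat_on_def)

lemma det_map_of_real: "det (map_mat complex_of_real A) = complex_of_real (det A)"
proof -
  have "complex_of_real (signof p) = signof p" for p :: "nat \<Rightarrow> nat"
    by (simp add: sign_def)
  then show ?thesis
    by (cases "dim_row A = dim_col A") (auto simp: det_def intro!: sum.cong prod.cong)
qed

text \<open>The Leibniz formula is a polynomial in the entries. Continuity gives access to the
  reduced determinant as a limit at the eigenvalue 0.\<close>

lemma tendsto_set_det:
  fixes F :: "'c \<Rightarrow> 'a \<Rightarrow> 'a \<Rightarrow> real"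
  assumes "finite S" and lim: "\<And>i j. i \<in> S \<Longrightarrow> j \<in> S \<Longrightarrow> ((\<lambda>x. F x i j) \<longlongrightarrow> G i j) L"
  shows "((\<lambda>x. set_det S (F x)) \<longlongrightarrow> set_det S G) L"
proof -
  obtain vs where vs: "distinct vs" "set vs = S"
    using finite_distinct_list[OF assms(1)] by blast
  show ?thesis
    unfolding set_det_eq[OF vs] det_def'[OF mat_on_carrier]
  proof (intro tendsto_sum tendsto_mult tendsto_const tendsto_prod)
    fix p i assume "p \<in> {p. p permutes {0..<length vs}}" "i \<in> {0..<length vs}"
    then have "i < length vs" "p i < length vs"
      using permutes_in_image[of p "{0..<length vs}" i] by auto
    then show "((\<lambda>x. mat_on vs (F x) $$ (i, p i)) \<longlongrightarrow> mat_on vs G $$ (i, p i)) L"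
      using lim vs(2) by (simp add: mat_on_def) (metis nth_mem)
  qed
qed

lemma set_det_uminus:
  assumes "finite S"
  shows "set_det S (\<lambda>i j. - f i j) = (- 1) ^ card S * set_det S f"
proof -
  obtain vs where vs: "distinct vs" "set vs = S"
    using finite_distinct_list[OF assms] by blast
  have "mat_on vs (\<lambda>i j. - f i j) = (- 1) \<cdot>\<^sub>m mat_on vs f"
    by (rule eq_matI) (auto simp: mat_on_def)
  then have "det (mat_on vs (\<lambda>i j. - f i j)) = (- 1) ^ length vs * det (mat_on vs f)"
    by (simp add: mat_on_def)
  moreover have "length vs = card S"
    using vs by (metis distinct_card)
  ultimately show ?thesis
    by (simp add: set_det_eq[OF vs])
qed

section \<open>The Laplacian of a simple graph\<close>

definition deg :: "('a \<times> 'a) set \<Rightarrow> 'a \<Rightarrow> nat" where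
  "deg E v = card (E `` {v})"

definition adj :: "('a \<times> 'a) set \<Rightarrow> 'a \<Rightarrow> 'a \<Rightarrow> real" where
  "adj E u v = (if (u, v) \<in> E then 1 else 0)"

definition lap :: "('a \<times> 'a) set \<Rightarrow> 'a \<Rightarrow> 'a \<Rightarrow> real" where
  "lap E u v = (if u = v then real (deg E u) else 0) - adj E u v"

text \<open>The characteristic polynomial as a real function, so that its values have a
  sign.\<close>

definition lap_char :: "'a set \<Rightarrow> ('a \<times> 'a) set \<Rightarrow> real \<Rightarrow> real" where
  "lap_char V E x = set_det V (\<lambda>u v. (if u = v then x else 0) - lap E u v)"

text \<open>Triangles are counted as ordered triples, hence six times each.\<close>

definition triangles :: "('a \<times> 'a) set \<Rightarrow> ('a \<times> 'a \<times> 'a) set" where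
  "triangles E = {(u, v, w). (u, v) \<in> E \<and> (v, w) \<in> E \<and> (w, u) \<in> E}"

locale simple_graph =
  fixes V :: "'a set" and E :: "('a \<times> 'a) set"
  assumes finite_V: "finite V" and E_sub: "E \<subseteq> V \<times> V"
    and E_sym: "(u, v) \<in> E \<Longrightarrow> (v, u) \<in> E" and E_irrefl: "(v, v) \<notin> E"
begin

lemma finite_E: "finite E"
  using finite_subset[OF E_sub] finite_V by simp

lemma nbrs_sub: "E `` {v} \<subseteq> V"
  using E_sub by auto

lemma finite_nbrs: "finite (E `` {v})"
  using finite_subset[OF nbrs_sub] finite_V by simp

lemma adj_sym: "adj E u v = adj E v u"
  using E_sym by (auto simp: adj_def)

lemma adj_refl: "adj E v v = 0"
  using E_irrefl by (simp add: adj_def)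

lemma lap_sym: "lap E u v = lap E v u"
  using adj_sym by (simp add: lap_def)

lemma sum_nbrs: "(\<Sum>v\<in>V. adj E u v * f v) = (\<Sum>v\<in>E `` {u}. f v)"
proof -
  have "(\<Sum>v\<in>V. adj E u v * f v) = (\<Sum>v\<in>V. if v \<in> E `` {u} then f v else 0)"
    by (intro sum.cong) (auto simp: adj_def)
  also have "\<dots> = sum f (V \<inter> E `` {u})"
    using finite_V by (simp add: sum.inter_restrict)
  also have "V \<inter> E `` {u} = E `` {u}"
    using nbrs_sub by blast
  finally show ?thesis .
qed

lemma sum_adj: "(\<Sum>v\<in>V. adj E u v) = deg E u"
  using sum_nbrs[of u "\<lambda>_. 1"] by (simp add: deg_def)

lemma lap_mult:
  fixes f :: "'a \<Rightarrow> real"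
  assumes u: "u \<in> V"
  shows "(\<Sum>v\<in>V. lap E u v * f v) = deg E u * f u - (\<Sum>v\<in>E `` {u}. f v)"
proof -
  have "(\<Sum>v\<in>V. lap E u v * f v) =
      (\<Sum>v\<in>V. if v = u then real (deg E u) * f v else 0) - (\<Sum>v\<in>V. adj E u v * f v)"
    unfolding sum_subtractf[symmetric] by (intro sum.cong) (auto simp: lap_def left_diff_distrib)
  then show ?thesis
    using u finite_V by (simp add: sum_nbrs)
qed

lemma sum_lap: "u \<in> V \<Longrightarrow> (\<Sum>v\<in>V. lap E u v) = 0"
  using lap_mult[of u "\<lambda>_. 1"] by (simp add: deg_def)

lemma sum_E: "(\<Sum>(u, v)\<in>E. f u v) = (\<Sum>u\<in>V. \<Sum>v\<in>E `` {u}. f u v)"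
proof -
  have "E = Sigma V (\<lambda>u. E `` {u})"
    using E_sub by auto
  then have "(\<Sum>(u, v)\<in>E. f u v) = (\<Sum>(u, v)\<in>Sigma V (\<lambda>u. E `` {u}). f u v)"
    by simp
  also have "\<dots> = (\<Sum>u\<in>V. \<Sum>v\<in>E `` {u}. f u v)"
    by (rule sum.Sigma[symmetric]) (use finite_V finite_nbrs in auto)
  finally show ?thesis .
qed

lemma card_E: "card E = (\<Sum>v\<in>V. deg E v)"
  using sum_E[of "\<lambda>_ _. 1 :: nat"] by (simp add: deg_def case_prod_beta)

lemma card_triangles:
  "real (card (triangles E)) = (\<Sum>u\<in>V. \<Sum>w\<in>V. (\<Sum>v\<in>V. adj E u v * adj E v w) * adj E w u)"
proof -
  have sub: "triangles E \<subseteq> V \<times> V \<times> V"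
    using E_sub by (auto simp: triangles_def)
  have fin: "finite (V \<times> V \<times> V)"
    using finite_V by simp
  have "real (card (triangles E)) = (\<Sum>t\<in>V \<times> V \<times> V. if t \<in> triangles E then 1 else 0)"
    using sub fin by (simp add: sum.inter_restrict[symmetric] Int_absorb1)
  also have "\<dots> = (\<Sum>u\<in>V. \<Sum>v\<in>V. \<Sum>w\<in>V. if (u, v, w) \<in> triangles E then 1 else 0)"
    by (simp add: sum.cartesian_product case_prod_beta)
  also have "\<dots> = (\<Sum>u\<in>V. \<Sum>v\<in>V. \<Sum>w\<in>V. adj E u v * adj E v w * adj E w u)"
    by (intro sum.cong refl) (auto simp: triangles_def adj_def)
  also have "\<dots> = (\<Sum>u\<in>V. \<Sum>w\<in>V. \<Sum>v\<in>V. adj E u v * adj E v w * adj E w u)"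
    by (intro sum.cong refl sum.swap)
  finally show ?thesis
    by (simp add: sum_distrib_right)
qed

text \<open>This is \<open>L^2 = D^2 - (D A + A D) + A^2\<close>, read entrywise.\<close>

lemma lap_square:
  assumes "u \<in> V" "w \<in> V"
  shows "(\<Sum>v\<in>V. lap E u v * lap E v w) =
    (if u = w then (real (deg E u))\<^sup>2 else 0) - (real (deg E u) + real (deg E w)) * adj E u w +
    (\<Sum>v\<in>V. adj E u v * adj E v w)"
proof -
  have "(\<Sum>v\<in>E `` {u}. lap E v w) = (\<Sum>v\<in>V. adj E u v * lap E v w)"
    by (simp add: sum_nbrs)
  also have "\<dots> = (\<Sum>v\<in>V. if v = w then adj E u v * real (deg E v) else 0) - (\<Sum>v\<in>V. adj E u v * adj E v w)"
    unfolding sum_subtractf[symmetric] by (intro sum.cong) (auto simp: lap_def right_diff_distrib)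
  also have "(\<Sum>v\<in>V. if v = w then adj E u v * real (deg E v) else 0) = adj E u w * real (deg E w)"
    using assms finite_V by simp
  finally have "(\<Sum>v\<in>V. lap E u v * lap E v w) =
      real (deg E u) * lap E u w - (adj E u w * real (deg E w) - (\<Sum>v\<in>V. adj E u v * adj E v w))"
    using lap_mult[OF assms(1)] by simp
  then show ?thesis
    by (simp add: lap_def power2_eq_square algebra_simps)
qed

lemma lap_square_diag: "u \<in> V \<Longrightarrow> (\<Sum>v\<in>V. lap E u v * lap E v u) = (real (deg E u))\<^sup>2 + real (deg E u)"
proof -
  assume u: "u \<in> V"
  have "(\<Sum>v\<in>V. adj E u v * adj E v u) = (\<Sum>v\<in>V. adj E u v)"
    using adj_sym by (intro sum.cong) (auto simp: adj_def)
  then show ?thesis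
    using u by (simp add: lap_square adj_refl sum_adj)
qed

text \<open>In \<open>tr (D - A)^3\<close> the term \<open>tr (D^2 A)\<close> vanishes because
  \<open>A\<close> has zero diagonal; \<open>tr (D A^2)\<close> is the sum of squared degrees, since
  \<open>A^2\<close> has the degrees on its diagonal; and \<open>tr A^3\<close> counts closed walks
  of length 3, that is, ordered triangles.\<close>

lemma trace_lap_cube:
  "(\<Sum>u\<in>V. \<Sum>w\<in>V. (\<Sum>v\<in>V. lap E u v * lap E v w) * lap E w u) =
   (\<Sum>u\<in>V. real (deg E u) ^ 3) + 3 * (\<Sum>u\<in>V. (real (deg E u))\<^sup>2) - card (triangles E)"
proof -
  let ?d = "\<lambda>u. real (deg E u)"
  let ?s = "\<lambda>u w. \<Sum>v\<in>V. adj E u v * adj E v w"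
  have row: "(\<Sum>w\<in>V. (\<Sum>v\<in>V. lap E u v * lap E v w) * lap E w u) =
      ?d u ^ 3 + ?d u ^ 2 + (\<Sum>w\<in>V. (?d u + ?d w) * adj E u w) - (\<Sum>w\<in>V. ?s u w * adj E w u)"
    if u: "u \<in> V" for u
  proof -
    have "(\<Sum>w\<in>V. (\<Sum>v\<in>V. lap E u v * lap E v w) * lap E w u) =
        (\<Sum>w\<in>V. (if w = u then (\<Sum>v\<in>V. lap E u v * lap E v u) * ?d u else 0) +
          (?d u + ?d w) * adj E u w - ?s u w * adj E w u)"
    proof (rule sum.cong[OF refl])
      fix w assume w: "w \<in> V"
      have sq: "adj E u w * adj E w u = adj E u w"
        using adj_sym[of u w] by (auto simp: adj_def)
      show "(\<Sum>v\<in>V. lap E u v * lap E v w) * lap E w u =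
          (if w = u then (\<Sum>v\<in>V. lap E u v * lap E v u) * ?d u else 0) +
          (?d u + ?d w) * adj E u w - ?s u w * adj E w u"
      proof (cases "w = u")
        case True
        then show ?thesis by (simp add: lap_def adj_refl)
      next
        case False
        then have "lap E w u = - adj E w u"
          by (simp add: lap_def)
        moreover have "(\<Sum>v\<in>V. lap E u v * lap E v w) = - ((?d u + ?d w) * adj E u w) + ?s u w"
          using lap_square[OF u w] False by simp
        moreover have "(?d u + ?d w) * adj E u w * adj E w u = (?d u + ?d w) * adj E u w"
          using sq by (simp add: mult.assoc)
        ultimately show ?thesis
          using False by (simp add: distrib_right left_diff_distrib mult.assoc)
      qed
    qed
    also have "\<dots> = (\<Sum>v\<in>V. lap E u v * lap E v u) * ?d u + (\<Sum>w\<in>V. (?d u + ?d w) * adj E u w)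
        - (\<Sum>w\<in>V. ?s u w * adj E w u)"
      using u finite_V by (simp add: sum.distrib sum_subtractf)
    also have "(\<Sum>v\<in>V. lap E u v * lap E v u) * ?d u = ?d u ^ 3 + ?d u ^ 2"
      by (simp add: lap_square_diag[OF u] power2_eq_square power3_eq_cube distrib_right)
    finally show ?thesis .
  qed
  have deg_left: "(\<Sum>w\<in>V. ?d u * adj E u w) = (?d u)\<^sup>2" for u
    using sum_adj[of u] by (simp add: sum_distrib_left[symmetric] power2_eq_square)
  have "(\<Sum>u\<in>V. \<Sum>w\<in>V. ?d w * adj E u w) = (\<Sum>w\<in>V. \<Sum>u\<in>V. ?d w * adj E w u)"
    by (subst sum.swap) (simp add: adj_sym)
  then have deg_right: "(\<Sum>u\<in>V. \<Sum>w\<in>V. ?d w * adj E u w) = (\<Sum>w\<in>V. (?d w)\<^sup>2)"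
    by (simp add: deg_left)
  show ?thesis
    by (simp add: row sum.distrib sum_subtractf distrib_right deg_left deg_right card_triangles
      flip: sum_distrib_left) (simp add: sum_adj power2_eq_square)
qed

end

section \<open>Invariants determined by the Laplacian spectrum\<close>

lemma pair_graph_simple_graph: "pair_graph G \<Longrightarrow> simple_graph (pverts G) (parcs G)"
proof -
  assume "pair_graph G"
  then interpret pair_graph G .
  show ?thesis
    using pair_finite_verts in_arcsD1 in_arcsD2 pair_sym_arcs pair_no_loops
    by unfold_locales (auto simp: symmetric_def sym_def, blast)
qed

lemma out_degree_deg: "out_degree (with_proj G) v = deg (parcs G) v"
proof -
  have "out_arcs (with_proj G) v = Pair v ` (parcs G `` {v})"
    by (auto simp: out_arcs_def)
  then show ?thesis
    by (simp add: out_degree_def deg_def card_image inj_on_def)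
qed

lemma map_laplacian_mat:
  assumes "distinct vs"
  shows "map_mat complex_of_real (laplacian_mat G vs) =
    mat_on vs (\<lambda>u v. complex_of_real (lap (parcs G) u v))"
  by (rule eq_matI)
    (use assms in \<open>auto simp: laplacian_mat_def degree_mat_def adjacency_mat_def mat_on_def lap_def
      adj_def out_degree_deg nth_eq_iff_index_eq\<close>)

lemma laplacian_spectrum_mat_on:
  assumes "distinct vs" "set vs = pverts G"
  shows "laplacian_spectrum G = proots (char_poly (mat_on vs (\<lambda>u v. complex_of_real (lap (parcs G) u v))))"
  using laplacian_spectrum_eq[OF assms] map_laplacian_mat[OF assms(1)] by simp

lemma size_laplacian_spectrum:
  assumes "finite (pverts G)"
  shows "size (laplacian_spectrum G) = card (pverts G)"
proof -
  obtain vs where vs: "distinct vs" "set vs = pverts G"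
    using finite_distinct_list[OF assms] by blast
  have "length vs = card (pverts G)"
    using vs by (metis distinct_card)
  then show ?thesis
    using degree_monic_char_poly[OF mat_on_carrier, of vs "\<lambda>u v. complex_of_real (lap (parcs G) u v)"]
    by (simp add: laplacian_spectrum_mat_on[OF vs] size_proots_complex)
qed

lemma lap_char_eq_prod_spectrum:
  assumes "finite (pverts G)"
  shows "complex_of_real (lap_char (pverts G) (parcs G) x) =
    (\<Prod>a\<in>#laplacian_spectrum G. complex_of_real x - a)"
proof -
  obtain vs where vs: "distinct vs" "set vs = pverts G"
    using finite_distinct_list[OF assms] by blast
  let ?f = "\<lambda>u v. complex_of_real (lap (parcs G) u v)"
  let ?A = "mat_on vs ?f"
  let ?g = "\<lambda>u v. (if u = v then x else 0) - lap (parcs G) u v"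
  have "poly (char_poly ?A) (complex_of_real x) = det (map_mat complex_of_real (mat_on vs ?g))"
    unfolding char_poly_def
    by (rule poly_det_cong[of _ "length vs"])
      (use vs in \<open>auto simp: char_poly_matrix_def mat_on_def nth_eq_iff_index_eq\<close>)
  also have "\<dots> = complex_of_real (lap_char (pverts G) (parcs G) x)"
    by (simp add: det_map_of_real lap_char_def set_det_eq[OF vs])
  finally have "complex_of_real (lap_char (pverts G) (parcs G) x) = poly (char_poly ?A) (complex_of_real x)" ..
  also have "\<dots> = poly (\<Prod>a\<in>#laplacian_spectrum G. [:- a, 1:]) (complex_of_real x)"
    using char_poly_eq_prod_proots[OF mat_on_carrier, of vs ?f]
    by (simp add: laplacian_spectrum_mat_on[OF vs])
  also have "\<dots> = (\<Prod>a\<in>#laplacian_spectrum G. complex_of_real x - a)"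
    by (simp add: poly_prod_mset image_mset.compositionality o_def)
  finally show ?thesis .
qed

lemma power_sums_laplacian_spectrum:
  assumes "pair_graph G"
  defines "E \<equiv> parcs G" and "V \<equiv> pverts G"
  shows "(\<Sum>a\<in>#laplacian_spectrum G. a) = of_real (\<Sum>v\<in>V. real (deg E v))"
    and "(\<Sum>a\<in>#laplacian_spectrum G. a ^ 2) = of_real (\<Sum>v\<in>V. (real (deg E v))\<^sup>2 + real (deg E v))"
    and "(\<Sum>a\<in>#laplacian_spectrum G. a ^ 3) =
      of_real ((\<Sum>v\<in>V. real (deg E v) ^ 3) + 3 * (\<Sum>v\<in>V. (real (deg E v))\<^sup>2) - card (triangles E))"
proof -
  interpret simple_graph V E
    using pair_graph_simple_graph[OF assms(1)] by (simp add: V_def E_def)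
  obtain vs where vs: "distinct vs" "set vs = pverts G"
    using finite_distinct_list[OF finite_V] by (auto simp: V_def)
  define f where "f u v = complex_of_real (lap E u v)" for u v
  let ?A = "mat_on vs f"
  have V: "set vs = V" by (simp add: vs V_def)
  have sp: "laplacian_spectrum G = proots (char_poly ?A)"
    using laplacian_spectrum_mat_on[OF vs] by (simp add: f_def[abs_def] E_def)
  note tr = mat_trace_power_eq_sum_proots[OF mat_on_carrier, of vs f, folded sp]
  have c: "?A \<in> carrier_mat (length vs) (length vs)" by simp
  have p1: "?A ^\<^sub>m 1 = ?A"
    using c by simp
  have p2: "?A ^\<^sub>m 2 = ?A * ?A"
    using c by (simp add: numeral_2_eq_2)
  have p3: "?A ^\<^sub>m 3 = ?A * ?A * ?A"
    using c by (simp add: numeral_3_eq_3)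
  show "(\<Sum>a\<in>#laplacian_spectrum G. a) = of_real (\<Sum>v\<in>V. real (deg E v))"
    using tr[of 1] unfolding p1 mat_trace_mat_on[OF vs(1)] V
    by (simp add: f_def lap_def adj_refl)
  show "(\<Sum>a\<in>#laplacian_spectrum G. a ^ 2) = of_real (\<Sum>v\<in>V. (real (deg E v))\<^sup>2 + real (deg E v))"
    using tr[of 2] unfolding p2 mat_on_mult[OF vs(1)] mat_trace_mat_on[OF vs(1)] V
    by (simp add: f_def lap_square_diag flip: of_real_mult of_real_sum) (simp add: sum.distrib)
  show "(\<Sum>a\<in>#laplacian_spectrum G. a ^ 3) =
      of_real ((\<Sum>v\<in>V. real (deg E v) ^ 3) + 3 * (\<Sum>v\<in>V. (real (deg E v))\<^sup>2) - card (triangles E))"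
    using tr[of 3] unfolding p3 mat_on_mult[OF vs(1)] mat_trace_mat_on[OF vs(1)] V
    unfolding trace_lap_cube[symmetric]
    by (simp add: f_def flip: of_real_mult of_real_sum)
qed

text \<open>The traces are triangular in the power sums of the degrees, so each power sum follows
  from the earlier ones; the cubes remain tied to the number of triangles. Integers replace reals
  here because the analysis of degree sequences is integer arithmetic.\<close>

lemma L_cospectral_invariants:
  assumes "pair_graph G" "pair_graph H" "L_cospectral G H"
  shows "card (pverts G) = card (pverts H)"
    and "lap_char (pverts G) (parcs G) x = lap_char (pverts H) (parcs H) x"
    and "(\<Sum>v\<in>pverts G. int (deg (parcs G) v)) = (\<Sum>v\<in>pverts H. int (deg (parcs H) v))"
    and "(\<Sum>v\<in>pverts G. (int (deg (parcs G) v))\<^sup>2) = (\<Sum>v\<in>pverts H. (int (deg (parcs H) v))\<^sup>2)"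
    and "(\<Sum>v\<in>pverts G. int (deg (parcs G) v) ^ 3) - int (card (triangles (parcs G))) =
      (\<Sum>v\<in>pverts H. int (deg (parcs H) v) ^ 3) - int (card (triangles (parcs H)))"
proof -
  have sp: "laplacian_spectrum G = laplacian_spectrum H"
    using assms(3) by (simp add: L_cospectral_def)
  have fin: "finite (pverts G)" "finite (pverts H)"
    using assms(1,2)[THEN pair_graph_simple_graph] by (simp_all add: simple_graph_def)
  show "card (pverts G) = card (pverts H)"
    using fin sp by (metis size_laplacian_spectrum)
  show "lap_char (pverts G) (parcs G) x = lap_char (pverts H) (parcs H) x"
    using fin sp by (metis lap_char_eq_prod_spectrum of_real_eq_iff)
  note pG = power_sums_laplacian_spectrum[OF assms(1)] and pH = power_sums_laplacian_spectrum[OF assms(2)]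
  have 1: "(\<Sum>v\<in>pverts G. real (deg (parcs G) v)) = (\<Sum>v\<in>pverts H. real (deg (parcs H) v))"
    using pG(1) pH(1) sp by (metis of_real_eq_iff)
  have "(\<Sum>v\<in>pverts G. (real (deg (parcs G) v))\<^sup>2 + real (deg (parcs G) v)) =
      (\<Sum>v\<in>pverts H. (real (deg (parcs H) v))\<^sup>2 + real (deg (parcs H) v))"
    using pG(2) pH(2) sp by (metis of_real_eq_iff)
  then have 2: "(\<Sum>v\<in>pverts G. (real (deg (parcs G) v))\<^sup>2) = (\<Sum>v\<in>pverts H. (real (deg (parcs H) v))\<^sup>2)"
    using 1 by (simp add: sum.distrib)
  have "(\<Sum>v\<in>pverts G. real (deg (parcs G) v) ^ 3) + 3 * (\<Sum>v\<in>pverts G. (real (deg (parcs G) v))\<^sup>2)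
        - card (triangles (parcs G)) =
      (\<Sum>v\<in>pverts H. real (deg (parcs H) v) ^ 3) + 3 * (\<Sum>v\<in>pverts H. (real (deg (parcs H) v))\<^sup>2)
        - card (triangles (parcs H))"
    using pG(3) pH(3) sp by (metis of_real_eq_iff)
  then have 3: "(\<Sum>v\<in>pverts G. real (deg (parcs G) v) ^ 3) - card (triangles (parcs G)) =
      (\<Sum>v\<in>pverts H. real (deg (parcs H) v) ^ 3) - card (triangles (parcs H))"
    using 2 by simp
  show "(\<Sum>v\<in>pverts G. int (deg (parcs G) v)) = (\<Sum>v\<in>pverts H. int (deg (parcs H) v))"
    using 1 by (simp flip: of_nat_sum)
  show "(\<Sum>v\<in>pverts G. (int (deg (parcs G) v))\<^sup>2) = (\<Sum>v\<in>pverts H. (int (deg (parcs H) v))\<^sup>2)"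
    using 2 by (simp flip: of_nat_sum of_nat_power)
  have "real_of_int ((\<Sum>v\<in>pverts G. int (deg (parcs G) v) ^ 3) - int (card (triangles (parcs G)))) =
      real_of_int ((\<Sum>v\<in>pverts H. int (deg (parcs H) v) ^ 3) - int (card (triangles (parcs H))))"
    using 3 by simp
  then show "(\<Sum>v\<in>pverts G. int (deg (parcs G) v) ^ 3) - int (card (triangles (parcs G))) =
      (\<Sum>v\<in>pverts H. int (deg (parcs H) v) ^ 3) - int (card (triangles (parcs H)))"
    by (simp only: of_int_eq_iff)
qed

section \<open>Connectedness and the reduced Laplacian\<close>

definition spans_from :: "'a \<Rightarrow> 'a set \<Rightarrow> ('a \<times> 'a) set \<Rightarrow> bool" where
  "spans_from c V E \<longleftrightarrow> (\<forall>v\<in>V. (c, v) \<in> E\<^sup>*)"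

lemma quad_form_extend:
  assumes "finite V" "S \<subseteq> V"
  shows "quad_form S f x = quad_form V f (\<lambda>i. if i \<in> S then x i else 0)"
proof -
  have "quad_form V f (\<lambda>i. if i \<in> S then x i else 0) =
      (\<Sum>i\<in>V. if i \<in> S then (\<Sum>j\<in>V. if j \<in> S then f i j * x i * x j else 0) else 0)"
    unfolding quad_form_def by (auto intro!: sum.cong)
  also have "\<dots> = (\<Sum>i\<in>S. \<Sum>j\<in>S. f i j * x i * x j)"
    using assms by (simp add: sum.inter_restrict[symmetric] Int_absorb1)
  finally show ?thesis
    by (simp add: quad_form_def)
qed

lemma constant_on_rtrancl:
  assumes "(c, v) \<in> E\<^sup>*" and "\<And>u v. (u, v) \<in> E \<Longrightarrow> x u = x v"
  shows "x c = x v"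
  using assms(1) by (induction rule: rtrancl_induct) (auto dest: assms(2))

context simple_graph
begin

text \<open>Adding all rows to row \<open>v\<close>, and then all columns to column \<open>v\<close>, makes \<open>n x\<close> the pivot at
  \<open>v\<close>.\<close>

lemma lap_char_reduced:
  fixes x :: real
  assumes v: "v \<in> V" and x: "x \<noteq> 0"
  shows "lap_char V E x = card V * x *
    set_det (V - {v}) (\<lambda>i j. (if i = j then x else 0) - lap E i j - x / card V)"
proof -
  define M where "M i j = (if i = j then x else 0) - lap E i j" for i j
  define R where "R i j = (if i = j \<or> i = v then 1 else 0 :: real)" for i j
  define M' where "M' i j = (if i = v \<and> j = v then card V * x else if i = v \<or> j = v then x else M i j)" for i j
  have nz: "card V * x \<noteq> 0"
    using v x finite_V by auto
  have row: "(\<Sum>j\<in>V. M i j) = x" if "i \<in> V" for i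
    using that finite_V by (simp add: M_def sum_subtractf sum_lap)
  have Msym: "M i j = M j i" for i j
    by (simp add: M_def lap_sym[of i j])
  have "set_det V R = (\<Prod>i\<in>V. R i i)"
    by (rule set_det_triangular[OF finite_V, where r = "\<lambda>i. if i = v then 0 else 1"])
      (auto simp: R_def split: if_splits)
  then have R: "set_det V R = 1" "set_det V (\<lambda>i j. R j i) = 1"
    using set_det_transpose[OF finite_V, of R] by (simp_all add: R_def)
  have RM: "(\<Sum>k\<in>V. R i k * M k j) = (if i = v then x else M i j)" if "i \<in> V" "j \<in> V" for i j
  proof (cases "i = v")
    case True
    then show ?thesis
      using row[OF that(2)] by (simp add: R_def Msym[of _ j])
  next
    case False
    then have "(\<Sum>k\<in>V. R i k * M k j) = (\<Sum>k\<in>V. if k = i then M k j else 0)"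
      by (intro sum.cong) (auto simp: R_def)
    then show ?thesis
      using False that finite_V by simp
  qed
  have RMR: "(\<Sum>l\<in>V. (\<Sum>k\<in>V. R i k * M k l) * R j l) = M' i j" if ij: "i \<in> V" "j \<in> V" for i j
  proof -
    have "(\<Sum>l\<in>V. (\<Sum>k\<in>V. R i k * M k l) * R j l) = (\<Sum>l\<in>V. (if i = v then x else M i l) * R j l)"
      using RM ij by (intro sum.cong) auto
    also have "\<dots> = M' i j"
    proof (cases "j = v")
      case True
      then show ?thesis
        using row[OF ij(1)] by (auto simp: R_def M'_def)
    next
      case False
      then have "(\<Sum>l\<in>V. (if i = v then x else M i l) * R j l) =
          (\<Sum>l\<in>V. if l = j then (if i = v then x else M i l) else 0)"
        by (intro sum.cong) (auto simp: R_def)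
      then show ?thesis
        using False ij finite_V by (simp add: M'_def)
    qed
    finally show ?thesis .
  qed
  have "lap_char V E x = set_det V M"
    by (simp add: lap_char_def M_def[abs_def])
  also have "\<dots> = set_det V (\<lambda>i j. \<Sum>l\<in>V. (\<Sum>k\<in>V. R i k * M k l) * R j l)"
    using set_det_mult[OF finite_V, of "\<lambda>i l. \<Sum>k\<in>V. R i k * M k l" "\<lambda>l j. R j l"]
      set_det_mult[OF finite_V, of R M] R by simp
  also have "\<dots> = set_det V M'"
    using RMR finite_V by (intro set_det_cong) auto
  also have "\<dots> = set_det (insert v (V - {v})) M'"
    using v by (simp add: insert_absorb)
  also have "\<dots> = M' v v * set_det (V - {v}) (\<lambda>i j. M' i j - M' i v * M' v j / M' v v)"
    using finite_V nz by (intro set_det_schur) (auto simp: M'_def)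
  also have "M' v v = card V * x"
    by (simp add: M'_def)
  also have "set_det (V - {v}) (\<lambda>i j. M' i j - M' i v * M' v j / (card V * x)) =
      set_det (V - {v}) (\<lambda>i j. (if i = j then x else 0) - lap E i j - x / card V)"
    using x finite_V by (intro set_det_cong) (auto simp: M'_def M_def)
  finally show ?thesis .
qed

text \<open>The limit is the linear coefficient of the characteristic polynomial, by the matrix-tree
  theorem \<open>n\<close> times the number of spanning trees up to sign. Taking it as a limit of
  quotients avoids differentiating a determinant.\<close>

lemma reduced_lap_char_tendsto:
  assumes "v \<in> V"
  shows "((\<lambda>x. lap_char V E x / x) \<longlongrightarrow>
    card V * ((- 1) ^ (card V - 1) * set_det (V - {v}) (lap E))) (at 0)"
proof -
  let ?R = "\<lambda>x. set_det (V - {v}) (\<lambda>i j. (if i = j then x else 0) - lap E i j - x / card V)"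
  have "(?R \<longlongrightarrow> set_det (V - {v}) (\<lambda>i j. - lap E i j)) (at 0)"
  proof (rule tendsto_set_det)
    fix i j
    have "isCont (\<lambda>x. (if i = j then x else 0) - lap E i j - x * inverse (card V)) 0"
      by (cases "i = j") (auto intro!: continuous_intros)
    then show "((\<lambda>x. (if i = j then x else 0) - lap E i j - x / card V) \<longlongrightarrow> - lap E i j) (at 0)"
      by (simp add: isCont_def divide_inverse cong: if_cong)
  qed (simp add: finite_V)
  then have "((\<lambda>x. card V * ?R x) \<longlongrightarrow> card V * set_det (V - {v}) (\<lambda>i j. - lap E i j)) (at 0)"
    by (intro tendsto_intros)
  moreover have "eventually (\<lambda>x. card V * ?R x = lap_char V E x / x) (at 0)"
    unfolding eventually_at_filter using lap_char_reduced[OF assms] by (intro always_eventually) auto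
  ultimately have "((\<lambda>x. lap_char V E x / x) \<longlongrightarrow> card V * set_det (V - {v}) (\<lambda>i j. - lap E i j)) (at 0)"
    by (rule Lim_transform_eventually)
  then show ?thesis
    using assms finite_V by (simp add: set_det_uminus)
qed

text \<open>Every edge occurs in \<open>E\<close> in both orientations, hence the division by
  2.\<close>

lemma quad_form_lap: "quad_form V (lap E) x = (\<Sum>(u, v)\<in>E. (x u - x v)\<^sup>2) / 2"
proof -
  have left: "(\<Sum>(u, v)\<in>E. (x u)\<^sup>2) = (\<Sum>u\<in>V. deg E u * (x u)\<^sup>2)"
    by (simp add: sum_E deg_def)
  have "(\<Sum>(u, v)\<in>E. (x v)\<^sup>2) = (\<Sum>(u, v)\<in>E. (x u)\<^sup>2)"
    by (rule sum.reindex_bij_witness[of _ prod.swap prod.swap]) (auto intro: E_sym)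
  then have "(\<Sum>(u, v)\<in>E. (x u - x v)\<^sup>2) = 2 * (\<Sum>u\<in>V. deg E u * (x u)\<^sup>2) - 2 * (\<Sum>(u, v)\<in>E. x u * x v)"
    using left by (simp add: power2_diff case_prod_beta sum.distrib sum_subtractf sum_distrib_left mult.assoc)
  moreover have "quad_form V (lap E) x = (\<Sum>u\<in>V. x u * (\<Sum>v\<in>V. lap E u v * x v))"
    unfolding quad_form_def sum_distrib_left by (intro sum.cong refl) (simp add: mult_ac)
  then have "quad_form V (lap E) x = (\<Sum>u\<in>V. deg E u * (x u)\<^sup>2 - (\<Sum>v\<in>E `` {u}. x u * x v))"
    by (simp add: lap_mult right_diff_distrib flip: sum_distrib_left)
      (simp add: power2_eq_square mult_ac)
  then have "quad_form V (lap E) x = (\<Sum>u\<in>V. deg E u * (x u)\<^sup>2) - (\<Sum>(u, v)\<in>E. x u * x v)"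
    by (simp add: sum_E sum_subtractf)
  ultimately show ?thesis by simp
qed

lemma sum_edges_zero_constant:
  assumes "(\<Sum>(u, v)\<in>E. (x u - x v)\<^sup>2) \<le> (0 :: real)" "(u, v) \<in> E"
  shows "x u = x v"
proof -
  have "(\<Sum>(u, v)\<in>E. (x u - x v)\<^sup>2) = 0"
    using assms(1) by (intro antisym sum_nonneg) auto
  then have "\<forall>e\<in>E. (case e of (u, v) \<Rightarrow> (x u - x v)\<^sup>2) = 0"
    by (subst (asm) sum_nonneg_eq_0_iff) (auto simp: finite_E)
  then show ?thesis
    using assms(2) by fastforce
qed

text \<open>Extend \<open>x\<close> by 0 to \<open>c\<close>. If the form were not positive, the
  extension would be constant along edges, hence constant on the connected graph, with the value 0
  that it has at \<open>c\<close>.\<close>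

lemma reduced_lap_pos_def:
  assumes c: "c \<in> V" and conn: "spans_from c V E"
  shows "pos_def_on (V - {c}) (lap E)"
  unfolding pos_def_on_def
proof (intro allI impI)
  fix x assume nz: "\<exists>i\<in>V - {c}. x i \<noteq> (0 :: real)"
  define y where "y i = (if i \<in> V - {c} then x i else 0)" for i
  have eq: "quad_form (V - {c}) (lap E) x = (\<Sum>(u, v)\<in>E. (y u - y v)\<^sup>2) / 2"
    using quad_form_extend[OF finite_V, of "V - {c}" "lap E" x] quad_form_lap[of y]
    by (simp add: y_def[abs_def])
  show "0 < quad_form (V - {c}) (lap E) x"
  proof (rule ccontr)
    assume "\<not> 0 < quad_form (V - {c}) (lap E) x"
    then have "\<And>u v. (u, v) \<in> E \<Longrightarrow> y u = y v"
      using eq by (intro sum_edges_zero_constant[of y]) auto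
    then have "y c = y v" if "v \<in> V" for v
      using conn that constant_on_rtrancl[of c v E y] by (auto simp: spans_from_def)
    moreover obtain i where "i \<in> V - {c}" "x i \<noteq> 0"
      using nz by blast
    ultimately have "y c = x i"
      by (metis DiffD1 y_def)
    then show False
      using \<open>x i \<noteq> 0\<close> by (simp add: y_def)
  qed
qed

lemma symmetric_on_lap: "symmetric_on S (lap E)"
  using lap_sym by (auto simp: symmetric_on_def)

lemma reduced_lap_det_nonzero_iff:
  assumes c: "c \<in> V"
  shows "set_det (V - {c}) (lap E) \<noteq> 0 \<longleftrightarrow> spans_from c V E"
proof
  assume "spans_from c V E"
  then have "set_det (V - {c}) (lap E) > 0"
    using finite_V by (intro set_det_pos_def symmetric_on_lap reduced_lap_pos_def[OF c]) auto
  then show "set_det (V - {c}) (lap E) \<noteq> 0" by simp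
next
  assume nz: "set_det (V - {c}) (lap E) \<noteq> 0"
  show "spans_from c V E"
  proof (rule ccontr)
    assume "\<not> spans_from c V E"
    then obtain w where w: "w \<in> V" "(c, w) \<notin> E\<^sup>*"
      by (auto simp: spans_from_def)
    \<comment> \<open>The indicator of the vertices not reachable from \<open>c\<close> is constant
      along edges and vanishes at \<open>c\<close>, so it lies in the kernel of the reduced
      Laplacian.\<close>
    define x where "x v = (if (c, v) \<in> E\<^sup>* then 0 else 1 :: real)" for v
    have xc: "x c = 0" by (simp add: x_def)
    have const: "x u = x v" if "(u, v) \<in> E" for u v
      using that E_sym[OF that] by (auto simp: x_def intro: rtrancl_into_rtrancl)
    have "(\<Sum>j\<in>V - {c}. lap E i j * x j) = 0" if "i \<in> V - {c}" for i
    proof -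
      have "(\<Sum>j\<in>V - {c}. lap E i j * x j) = (\<Sum>j\<in>V. lap E i j * x j)"
        using finite_V c xc by (simp add: sum_diff1)
      also have "\<dots> = deg E i * x i - (\<Sum>j\<in>E `` {i}. x i)"
        using that const by (subst lap_mult) auto
      finally show ?thesis
        by (simp add: deg_def)
    qed
    moreover have "w \<in> V - {c}" "x w \<noteq> 0"
      using w by (auto simp: x_def)
    ultimately have "set_det (V - {c}) (lap E) = 0"
      using finite_V by (subst set_det_eq_0_iff) auto
    then show False using nz by simp
  qed
qed

end

text \<open>Equal characteristic polynomials have equal limits, and the factor \<open>card V\<close>
  is nonzero. The deleted vertices are arbitrary on both sides.\<close>

lemma reduced_lap_det_eq:
  assumes "simple_graph V E" "simple_graph V' E'" "card V = card V'"
    and char: "\<And>x. lap_char V E x = lap_char V' E' x" and v: "v \<in> V" "v' \<in> V'"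
  shows "set_det (V - {v}) (lap E) = set_det (V' - {v'}) (lap E')"
proof -
  have "card V \<noteq> 0"
    using v(1) assms(1) by (auto simp: simple_graph_def)
  moreover have "real (card V) * ((- 1) ^ (card V - 1) * set_det (V - {v}) (lap E)) =
      real (card V') * ((- 1) ^ (card V' - 1) * set_det (V' - {v'}) (lap E'))"
    using simple_graph.reduced_lap_char_tendsto[OF assms(1) v(1)]
      simple_graph.reduced_lap_char_tendsto[OF assms(2) v(2)]
    unfolding char by (rule LIM_unique)
  ultimately show ?thesis
    using assms(3) by simp
qed

lemma spans_from_transfer:
  assumes "simple_graph V E" "simple_graph V' E'" "card V = card V'"
    and "\<And>x. lap_char V E x = lap_char V' E' x" and "v \<in> V" "v' \<in> V'" "spans_from v V E"
  shows "spans_from v' V' E'"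
  using reduced_lap_det_eq[OF assms(1-6)] simple_graph.reduced_lap_det_nonzero_iff[OF assms(1,5)]
    simple_graph.reduced_lap_det_nonzero_iff[OF assms(2,6)] assms(7) by simp

section \<open>The characteristic polynomial at 4 and at the number of vertices\<close>

context simple_graph
begin

lemma quad_form_char:
  "quad_form V (\<lambda>i j. (if i = j then a else 0) - lap E i j) x =
    a * (\<Sum>v\<in>V. (x v)\<^sup>2) - (\<Sum>(u, v)\<in>E. (x u - x v)\<^sup>2) / 2"
proof -
  have "quad_form V (\<lambda>i j. (if i = j then a else 0) - lap E i j) x =
      (\<Sum>i\<in>V. \<Sum>j\<in>V. if j = i then a * (x i)\<^sup>2 else 0) - quad_form V (lap E) x"
    unfolding quad_form_def sum_subtractf[symmetric]
    by (intro sum.cong refl) (auto simp: left_diff_distrib power2_eq_square)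
  then show ?thesis
    using finite_V by (simp add: quad_form_lap sum_distrib_left)
qed

text \<open>The eigenvalue \<open>4\<close> is an upper bound for paths and cycles; it is not attained if one vertex of
  every component is grounded.\<close>

lemma four_minus_lap_pos_def:
  assumes c: "c \<in> C" "C \<subseteq> V" and conn: "spans_from c V E"
    and deg2: "\<And>v. v \<in> V - C \<Longrightarrow> deg E v \<le> 2"
  shows "pos_def_on (V - C) (\<lambda>i j. (if i = j then 4 else 0) - lap E i j)"
  unfolding pos_def_on_def
proof (intro allI impI)
  fix x assume nz: "\<exists>i\<in>V - C. x i \<noteq> (0 :: real)"
  define y where "y i = (if i \<in> V - C then x i else 0)" for i
  have eq: "quad_form (V - C) (\<lambda>i j. (if i = j then 4 else 0) - lap E i j) x =
      4 * (\<Sum>v\<in>V. (y v)\<^sup>2) - (\<Sum>(u, v)\<in>E. (y u - y v)\<^sup>2) / 2"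
    using quad_form_extend[OF finite_V, of "V - C" _ x] quad_form_char[of 4 y]
    by (simp add: y_def[abs_def])
  have swap: "(\<Sum>(u, v)\<in>E. (y v)\<^sup>2) = (\<Sum>(u, v)\<in>E. (y u)\<^sup>2)"
    by (rule sum.reindex_bij_witness[of _ prod.swap prod.swap]) (auto intro: E_sym)
  \<comment> \<open>The parallelogram identity compares \<open>4 - L\<close> with the signless
    Laplacian \<open>D + A\<close>: since degrees are at most 2 on the support of \<open>y\<close>,
    the form of \<open>4 - L\<close> is at least that of \<open>D + A\<close>.\<close>
  have "(\<Sum>(u, v)\<in>E. (y u - y v)\<^sup>2) + (\<Sum>(u, v)\<in>E. (y u + y v)\<^sup>2) =
      2 * (\<Sum>(u, v)\<in>E. (y u)\<^sup>2) + 2 * (\<Sum>(u, v)\<in>E. (y v)\<^sup>2)"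
    unfolding sum.distrib[symmetric] sum_distrib_left
    by (intro sum.cong refl) (auto simp: power2_eq_square algebra_simps)
  also have "\<dots> = 4 * (\<Sum>u\<in>V. deg E u * (y u)\<^sup>2)"
    using swap by (simp add: sum_E deg_def)
  finally have par: "(\<Sum>(u, v)\<in>E. (y u - y v)\<^sup>2) + (\<Sum>(u, v)\<in>E. (y u + y v)\<^sup>2) =
      4 * (\<Sum>u\<in>V. deg E u * (y u)\<^sup>2)" .
  have "(\<Sum>u\<in>V. deg E u * (y u)\<^sup>2) \<le> (\<Sum>u\<in>V. 2 * (y u)\<^sup>2)"
    using deg2 by (intro sum_mono) (force simp: y_def intro: mult_right_mono)
  then have "(\<Sum>u\<in>V. deg E u * (y u)\<^sup>2) \<le> 2 * (\<Sum>u\<in>V. (y u)\<^sup>2)"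
    by (simp add: sum_distrib_left)
  then have ge: "(\<Sum>(u, v)\<in>E. (y u + y v)\<^sup>2) / 2 \<le> quad_form (V - C) (\<lambda>i j. (if i = j then 4 else 0) - lap E i j) x"
    unfolding eq using par by simp
  show "0 < quad_form (V - C) (\<lambda>i j. (if i = j then 4 else 0) - lap E i j) x"
  proof (rule ccontr)
    assume "\<not> 0 < quad_form (V - C) (\<lambda>i j. (if i = j then 4 else 0) - lap E i j) x"
    then have "(\<Sum>(u, v)\<in>E. (y u + y v)\<^sup>2) = 0"
      using ge by (intro antisym sum_nonneg) auto
    then have "\<forall>e\<in>E. (case e of (u, v) \<Rightarrow> (y u + y v)\<^sup>2) = 0"
      by (subst (asm) sum_nonneg_eq_0_iff) (auto simp: finite_E)
    \<comment> \<open>Now \<open>y\<close> changes sign along every edge, so it is the square of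
      \<open>y\<close> that is constant.\<close>
    then have "\<And>u v. (u, v) \<in> E \<Longrightarrow> (y u)\<^sup>2 = (y v)\<^sup>2"
      by (fastforce simp: power2_eq_iff)
    then have "(y v)\<^sup>2 = (y c)\<^sup>2" if "v \<in> V" for v
      using conn that constant_on_rtrancl[of c v E "\<lambda>v. (y v)\<^sup>2"] by (auto simp: spans_from_def)
    moreover have "y c = 0"
      using c by (simp add: y_def)
    moreover obtain i where "i \<in> V - C" "x i \<noteq> 0"
      using nz by blast
    ultimately have "(x i)\<^sup>2 = 0"
      by (metis DiffD1 y_def power_zero_numeral)
    then show False
      using \<open>x i \<noteq> 0\<close> by simp
  qed
qed

lemma symmetric_on_char: "symmetric_on S (\<lambda>i j. (if i = j then a else 0) - lap E i j)"
  using lap_sym by (auto simp: symmetric_on_def)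

text \<open>Away from \<open>c\<close> the form of \<open>4 - L\<close> is positive definite, and
  the unit vector at \<open>c\<close> is a negative direction with value
  \<open>4 - deg E c\<close>.\<close>

lemma lap_char_4_neg:
  assumes c: "c \<in> V" "spans_from c V E" and deg2: "\<And>v. v \<in> V - {c} \<Longrightarrow> deg E v \<le> 2"
    and "deg E c > 4"
  shows "lap_char V E 4 < 0"
proof -
  let ?f = "\<lambda>i j. (if i = j then 4 else 0) - lap E i j"
  let ?x = "\<lambda>i. if i = c then 1 else 0 :: real"
  have V: "insert c (V - {c}) = V"
    using c by auto
  have "quad_form V ?f ?x = (\<Sum>i\<in>V. if i = c then ?f c c else 0)"
    unfolding quad_form_def using finite_V c
    by (intro sum.cong refl) (auto simp: if_distrib cong: if_cong)
  also have "\<dots> = 4 - real (deg E c)"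
    using finite_V c by (simp add: lap_def adj_refl)
  finally have "quad_form V ?f ?x < 0"
    using assms(4) by simp
  moreover have "pos_def_on (V - {c}) ?f"
    using four_minus_lap_pos_def[of c "{c}"] assms by auto
  ultimately show ?thesis
    unfolding lap_char_def using set_det_one_negative_direction[of "V - {c}" c ?f ?x, unfolded V]
      symmetric_on_char finite_V by blast
qed

text \<open>If \<open>u\<close> and \<open>w\<close> are adjacent, the stars formed by their three other neighbours are disjoint, and
  \<open>4\<close> is an eigenvalue of each of them.\<close>

lemma lap_char_4_nonneg:
  assumes uw: "u \<in> V" "w \<in> V" "u \<noteq> w" "deg E u = 4" "deg E w = 4" and conn: "spans_from u V E"
    and deg2: "\<And>v. v \<in> V - {u, w} \<Longrightarrow> deg E v \<le> 2" and tri: "triangles E = {}"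
  shows "lap_char V E 4 \<ge> 0"
proof -
  let ?f = "\<lambda>i j. (if i = j then 4 else 0) - lap E i j"
  let ?S = "V - {u, w}"
  have V: "insert u (insert w ?S) = V"
    using uw by auto
  have pd: "pos_def_on ?S ?f"
    using four_minus_lap_pos_def[of u "{u, w}"] uw conn deg2 by auto
  have ext: "\<exists>x. x u = p \<and> x w = q \<and> quad_form V ?f x \<le> 0" for p q
  proof (cases "(u, w) \<in> E")
    case False
    let ?x = "\<lambda>i. if i = u then p else if i = w then q else 0"
    have "quad_form V ?f ?x = quad_form {u, w} ?f ?x"
    proof -
      have "(\<lambda>i. if i \<in> {u, w} then ?x i else 0) = ?x" by auto
      then show ?thesis
        using quad_form_extend[OF finite_V, of "{u, w}" ?f ?x] uw by simp
    qed
    \<comment> \<open>The diagonal entries are \<open>4 - 4\<close>, and nonadjacency makes the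
      others vanish.\<close>
    also have "\<dots> = 0"
    proof -
      have "(w, u) \<notin> E" using False E_sym by blast
      then show ?thesis
        using uw False by (simp add: quad_form_def lap_def adj_def E_irrefl)
    qed
    finally show ?thesis
      using uw(3) by (intro exI[of _ ?x]) auto
  next
    case True
    define A where "A = E `` {u} - {w}"
    define B where "B = E `` {w} - {u}"
    have wu: "(w, u) \<in> E" using True E_sym by blast
    have fin: "finite A" "finite B"
      using finite_nbrs by (auto simp: A_def B_def)
    have card: "card A = 3" "card B = 3"
      using uw(4,5) True wu finite_nbrs by (simp_all add: A_def B_def deg_def)
    have disj: "A \<inter> B = {}"
    proof (rule ccontr)
      assume "A \<inter> B \<noteq> {}"
      then obtain z where "(u, z) \<in> E" "(w, z) \<in> E"
        by (auto simp: A_def B_def)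
      then have "(u, z, w) \<in> triangles E"
        using wu E_sym by (auto simp: triangles_def)
      then show False using tri by simp
    qed
    have notin: "u \<notin> A" "w \<notin> A" "u \<notin> B" "w \<notin> B"
      by (auto simp: A_def B_def E_irrefl)
    have sub: "A \<subseteq> V" "B \<subseteq> V"
      using nbrs_sub by (auto simp: A_def B_def)
    \<comment> \<open>On each star this is the eigenvector \<open>(3, -1, -1, -1)\<close> for the
      eigenvalue 4, scaled to the prescribed value at \<open>u\<close> or \<open>w\<close>.\<close>
    define x where "x i = (if i = u then p else if i = w then q else if i \<in> A then - p / 3
      else if i \<in> B then - q / 3 else 0)" for i
    have xA: "x i = - p / 3" if "i \<in> A" for i
      using that notin by (auto simp: x_def)
    have xB: "x i = - q / 3" if "i \<in> B" for i
      using that notin disj by (auto simp: x_def)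
    have xu: "x u = p" and xw: "x w = q"
      using uw(3) by (auto simp: x_def)
    have "(\<Sum>v\<in>V. (x v)\<^sup>2) = (\<Sum>v\<in>insert u (insert w (A \<union> B)). (x v)\<^sup>2)"
      using sub uw(1,2) finite_V by (intro sum.mono_neutral_right) (auto simp: x_def)
    also have "\<dots> = p\<^sup>2 + q\<^sup>2 + ((\<Sum>v\<in>A. (x v)\<^sup>2) + (\<Sum>v\<in>B. (x v)\<^sup>2))"
      using uw(3) notin fin disj xu xw by (simp add: sum.union_disjoint)
    also have "\<dots> = 4 / 3 * p\<^sup>2 + 4 / 3 * q\<^sup>2"
      using xA xB card by (simp add: power2_eq_square)
    finally have norm: "(\<Sum>v\<in>V. (x v)\<^sup>2) = 4 / 3 * p\<^sup>2 + 4 / 3 * q\<^sup>2" .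
    let ?F = "\<lambda>(u, v). (x u - x v)\<^sup>2"
    have star: "sum ?F ({a} \<times> X) = card X * (a' - b)\<^sup>2" "sum ?F (X \<times> {a}) = card X * (a' - b)\<^sup>2"
      if "x a = a'" "\<And>i. i \<in> X \<Longrightarrow> x i = b" for a X and a' b :: real
    proof -
      have "sum ?F ({a} \<times> X) = sum (\<lambda>_. (a' - b)\<^sup>2) X"
        using that by (simp add: sum.cartesian_product[symmetric])
      then show "sum ?F ({a} \<times> X) = card X * (a' - b)\<^sup>2" by simp
      have "sum ?F (X \<times> {a}) = sum (\<lambda>_. (a' - b)\<^sup>2) X"
        using that by (simp add: sum.cartesian_product[symmetric] power2_commute)
      then show "sum ?F (X \<times> {a}) = card X * (a' - b)\<^sup>2" by simp
    qed
    \<comment> \<open>Edges outside the two stars, such as \<open>(u, w)\<close> itself, can only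
      lower the form, so it suffices to keep the star edges in both orientations.\<close>
    have "sum ?F ({u} \<times> A \<union> A \<times> {u} \<union> ({w} \<times> B \<union> B \<times> {w})) \<le> sum ?F E"
      by (rule sum_mono2) (use finite_E E_sym in \<open>auto simp: A_def B_def\<close>)
    moreover have "sum ?F ({u} \<times> A \<union> A \<times> {u} \<union> ({w} \<times> B \<union> B \<times> {w})) =
        sum ?F ({u} \<times> A) + sum ?F (A \<times> {u}) + (sum ?F ({w} \<times> B) + sum ?F (B \<times> {w}))"
    proof -
      have "({u} \<times> A) \<inter> (A \<times> {u}) = {}" "({w} \<times> B) \<inter> (B \<times> {w}) = {}"
        "({u} \<times> A \<union> A \<times> {u}) \<inter> ({w} \<times> B \<union> B \<times> {w}) = {}"
        using notin uw(3) by auto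
      then show ?thesis
        using fin by (simp only: sum.union_disjoint finite_UnI finite_cartesian_product finite.emptyI finite.insertI)
    qed
    ultimately have "2 * (3 * (p - - p / 3)\<^sup>2) + 2 * (3 * (q - - q / 3)\<^sup>2) \<le> sum ?F E"
      using star[of u p A "- p / 3"] star[of w q B "- q / 3"] xu xw xA xB card by simp
    then have "32 / 3 * p\<^sup>2 + 32 / 3 * q\<^sup>2 \<le> sum ?F E"
      by (simp add: power2_eq_square)
    then have "quad_form V ?f x \<le> 0"
      unfolding quad_form_char norm by simp
    then show ?thesis
      using xu xw by blast
  qed
  show ?thesis
    unfolding lap_char_def
    using set_det_two_nonpositive_directions[of ?S u w ?f, OF _ _ _ uw(3) symmetric_on_char pd] ext finite_V
    by (simp add: V)
qed

text \<open>An eigenvector for the eigenvalue \<open>n\<close> lies in the kernel of the Laplacian of the complement,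
  so the complement is disconnected.\<close>

lemma leaf_imp_card_not_eigenvalue:
  assumes leaf: "a \<in> V" "E `` {a} = {b}" and b: "deg E b < card V - 1" and n: "2 < card V"
  shows "lap_char V E (card V) \<noteq> 0"
proof
  assume "lap_char V E (card V) = 0"
  then obtain x where nz: "\<exists>i\<in>V. x i \<noteq> 0" and
    ker: "\<And>i. i \<in> V \<Longrightarrow> (\<Sum>j\<in>V. ((if i = j then real (card V) else 0) - lap E i j) * x j) = 0"
    unfolding lap_char_def set_det_eq_0_iff[OF finite_V] by blast
  have row: "(\<Sum>j\<in>V. lap E i j * x j) = card V * x i" if "i \<in> V" for i
  proof -
    have "(\<Sum>j\<in>V. ((if i = j then real (card V) else 0) - lap E i j) * x j) =
        (\<Sum>j\<in>V. if j = i then real (card V) * x j else 0) - (\<Sum>j\<in>V. lap E i j * x j)"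
      unfolding sum_subtractf[symmetric] by (intro sum.cong refl) (auto simp: left_diff_distrib)
    then show ?thesis
      using ker[OF that] that finite_V by simp
  qed
  \<comment> \<open>Summing the eigenvalue equation over all rows: the columns of the Laplacian have
    sum 0, so \<open>x\<close> is orthogonal to the constants.\<close>
  have "card V * (\<Sum>i\<in>V. x i) = (\<Sum>i\<in>V. \<Sum>j\<in>V. lap E i j * x j)"
    by (simp add: row sum_distrib_left)
  also have "\<dots> = (\<Sum>j\<in>V. (\<Sum>i\<in>V. lap E j i) * x j)"
    unfolding sum_distrib_right by (subst sum.swap) (intro sum.cong refl arg_cong2[of _ _ _ _ "(*)"] lap_sym)
  finally have sum0: "(\<Sum>i\<in>V. x i) = 0"
    using n by (simp add: sum_lap)
  define F where "F = {(i, j). i \<in> V \<and> j \<in> V \<and> i \<noteq> j \<and> (i, j) \<notin> E}"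
  have "simple_graph V F"
    using finite_V E_sym by unfold_locales (auto simp: F_def)
  then interpret F: simple_graph V F .
  \<comment> \<open>The Laplacian of the complement is \<open>n I - J - L\<close>, with
    \<open>J\<close> the all-ones matrix; \<open>J\<close> annihilates \<open>x\<close> because its
    entries sum to 0.\<close>
  have lapF: "lap F i j = (if i = j then real (card V) else 0) - 1 - lap E i j" if "i \<in> V" "j \<in> V" for i j
  proof (cases "i = j")
    case True
    have "F `` {i} = V - {i} - E `` {i}"
      using that E_sub by (auto simp: F_def)
    moreover have "E `` {i} \<subseteq> V - {i}"
      using nbrs_sub E_irrefl by auto
    ultimately have "card (F `` {i}) = card (V - {i}) - card (E `` {i})"
      using finite_nbrs by (simp add: card_Diff_subset)
    moreover have "card (E `` {i}) \<le> card (V - {i})"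
      using \<open>E `` {i} \<subseteq> V - {i}\<close> finite_V by (intro card_mono) auto
    moreover have "card (V - {i}) = card V - 1" "1 \<le> card V"
      using that n by auto
    ultimately have "real (deg F i) = real (card V) - 1 - real (deg E i)"
      by (simp add: deg_def of_nat_diff)
    then show ?thesis
      using True by (simp add: lap_def adj_refl F.adj_refl)
  next
    case False
    then show ?thesis
      using that by (auto simp: lap_def adj_def F_def)
  qed
  have rowF: "(\<Sum>j\<in>V. lap F i j * x j) = 0" if "i \<in> V" for i
  proof -
    have "(\<Sum>j\<in>V. lap F i j * x j) = (\<Sum>j\<in>V. ((if i = j then real (card V) else 0) - lap E i j) * x j) - (\<Sum>j\<in>V. x j)"
      unfolding sum_subtractf[symmetric] using that
      by (intro sum.cong refl) (simp add: lapF algebra_simps)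
    then show ?thesis
      using ker[OF that] sum0 by simp
  qed
  have "quad_form V (lap F) x = (\<Sum>i\<in>V. x i * (\<Sum>j\<in>V. lap F i j * x j))"
    unfolding quad_form_def sum_distrib_left by (intro sum.cong refl) (simp add: mult_ac)
  then have "(\<Sum>(u, v)\<in>F. (x u - x v)\<^sup>2) \<le> 0"
    using F.quad_form_lap[of x] rowF by simp
  then have const: "x i = x j" if "(i, j) \<in> F" for i j
    by (rule F.sum_edges_zero_constant[OF _ that])
  have ab: "b \<in> V"
    using leaf(2) nbrs_sub[of a] by auto
  \<comment> \<open>In the complement the leaf \<open>a\<close> is adjacent to everything except
    \<open>b\<close>, and \<open>b\<close> has some neighbour there since
    \<open>deg E b < card V - 1\<close>. So \<open>x\<close> is constant, and having sum 0 it is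
    zero.\<close>
  have other: "x i = x a" if "i \<in> V" "i \<noteq> b" for i
  proof (cases "i = a")
    case False
    have "(i, a) \<notin> E"
      using that(2) leaf(2) E_sym by blast
    then show ?thesis
      using that False leaf(1) by (intro const) (simp add: F_def)
  qed simp
  have "\<not> V - {b} \<subseteq> E `` {b}"
  proof
    assume "V - {b} \<subseteq> E `` {b}"
    then have "card (V - {b}) \<le> deg E b"
      unfolding deg_def using finite_nbrs by (intro card_mono)
    then show False
      using b ab finite_V by simp
  qed
  then obtain z where "z \<in> V" "z \<noteq> b" "(b, z) \<notin> E" by auto
  then have "(b, z) \<in> F"
    using ab by (auto simp: F_def)
  then have "x b = x a"
    using const other[OF \<open>z \<in> V\<close> \<open>z \<noteq> b\<close>] by fastforce
  then have all: "x i = x a" if "i \<in> V" for i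
    using other that by (cases "i = b") auto
  have "(\<Sum>i\<in>V. x i) = (\<Sum>i\<in>V. x a)"
    by (intro sum.cong refl all)
  then have "x a = 0"
    using sum0 n by auto
  then show False
    using nz all by auto
qed

end

section \<open>Unicyclic graphs\<close>

text \<open>The factorization \<open>L = B B^T\<close>, where \<open>B\<close> is the incidence
  matrix of an orientation: \<open>A\<close> contains each edge in exactly one direction.\<close>

lemma lap_orientation:
  assumes "simple_graph V E" and A: "E = A \<union> A\<inverse>" "A \<inter> A\<inverse> = {}"
  shows "lap E i j = (\<Sum>(p, q)\<in>A. (of_bool (i = p) - of_bool (i = q)) * (of_bool (j = p) - of_bool (j = q)))"
proof -
  interpret simple_graph V E by fact
  have finA: "finite A"
    using finite_E A(1) by auto
  have loop: "p \<noteq> q" if "(p, q) \<in> A" for p q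
    using that E_irrefl[of p] unfolding A(1) by blast
  have sumE: "sum f E = (\<Sum>(p, q)\<in>A. f (p, q) + f (q, p))" for f :: "'a \<times> 'a \<Rightarrow> real"
  proof -
    have "sum f (A\<inverse>) = (\<Sum>(p, q)\<in>A. f (q, p))"
      by (rule sum.reindex_bij_witness[of _ prod.swap prod.swap]) auto
    moreover have "sum f E = sum f A + sum f (A\<inverse>)"
      unfolding A(1) by (rule sum.union_disjoint) (use finA A(2) in auto)
    ultimately show ?thesis
      by (simp add: sum.distrib case_prod_beta)
  qed
  have "real (deg E i) = (\<Sum>e\<in>E. of_bool (fst e = i))"
  proof -
    have "(\<Sum>e\<in>E. of_bool (fst e = i)) = real (card (E \<inter> {e. fst e = i}))"
      using finite_E by (simp add: of_bool_def sum.If_cases)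
    moreover have "E \<inter> {e. fst e = i} = Pair i ` (E `` {i})"
      by auto
    ultimately show ?thesis
      by (simp add: deg_def card_image inj_on_def)
  qed
  then have deg: "real (deg E i) = (\<Sum>(p, q)\<in>A. of_bool (p = i) + of_bool (q = i))"
    by (simp add: sumE)
  have "adj E i j = (\<Sum>e\<in>E. of_bool (e = (i, j)))"
    using finite_E by (simp add: adj_def of_bool_def)
  then have adj: "adj E i j = (\<Sum>(p, q)\<in>A. of_bool (p = i \<and> q = j) + of_bool (q = i \<and> p = j))"
    by (simp add: sumE)
  have "lap E i j = of_bool (i = j) * real (deg E i) - adj E i j"
    by (simp add: lap_def)
  also have "\<dots> = (\<Sum>e\<in>A. of_bool (i = j) * (of_bool (fst e = i) + of_bool (snd e = i)) -
      (of_bool (fst e = i \<and> snd e = j) + of_bool (snd e = i \<and> fst e = j)))"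
    unfolding deg adj case_prod_beta by (simp only: sum_subtractf sum_distrib_left)
  also have "\<dots> = (\<Sum>(p, q)\<in>A. (of_bool (i = p) - of_bool (i = q)) * (of_bool (j = p) - of_bool (j = q)))"
  proof (intro sum.cong refl, clarify)
    fix p q assume "(p, q) \<in> A"
    then have "p \<noteq> q" by (rule loop)
    then show "of_bool (i = j) * (of_bool (fst (p, q) = i) + of_bool (snd (p, q) = i)) -
        (of_bool (fst (p, q) = i \<and> snd (p, q) = j) + of_bool (snd (p, q) = i \<and> fst (p, q) = j)) =
        (of_bool (i = p) - of_bool (i = q)) * (of_bool (j = p) - of_bool (j = q) :: real)"
      by (cases "i = p"; cases "i = q"; cases "j = p"; cases "j = q") simp_all
  qed
  finally show ?thesis .
qed

text \<open>Counts how often \<open>w\<close> occurs among the first \<open>n\<close> vertices of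
  \<open>a\<close>, \<open>\<pi> a\<close>, \<open>\<pi> (\<pi> a)\<close> and so on. Real values,
  because it serves as a coefficient vector.\<close>

primrec ancestors :: "('a \<Rightarrow> 'a) \<Rightarrow> nat \<Rightarrow> 'a \<Rightarrow> 'a \<Rightarrow> real" where
  "ancestors \<pi> 0 a w = 0"
| "ancestors \<pi> (Suc n) a w = of_bool (w = a) + ancestors \<pi> n (\<pi> a) w"

locale rooted_tree =
  fixes V :: "'a set" and c :: 'a and \<delta> :: "'a \<Rightarrow> nat" and \<pi> :: "'a \<Rightarrow> 'a"
  assumes finV: "finite V" and root: "c \<in> V" "\<delta> c = 0"
    and parent: "w \<in> V \<Longrightarrow> w \<noteq> c \<Longrightarrow> \<pi> w \<in> V \<and> \<delta> w = Suc (\<delta> (\<pi> w))"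
begin

abbreviation "S \<equiv> V - {c}"

text \<open>Column \<open>w\<close> stands for the tree edge from \<open>w\<close> to its
  parent.\<close>

definition N :: "'a \<Rightarrow> 'a \<Rightarrow> real" where
  "N i w = of_bool (i = w) - of_bool (i = \<pi> w)"

text \<open>With \<open>\<delta> a\<close> steps the walk stops just before the root. A vertex
  standing for the edge to its parent, \<open>h a\<close> is the edge set of the path from
  \<open>a\<close> to the root.\<close>

definition h :: "'a \<Rightarrow> 'a \<Rightarrow> real" where
  "h a = ancestors \<pi> (\<delta> a) a"

lemma h_root: "h c w = 0"
  by (simp add: h_def root)

lemma h_step: "a \<in> S \<Longrightarrow> h a w = of_bool (w = a) + h (\<pi> a) w"
  using parent[of a] by (simp add: h_def)

lemma tree_induct [consumes 1, case_names root step]: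
  assumes "a \<in> V" "P c" "\<And>a. a \<in> S \<Longrightarrow> P (\<pi> a) \<Longrightarrow> P a"
  shows "P a"
  using assms(1)
proof (induction "\<delta> a" arbitrary: a rule: less_induct)
  case less
  then show ?case
    using assms(2,3) parent[of a] by (cases "a = c") auto
qed

lemma h_support: "a \<in> V \<Longrightarrow> h a w \<noteq> 0 \<Longrightarrow> \<delta> w \<le> \<delta> a \<and> (\<delta> w = \<delta> a \<longrightarrow> w = a)"
proof (induction a arbitrary: w rule: tree_induct)
  case root
  then show ?case by (simp add: h_root)
next
  case (step a)
  show ?case
  proof (cases "w = a")
    case False
    then have "h (\<pi> a) w \<noteq> 0"
      using h_step[OF step(1), of w] step(3) by simp
    then have "\<delta> w \<le> \<delta> (\<pi> a)"
      using step(2) by blast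
    then show ?thesis
      using parent[of a] step(1) by auto
  qed simp
qed

lemma h_self: "a \<in> S \<Longrightarrow> h a a = 1"
proof -
  assume a: "a \<in> S"
  then have "\<pi> a \<in> V" "\<delta> a = Suc (\<delta> (\<pi> a))"
    using parent[of a] by auto
  then have "h (\<pi> a) a = 0"
    using h_support[of "\<pi> a" a] by auto
  then show ?thesis
    using h_step[OF a, of a] by simp
qed

text \<open>The oriented edges on the path from \<open>a\<close> to the root telescope to
  \<open>a\<close> minus the root, and the row of the root has been deleted.\<close>

lemma N_h: "a \<in> V \<Longrightarrow> i \<in> S \<Longrightarrow> (\<Sum>w\<in>S. N i w * h a w) = of_bool (i = a)"
proof (induction a rule: tree_induct)
  case root
  then show ?case by (simp add: h_root)
next
  case (step a)
  have "(\<Sum>w\<in>S. N i w * h a w) = (\<Sum>w\<in>S. (if w = a then N i w else 0) + N i w * h (\<pi> a) w)"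
    using h_step[OF step(1)] by (intro sum.cong) (auto simp: distrib_left)
  also have "\<dots> = N i a + of_bool (i = \<pi> a)"
    using step finV by (simp add: sum.distrib)
  finally show ?case by (simp add: N_def)
qed

lemma det_N: "set_det S N = 1"
proof -
  have "set_det S N = (\<Prod>i\<in>S. N i i)"
    by (rule set_det_triangular[where r = \<delta>]) (use finV parent in \<open>auto simp: N_def of_bool_def split: if_splits\<close>)
  also have "\<dots> = 1"
    using parent by (intro prod.neutral) (force simp: N_def)
  finally show ?thesis .
qed

text \<open>\<open>N\<close> is the reduced incidence matrix of the tree. If \<open>N y\<close> is the incidence vector of the
  additional edge, the reduced Laplacian is \<open>N (I + y y\<^sup>T) N\<^sup>T\<close>.\<close>

lemma unicyclic_reduced_lap_det:
  assumes G: "simple_graph V E" and ab: "a \<in> V" "b \<in> V" "a \<noteq> b"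
    and non_tree: "\<And>w. w \<in> S \<Longrightarrow> (a, b) \<noteq> (w, \<pi> w) \<and> (b, a) \<noteq> (w, \<pi> w)"
    and E: "E = (\<lambda>w. (w, \<pi> w)) ` S \<union> (\<lambda>w. (\<pi> w, w)) ` S \<union> {(a, b), (b, a)}"
  shows "set_det S (lap E) = 1 + (\<Sum>w\<in>S. (h a w - h b w)\<^sup>2)"
proof -
  define A where "A = insert (a, b) ((\<lambda>w. (w, \<pi> w)) ` S)"
  \<comment> \<open>The common part of the two root paths cancels: \<open>y\<close> is
    \<open>1\<close> or \<open>-1\<close> on the tree path from \<open>a\<close> to \<open>b\<close>
    and 0 elsewhere. So its squared norm plus 1 is the length of the cycle.\<close>
  define y where "y w = h a w - h b w" for w
  have finS: "finite S" using finV by simp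
  have AE: "E = A \<union> A\<inverse>"
    unfolding E A_def by auto
  have disj: "A \<inter> A\<inverse> = {}"
  proof -
    have "\<pi> (\<pi> w) \<noteq> w" if "w \<in> S" "\<pi> w \<in> S" for w
      using parent[of w] parent[of "\<pi> w"] that by force
    moreover have "(b, a) \<notin> (\<lambda>w. (w, \<pi> w)) ` S" "(a, b) \<notin> (\<lambda>w. (w, \<pi> w)) ` S"
      using non_tree by (auto simp only: image_iff)
    ultimately show ?thesis
      using ab(3) unfolding A_def by (force simp: converse_unfold)
  qed
  have y: "(\<Sum>w\<in>S. N i w * y w) = of_bool (i = a) - of_bool (i = b)" if "i \<in> S" for i
    using N_h[OF ab(1) that] N_h[OF ab(2) that] by (simp add: y_def right_diff_distrib sum_subtractf)
  let ?K = "\<lambda>i j. (if i = j then 1 else 0) + 1 * (y i * y j)"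
  have lapN: "lap E i j = (\<Sum>l\<in>S. (\<Sum>k\<in>S. N i k * ?K k l) * N j l)" if ij: "i \<in> S" "j \<in> S" for i j
  proof -
    have "lap E i j = (of_bool (i = a) - of_bool (i = b)) * (of_bool (j = a) - of_bool (j = b)) +
        (\<Sum>(p, q)\<in>(\<lambda>w. (w, \<pi> w)) ` S. (of_bool (i = p) - of_bool (i = q)) * (of_bool (j = p) - of_bool (j = q)))"
      unfolding lap_orientation[OF G AE disj] unfolding A_def
      using non_tree finS by (subst sum.insert) auto
    also have "(\<Sum>(p, q)\<in>(\<lambda>w. (w, \<pi> w)) ` S. (of_bool (i = p) - of_bool (i = q)) * (of_bool (j = p) - of_bool (j = q))) =
        (\<Sum>w\<in>S. N i w * N j w)"
      by (subst sum.reindex) (auto simp: inj_on_def N_def)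
    finally have L: "lap E i j = (\<Sum>w\<in>S. N i w * y w) * (\<Sum>w\<in>S. N j w * y w) + (\<Sum>w\<in>S. N i w * N j w)"
      using y ij by simp
    have "(\<Sum>k\<in>S. N i k * ?K k l) = N i l + (\<Sum>k\<in>S. N i k * y k) * y l" if "l \<in> S" for l
    proof -
      have "(\<Sum>k\<in>S. N i k * ?K k l) = (\<Sum>k\<in>S. (if k = l then N i k else 0) + N i k * y k * y l)"
        by (intro sum.cong) (auto simp: distrib_left)
      then show ?thesis
        using that finS by (simp add: sum.distrib sum_distrib_right)
    qed
    then have "(\<Sum>l\<in>S. (\<Sum>k\<in>S. N i k * ?K k l) * N j l) =
        (\<Sum>l\<in>S. N i l * N j l + (\<Sum>k\<in>S. N i k * y k) * (N j l * y l))"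
      by (intro sum.cong) (auto simp: algebra_simps)
    then show ?thesis
      using L by (simp add: sum.distrib sum_distrib_left)
  qed
  have "set_det S (lap E) = set_det S (\<lambda>i j. \<Sum>l\<in>S. (\<Sum>k\<in>S. N i k * ?K k l) * N j l)"
    using lapN finS by (intro set_det_cong) auto
  also have "\<dots> = set_det S N * set_det S ?K * set_det S (\<lambda>l j. N j l)"
    using set_det_mult[OF finS, of "\<lambda>i l. \<Sum>k\<in>S. N i k * ?K k l" "\<lambda>l j. N j l"]
      set_det_mult[OF finS, of N ?K] by simp
  also have "\<dots> = set_det S ?K"
    using set_det_transpose[OF finS, of N] det_N by simp
  also have "\<dots> = 1 + 1 * (\<Sum>w\<in>S. (y w)\<^sup>2)"
    by (rule set_det_identity_plus_rank_one[OF finS]) simp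
  finally show ?thesis
    by (simp add: y_def)
qed

end

section \<open>Breadth-first trees and triangle-free unicyclic graphs\<close>

context simple_graph
begin

definition distance :: "'a \<Rightarrow> 'a \<Rightarrow> nat" where
  "distance c v = (LEAST n. (c, v) \<in> E ^^ n)"

lemma distance_le: "(c, v) \<in> E ^^ n \<Longrightarrow> distance c v \<le> n"
  by (simp add: distance_def Least_le)

lemma distance_path: "(c, v) \<in> E\<^sup>* \<Longrightarrow> (c, v) \<in> E ^^ distance c v"
  unfolding distance_def by (metis LeastI rtrancl_imp_relpow)

lemma distance_edge: "(c, u) \<in> E\<^sup>* \<Longrightarrow> (u, v) \<in> E \<Longrightarrow> distance c v \<le> Suc (distance c u)"
  using distance_path[of c u] by (intro distance_le) auto

text \<open>The parent is the last but one vertex of a shortest path. Using distances as depths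
  bounds the difference in depth along any edge outside the tree by 1.\<close>

lemma bfs_tree:
  assumes c: "c \<in> V" and conn: "spans_from c V E"
  obtains \<pi> where "rooted_tree V c (distance c) \<pi>" "\<And>w. w \<in> V - {c} \<Longrightarrow> (w, \<pi> w) \<in> E"
proof -
  have ex: "\<exists>u. (u, w) \<in> E \<and> distance c w = Suc (distance c u)" if w: "w \<in> V - {c}" for w
  proof -
    have path: "(c, w) \<in> E ^^ distance c w"
      using conn w distance_path by (auto simp: spans_from_def)
    with w obtain m where m: "distance c w = Suc m"
      by (cases "distance c w") auto
    then obtain u where u: "(c, u) \<in> E ^^ m" "(u, w) \<in> E"
      using path by auto
    then have "distance c u \<le> m" "(c, u) \<in> E\<^sup>*"
      by (auto intro: distance_le relpow_imp_rtrancl)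
    then show ?thesis
      using distance_edge[of c u w] u m by force
  qed
  then obtain \<pi> where \<pi>: "\<And>w. w \<in> V - {c} \<Longrightarrow> (\<pi> w, w) \<in> E \<and> distance c w = Suc (distance c (\<pi> w))"
    by metis
  have "distance c c = 0"
    using distance_le[of c c 0] by simp
  then have "rooted_tree V c (distance c) \<pi>"
    using finite_V c \<pi> E_sub by unfold_locales auto
  then show thesis
    using that \<pi> E_sym by blast
qed

text \<open>\<open>E\<close> counts arcs, so there are as many edges as vertices, one more than in
  the tree. The determinant is at least 4 once three tree edges lie on the cycle: those from
  \<open>a\<close>, \<open>b\<close> and \<open>\<pi> a\<close> to their parents, where
  \<open>a\<close> is the endpoint of the extra edge that is at least as deep as
  \<open>b\<close>.\<close>

lemma triangle_free_unicyclic_reduced_lap_det: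
  assumes c: "c \<in> V" and conn: "spans_from c V E" and card: "card E = 2 * card V"
    and tri: "triangles E = {}"
  shows "set_det (V - {c}) (lap E) \<ge> 4"
proof -
  obtain \<pi> where tree: "rooted_tree V c (distance c) \<pi>" and \<pi>E: "\<And>w. w \<in> V - {c} \<Longrightarrow> (w, \<pi> w) \<in> E"
    using bfs_tree[OF c conn] by blast
  interpret T: rooted_tree V c "distance c" \<pi> by fact
  let ?\<delta> = "distance c"
  define A where "A = (\<lambda>w. (w, \<pi> w)) ` T.S"
  have finA: "finite A"
    using finite_V by (simp add: A_def)
  have disj: "A \<inter> A\<inverse> = {}"
  proof -
    have "\<pi> (\<pi> w) \<noteq> w" if "w \<in> T.S" "\<pi> w \<in> T.S" for w
      using T.parent[of w] T.parent[of "\<pi> w"] that by force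
    then show ?thesis
      unfolding A_def by (force simp: converse_unfold)
  qed
  have "card A = card V - 1"
    using c finite_V by (simp add: A_def card_image inj_on_def)
  then have cardT: "card (A \<union> A\<inverse>) = 2 * (card V - 1)"
    using finA disj by (simp add: card_Un_disjoint card_inverse)
  have sub: "A \<union> A\<inverse> \<subseteq> E"
    using \<pi>E E_sym by (auto simp: A_def)
  have "card V > 0"
    using c finite_V by (auto simp: card_gt_0_iff)
  then have card2: "card (E - (A \<union> A\<inverse>)) = 2"
    using cardT card sub finA by (simp add: card_Diff_subset)
  then obtain a0 b0 where ab0: "(a0, b0) \<in> E - (A \<union> A\<inverse>)"
    by (cases "E - (A \<union> A\<inverse>) = {}") auto
  have sw: "(q, p) \<in> E - (A \<union> A\<inverse>)" if "(p, q) \<in> E - (A \<union> A\<inverse>)" for p q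
    using that E_sym by auto
  obtain a b where ab: "(a, b) \<in> E - (A \<union> A\<inverse>)" "?\<delta> b \<le> ?\<delta> a"
  proof (cases "?\<delta> b0 \<le> ?\<delta> a0")
    case True
    then show ?thesis using that ab0 by blast
  next
    case False
    then show ?thesis using that sw[OF ab0] by fastforce
  qed
  have abV: "a \<in> V" "b \<in> V" "a \<noteq> b"
    using ab E_sub E_irrefl by auto
  have "{(a, b), (b, a)} = E - (A \<union> A\<inverse>)"
    using card2 ab(1) sw[OF ab(1)] abV(3) finite_E
    by (intro card_subset_eq) auto
  then have E_eq: "E = A \<union> A\<inverse> \<union> {(a, b), (b, a)}"
    using sub by blast
  have non_tree: "(a, b) \<noteq> (w, \<pi> w) \<and> (b, a) \<noteq> (w, \<pi> w)" if "w \<in> T.S" for w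
    using ab(1) that by (auto simp: A_def)
  have "A\<inverse> = (\<lambda>w. (\<pi> w, w)) ` T.S"
    by (auto simp: A_def)
  then have det: "set_det (V - {c}) (lap E) = 1 + (\<Sum>w\<in>T.S. (T.h a w - T.h b w)\<^sup>2)"
    using E_eq by (intro T.unicyclic_reduced_lap_det[OF simple_graph_axioms abV non_tree]) (auto simp: A_def)
  have \<delta>0: "v = c" if "v \<in> V" "?\<delta> v = 0" for v
    using T.parent[of v] that by auto
  have zero: "T.h p q = 0" if "p \<in> V" "?\<delta> p \<le> ?\<delta> q" "p \<noteq> q" for p q
  proof (rule ccontr)
    assume "T.h p q \<noteq> 0"
    then have "?\<delta> q \<le> ?\<delta> p \<and> (?\<delta> q = ?\<delta> p \<longrightarrow> q = p)"
      by (rule T.h_support[OF that(1)])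
    then show False
      using that by simp
  qed
  have "?\<delta> a \<le> Suc (?\<delta> b)"
    using conn abV E_sym ab by (intro distance_edge) (auto simp: spans_from_def)
  then consider "?\<delta> a = ?\<delta> b" | "?\<delta> a = Suc (?\<delta> b)"
    using ab(2) by linarith
  then have "\<exists>p. p \<in> T.S \<and> a \<in> T.S \<and> b \<in> T.S \<and> p \<noteq> a \<and> p \<noteq> b \<and>
      T.h a a - T.h b a = 1 \<and> T.h a b - T.h b b = -1 \<and> T.h a p - T.h b p = 1"
  proof cases
    \<comment> \<open>At equal depth the parents differ, for otherwise \<open>a\<close>,
      \<open>b\<close> and the common parent form a triangle. Hence \<open>\<pi> a\<close> is not
      the root and has a parent edge of its own.\<close>
    case 1
    have aS: "a \<in> T.S" and bS: "b \<in> T.S"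
      using abV 1 \<delta>0[of a] \<delta>0[of b] T.root(2) by auto
    note pa = T.parent[of a] and pb = T.parent[of b]
    have "\<pi> a \<noteq> \<pi> b"
    proof
      assume "\<pi> a = \<pi> b"
      then have "(a, b, \<pi> a) \<in> triangles E"
        using \<pi>E[OF aS] \<pi>E[OF bS] ab(1) E_sym by (auto simp: triangles_def)
      then show False using tri by simp
    qed
    moreover have "\<pi> a \<noteq> c"
      using calculation pa pb aS bS 1 \<delta>0[of "\<pi> b"] T.root(2) by auto
    moreover have "T.h a (\<pi> a) = 1"
      using T.h_step[OF aS, of "\<pi> a"] T.h_self[of "\<pi> a"] pa aS calculation by auto
    moreover have "T.h b (\<pi> a) = 0"
      using T.h_step[OF bS, of "\<pi> a"] zero[of "\<pi> b" "\<pi> a"] pa pb aS bS calculation 1 by auto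
    moreover have "T.h b a = 0" "T.h a b = 0"
      using zero abV 1 by auto
    moreover have "\<pi> a \<noteq> a" "\<pi> a \<noteq> b"
      using pa pb aS bS 1 by auto
    ultimately show ?thesis
      using T.h_self[OF aS] T.h_self[OF bS] aS bS pa by (intro exI[of _ "\<pi> a"]) auto
  next
    \<comment> \<open>One level apart, \<open>\<pi> a\<close> and \<open>b\<close> have equal depth
      and differ because the extra edge is not a tree edge; again neither is the root.\<close>
    case 2
    then have aS: "a \<in> T.S"
      using abV T.root(2) by auto
    note pa = T.parent[of a]
    have ne: "\<pi> a \<noteq> b"
      using non_tree[OF aS] by auto
    have "?\<delta> (\<pi> a) = ?\<delta> b"
      using pa aS 2 by auto
    then have bS: "b \<in> T.S" and pS: "\<pi> a \<in> T.S"
      using ne abV pa aS \<delta>0[of b] \<delta>0[of "\<pi> a"] T.root(2) by auto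
    have "T.h b a = 0" "T.h (\<pi> a) b = 0" "T.h b (\<pi> a) = 0"
      using zero abV pS ne 2 \<open>?\<delta> (\<pi> a) = ?\<delta> b\<close> by auto
    moreover have "T.h a b = T.h (\<pi> a) b"
      using T.h_step[OF aS, of b] abV by auto
    moreover have "\<pi> a \<noteq> a"
      using pa aS by auto
    moreover have "T.h a (\<pi> a) = 1"
      using T.h_step[OF aS, of "\<pi> a"] T.h_self[OF pS] \<open>\<pi> a \<noteq> a\<close> by auto
    ultimately show ?thesis
      using T.h_self[OF aS] T.h_self[OF bS] aS bS pS ne by (intro exI[of _ "\<pi> a"]) auto
  qed
  then obtain p where p: "p \<in> T.S" "a \<in> T.S" "b \<in> T.S" "p \<noteq> a" "p \<noteq> b"
    "T.h a a - T.h b a = 1" "T.h a b - T.h b b = -1" "T.h a p - T.h b p = 1"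
    by blast
  have "(\<Sum>w\<in>{a, b, p}. (T.h a w - T.h b w)\<^sup>2) \<le> (\<Sum>w\<in>T.S. (T.h a w - T.h b w)\<^sup>2)"
    using p finite_V by (intro sum_mono2) auto
  moreover have "(\<Sum>w\<in>{a, b, p}. (T.h a w - T.h b w)\<^sup>2) = 3"
    using p abV(3) by auto
  ultimately show ?thesis
    using det by simp
qed

end

section \<open>Path-friendship graphs\<close>

abbreviation "pf_verts s ls \<equiv> pverts (path_friendship_graph s ls)"
abbreviation "pf_arcs s ls \<equiv> parcs (path_friendship_graph s ls)"

lemma path_vertex_simps [simp]:
  "path_vertex j m = Pth j' m' \<longleftrightarrow> m = m' \<and> j = j' \<and> 0 < m'"
  "Pth j' m' = path_vertex j m \<longleftrightarrow> m = m' \<and> j = j' \<and> 0 < m'"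
  "path_vertex j m = Center \<longleftrightarrow> m = 0" "Center = path_vertex j m \<longleftrightarrow> m = 0"
  "path_vertex j m \<noteq> Tri i b" "Tri i b \<noteq> path_vertex j m"
  by (auto simp: path_vertex_def)

lemma symcl_iff: "(u, v) \<in> symcl R \<longleftrightarrow> (u, v) \<in> R \<or> (v, u) \<in> R"
  by (force simp: symcl_def)

lemma pf_verts_simps [simp]:
  "Center \<in> pf_verts s ls"
  "Tri i b \<in> pf_verts s ls \<longleftrightarrow> i < s"
  "Pth j m \<in> pf_verts s ls \<longleftrightarrow> j < length ls \<and> 1 \<le> m \<and> m \<le> ls ! j"
  by (auto simp: path_friendship_graph_def friendship_graph_def pendant_path_def)

lemma pf_arcs_iff:
  "(u, v) \<in> pf_arcs s ls \<longleftrightarrow>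
    (\<exists>i b. i < s \<and> ((u, v) = (Center, Tri i b) \<or> (u, v) = (Tri i b, Center) \<or> (u, v) = (Tri i b, Tri i (\<not> b)))) \<or>
    (\<exists>j m. j < length ls \<and> m < ls ! j \<and>
      ((u, v) = (path_vertex j m, path_vertex j (Suc m)) \<or> (u, v) = (path_vertex j (Suc m), path_vertex j m)))"
    (is "?L \<longleftrightarrow> ?R1 \<or> ?R2")
proof -
  have "?L \<longleftrightarrow> (u, v) \<in> parcs (friendship_graph s) \<or> (\<exists>j<length ls. (u, v) \<in> parcs (pendant_path j (ls ! j)))"
    by (auto simp: path_friendship_graph_def)
  moreover have "(u, v) \<in> parcs (friendship_graph s) \<longleftrightarrow> ?R1"
  proof
    assume "(u, v) \<in> parcs (friendship_graph s)"
    then show ?R1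
      by (auto simp: friendship_graph_def symcl_iff)
  next
    assume ?R1
    then obtain i b where "i < s" "(u, v) = (Center, Tri i b) \<or> (u, v) = (Tri i b, Center) \<or> (u, v) = (Tri i b, Tri i (\<not> b))"
      by blast
    then show "(u, v) \<in> parcs (friendship_graph s)"
      by (cases b) (auto simp: friendship_graph_def symcl_iff)
  qed
  moreover have "(\<exists>j<length ls. (u, v) \<in> parcs (pendant_path j (ls ! j))) \<longleftrightarrow> ?R2"
    by (auto simp: pendant_path_def symcl_iff)
  ultimately show ?thesis by blast
qed

lemma pf_arcs_simps [simp]:
  "(Center, Center) \<notin> pf_arcs s ls"
  "(Center, Tri i b) \<in> pf_arcs s ls \<longleftrightarrow> i < s"
  "(Tri i b, Center) \<in> pf_arcs s ls \<longleftrightarrow> i < s"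
  "(Tri i b, Tri i' b') \<in> pf_arcs s ls \<longleftrightarrow> i = i' \<and> i < s \<and> b' = (\<not> b)"
  "(Center, Pth j m) \<in> pf_arcs s ls \<longleftrightarrow> j < length ls \<and> m = 1 \<and> 1 \<le> ls ! j"
  "(Pth j m, Center) \<in> pf_arcs s ls \<longleftrightarrow> j < length ls \<and> m = 1 \<and> 1 \<le> ls ! j"
  "(Pth j m, Pth j' m') \<in> pf_arcs s ls \<longleftrightarrow> j = j' \<and> j < length ls \<and> 1 \<le> m \<and> 1 \<le> m' \<and>
     (m' = Suc m \<and> m' \<le> ls ! j \<or> m = Suc m' \<and> m \<le> ls ! j)"
  "(Tri i b, Pth j m) \<notin> pf_arcs s ls"
  "(Pth j m, Tri i b) \<notin> pf_arcs s ls"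
  unfolding pf_arcs_iff by (auto simp: Suc_le_eq, blast+)

lemma simple_graph_pf: "simple_graph (pf_verts s ls) (pf_arcs s ls)"
  by (intro pair_graph_simple_graph pair_graph_path_friendship_graph)

lemma nbrs_Center:
  assumes "\<forall>l\<in>set ls. 1 \<le> l"
  shows "pf_arcs s ls `` {Center} = (\<lambda>(i, b). Tri i b) ` ({..<s} \<times> UNIV) \<union> (\<lambda>j. Pth j 1) ` {..<length ls}"
    (is "?L = ?R")
proof -
  have "v \<in> ?L \<longleftrightarrow> v \<in> ?R" for v
    using assms by (cases v) (auto simp: image_iff)
  then show ?thesis by blast
qed

lemma nbrs_Tri: "i < s \<Longrightarrow> pf_arcs s ls `` {Tri i b} = {Center, Tri i (\<not> b)}"
proof -
  assume "i < s"
  then have "v \<in> pf_arcs s ls `` {Tri i b} \<longleftrightarrow> v \<in> {Center, Tri i (\<not> b)}" for v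
    by (cases v) auto
  then show ?thesis by blast
qed

lemma nbrs_Pth:
  assumes "j < length ls" "1 \<le> m" "m \<le> ls ! j"
  shows "pf_arcs s ls `` {Pth j m} =
    (if m < ls ! j then {path_vertex j (m - 1), Pth j (Suc m)} else {path_vertex j (m - 1)})"
    (is "?L = ?R")
proof -
  have "v \<in> ?L \<longleftrightarrow> v \<in> ?R" for v
    using assms by (cases v) (auto simp: path_vertex_def)
  then show ?thesis by blast
qed

lemma deg_Center:
  assumes "\<forall>l\<in>set ls. 1 \<le> l"
  shows "deg (pf_arcs s ls) Center = 2 * s + length ls"
proof -
  have "card ((\<lambda>(i, b). Tri i b) ` ({..<s} \<times> (UNIV :: bool set))) = s * 2"
    by (subst card_image) (auto simp: inj_on_def card_cartesian_product)
  moreover have "card ((\<lambda>j. Pth j 1) ` {..<length ls}) = length ls"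
    by (subst card_image) (auto simp: inj_on_def)
  moreover have "(\<lambda>(i, b). Tri i b) ` ({..<s} \<times> (UNIV :: bool set)) \<inter> (\<lambda>j. Pth j 1) ` {..<length ls} = {}"
    by auto
  ultimately show ?thesis
    unfolding deg_def nbrs_Center[OF assms] by (simp add: card_Un_disjoint)
qed

lemma deg_Tri: "i < s \<Longrightarrow> deg (pf_arcs s ls) (Tri i b) = 2"
  by (simp add: deg_def nbrs_Tri)

lemma deg_Pth:
  assumes "j < length ls" "1 \<le> m" "m \<le> ls ! j"
  shows "deg (pf_arcs s ls) (Pth j m) = (if m < ls ! j then 2 else 1)"
  unfolding deg_def nbrs_Pth[OF assms] by (auto simp: path_vertex_def)

lemma deg_non_Center:
  assumes "v \<in> pf_verts s ls - {Center}"
  shows "deg (pf_arcs s ls) v \<in> {1, 2}"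
  using assms by (cases v) (auto simp: deg_Tri deg_Pth)

text \<open>This serves two purposes: it counts the leaves, and in the reconstruction it recognises
  a vertex of degree 1 as the end of a path, which can be lengthened.\<close>

lemma leaves_pf:
  assumes "\<forall>l\<in>set ls. 1 \<le> l"
  shows "{v \<in> pf_verts s ls - {Center}. deg (pf_arcs s ls) v = 1} = (\<lambda>j. Pth j (ls ! j)) ` {..<length ls}"
    (is "?L = ?R")
proof -
  have pos: "1 \<le> ls ! j" if "j < length ls" for j
    using assms nth_mem[OF that] by blast
  have "v \<in> ?L \<longleftrightarrow> v \<in> ?R" for v
  proof (cases v)
    case (Pth j m)
    show ?thesis
    proof (cases "j < length ls \<and> 1 \<le> m \<and> m \<le> ls ! j")
      case True
      then show ?thesis
        unfolding Pth by (auto simp: deg_Pth)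
    next
      case False
      then show ?thesis
        unfolding Pth using pos by auto
    qed
  qed (auto simp: deg_Tri)
  then show ?thesis by blast
qed

lemma card_leaves_pf:
  assumes "\<forall>l\<in>set ls. 1 \<le> l"
  shows "card {v \<in> pf_verts s ls - {Center}. deg (pf_arcs s ls) v = 1} = length ls"
  unfolding leaves_pf[OF assms] by (subst card_image) (auto simp: inj_on_def)

lemma spans_from_Center:
  assumes "\<forall>l\<in>set ls. 1 \<le> l"
  shows "spans_from Center (pf_verts s ls) (pf_arcs s ls)"
  unfolding spans_from_def
proof
  fix v assume v: "v \<in> pf_verts s ls"
  show "(Center, v) \<in> (pf_arcs s ls)\<^sup>*"
  proof (cases v)
    case (Pth j m)
    have j: "j < length ls" "1 \<le> m" "m \<le> ls ! j"
      using v Pth by auto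
    have "(Center, path_vertex j n) \<in> (pf_arcs s ls)\<^sup>*" if "n \<le> ls ! j" for n
      using that
    proof (induction n)
      case (Suc n)
      have "(path_vertex j n, path_vertex j (Suc n)) \<in> pf_arcs s ls"
        using Suc.prems j by (auto simp: path_vertex_def)
      then show ?case
        using Suc by (meson Suc_leD rtrancl.rtrancl_into_rtrancl)
    qed (simp add: path_vertex_def)
    from this[OF j(3)] show ?thesis
      using j Pth by (simp add: path_vertex_def)
  qed (use v in auto)
qed

lemma card_triangles_pf: "card (triangles (pf_arcs s ls)) = 6 * s"
proof -
  let ?I = "{..<s} \<times> (UNIV :: bool set)"
  let ?f1 = "\<lambda>(i, b). (Center, Tri i b, Tri i (\<not> b))"
  let ?f2 = "\<lambda>(i, b). (Tri i b, Center, Tri i (\<not> b))"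
  let ?f3 = "\<lambda>(i, b). (Tri i b, Tri i (\<not> b), Center)"
  have eq: "(u, v, w) \<in> triangles (pf_arcs s ls) \<longleftrightarrow> (u, v, w) \<in> ?f1 ` ?I \<union> ?f2 ` ?I \<union> ?f3 ` ?I" for u v w
    by (cases u; cases v; cases w) (auto simp: triangles_def image_iff)
  have "triangles (pf_arcs s ls) = ?f1 ` ?I \<union> ?f2 ` ?I \<union> ?f3 ` ?I"
  proof (rule Set.set_eqI)
    fix t :: "pf_vertex \<times> pf_vertex \<times> pf_vertex"
    obtain u v w where "t = (u, v, w)" by (cases t)
    then show "t \<in> triangles (pf_arcs s ls) \<longleftrightarrow> t \<in> ?f1 ` ?I \<union> ?f2 ` ?I \<union> ?f3 ` ?I"
      by (simp only: eq)
  qed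
  moreover have "card (?f1 ` ?I) = 2 * s" "card (?f2 ` ?I) = 2 * s" "card (?f3 ` ?I) = 2 * s"
    by (subst card_image; force simp: inj_on_def card_cartesian_product)+
  moreover have "?f1 ` ?I \<inter> ?f2 ` ?I = {}" "(?f1 ` ?I \<union> ?f2 ` ?I) \<inter> ?f3 ` ?I = {}"
    by auto
  ultimately show ?thesis
    by (simp add: card_Un_disjoint)
qed

lemma card_verts_friendship: "card (pf_verts s []) = 2 * s + 1"
proof -
  have "v \<in> pf_verts s [] \<longleftrightarrow> v \<in> insert Center ((\<lambda>(i, b). Tri i b) ` ({..<s} \<times> UNIV))" for v
    by (cases v) (auto simp: image_iff)
  then have "pf_verts s [] = insert Center ((\<lambda>(i, b). Tri i b) ` ({..<s} \<times> UNIV))"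
    by blast
  moreover have "card ((\<lambda>(i, b). Tri i b) ` ({..<s} \<times> (UNIV :: bool set))) = s * 2"
    by (subst card_image) (auto simp: inj_on_def card_cartesian_product)
  ultimately show ?thesis
    by (simp add: card_insert_if image_iff)
qed

lemma lap_char_friendship:
  assumes "s > 0"
  shows "lap_char (pf_verts s []) (pf_arcs s []) (2 * s + 1) = 0"
proof -
  interpret simple_graph "pf_verts s []" "pf_arcs s []"
    by (rule simple_graph_pf)
  \<comment> \<open>The center is adjacent to all other vertices; the vector constant off the center
    and orthogonal to the constants is then an eigenvector for the number of vertices.\<close>
  define x where "x v = (if v = Center then 2 * real s else - 1)" for v
  have "(\<Sum>j\<in>pf_verts s []. ((if i = j then real (2 * s + 1) else 0) - lap (pf_arcs s []) i j) * x j) = 0"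
    if i: "i \<in> pf_verts s []" for i
  proof -
    have "(\<Sum>j\<in>pf_verts s []. ((if i = j then real (2 * s + 1) else 0) - lap (pf_arcs s []) i j) * x j) =
        (\<Sum>j\<in>pf_verts s []. if j = i then real (2 * s + 1) * x j else 0) -
        (\<Sum>j\<in>pf_verts s []. lap (pf_arcs s []) i j * x j)"
      unfolding sum_subtractf[symmetric] by (intro sum.cong refl) (auto simp: left_diff_distrib)
    also have "\<dots> = real (2 * s + 1) * x i - (deg (pf_arcs s []) i * x i - sum x (pf_arcs s [] `` {i}))"
      using i finite_V by (simp add: lap_mult)
    also have "\<dots> = 0"
    proof (cases i)
      case Center
      have "sum x (pf_arcs s [] `` {Center}) = (\<Sum>v\<in>pf_arcs s [] `` {Center}. - 1)"
        by (intro sum.cong) (auto simp: x_def)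
      also have "\<dots> = - real (2 * s)"
        using deg_Center[of "[]" s] by (simp add: deg_def)
      finally show ?thesis
        using Center deg_Center[of "[]" s] by (simp add: x_def algebra_simps)
    next
      case (Tri k b)
      then have "k < s" using i by simp
      then show ?thesis
        using Tri by (simp add: nbrs_Tri deg_Tri x_def)
    next
      case (Pth j m)
      then show ?thesis using i by simp
    qed
    finally show ?thesis .
  qed
  moreover have "Center \<in> pf_verts s []" "x Center \<noteq> 0"
    using assms by (auto simp: x_def)
  ultimately show ?thesis
    unfolding lap_char_def set_det_eq_0_iff[OF finite_V] by blast
qed

text \<open>The spanning tree omits the edge opposite to the center in the triangle. The root paths
  of its endpoints are single edges, so the formula gives \<open>1 + 1 + 1\<close>.\<close>

lemma reduced_lap_det_unicyclic_pf:
  assumes "\<forall>l\<in>set ls. 1 \<le> l"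
  shows "set_det (pf_verts 1 ls - {Center}) (lap (pf_arcs 1 ls)) = 3"
proof -
  let ?V = "pf_verts 1 ls" and ?E = "pf_arcs 1 ls"
  interpret simple_graph ?V ?E
    by (rule simple_graph_pf)
  define \<delta> where "\<delta> v = (case v of Center \<Rightarrow> 0 | Tri i b \<Rightarrow> 1 | Pth j m \<Rightarrow> m)" for v
  define \<pi> where "\<pi> v = (case v of Center \<Rightarrow> Center | Tri i b \<Rightarrow> Center | Pth j m \<Rightarrow> path_vertex j (m - 1))" for v
  let ?a = "Tri 0 False" and ?b = "Tri 0 True"
  interpret T: rooted_tree ?V Center \<delta> \<pi>
  proof
    show "finite ?V" by (rule finite_V)
    fix w assume "w \<in> ?V" "w \<noteq> Center"
    then show "\<pi> w \<in> ?V \<and> \<delta> w = Suc (\<delta> (\<pi> w))"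
      by (cases w) (auto simp: \<pi>_def \<delta>_def path_vertex_def split: if_splits)
  qed (auto simp: \<delta>_def)
  have eq: "(u, v) \<in> ?E \<longleftrightarrow> (u, v) \<in> (\<lambda>w. (w, \<pi> w)) ` T.S \<union> (\<lambda>w. (\<pi> w, w)) ` T.S \<union> {(?a, ?b), (?b, ?a)}" for u v
  proof -
    have 1: "(u, v) \<in> (\<lambda>w. (w, \<pi> w)) ` T.S \<longleftrightarrow> u \<in> ?V \<and> u \<noteq> Center \<and> v = \<pi> u"
      and 2: "(u, v) \<in> (\<lambda>w. (\<pi> w, w)) ` T.S \<longleftrightarrow> v \<in> ?V \<and> v \<noteq> Center \<and> u = \<pi> v"
      by auto
    show ?thesis
      unfolding Un_iff 1 2
      by (cases u; cases v) (use assms in \<open>auto simp: \<pi>_def path_vertex_def split: if_splits\<close>)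
  qed
  have E: "?E = (\<lambda>w. (w, \<pi> w)) ` T.S \<union> (\<lambda>w. (\<pi> w, w)) ` T.S \<union> {(?a, ?b), (?b, ?a)}"
  proof (rule Set.set_eqI)
    fix e :: "pf_vertex \<times> pf_vertex"
    obtain u v where "e = (u, v)" by (cases e)
    then show "e \<in> ?E \<longleftrightarrow> e \<in> (\<lambda>w. (w, \<pi> w)) ` T.S \<union> (\<lambda>w. (\<pi> w, w)) ` T.S \<union> {(?a, ?b), (?b, ?a)}"
      by (simp only: eq)
  qed
  have "set_det T.S (lap ?E) = 1 + (\<Sum>w\<in>T.S. (T.h ?a w - T.h ?b w)\<^sup>2)"
    by (rule T.unicyclic_reduced_lap_det[OF simple_graph_axioms _ _ _ _ E]) (auto simp: \<pi>_def)
  also have "(\<Sum>w\<in>T.S. (T.h ?a w - T.h ?b w)\<^sup>2) = (\<Sum>w\<in>T.S. if w \<in> {?a, ?b} then 1 else 0)"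
  proof (rule sum.cong[OF refl])
    fix w
    have "T.h ?a w = of_bool (w = ?a)" "T.h ?b w = of_bool (w = ?b)"
      using T.h_step[of ?a w] T.h_step[of ?b w] T.h_root[of w] by (auto simp: \<pi>_def)
    then show "(T.h ?a w - T.h ?b w)\<^sup>2 = (if w \<in> {?a, ?b} then 1 else 0)"
      by auto
  qed
  also have "\<dots> = real (card (T.S \<inter> {?a, ?b}))"
    by (subst sum.inter_restrict[symmetric]) (use finite_V in simp_all)
  also have "T.S \<inter> {?a, ?b} = {?a, ?b}"
    by auto
  finally show ?thesis by simp
qed

section \<open>Recognising path-friendship graphs\<close>

text \<open>Orbits of a fixed-point-free involution have two elements; removing one orbit at a time
  numbers them. The index and the Boolean are the labels used by the constructor
  \<open>Tri\<close>.\<close>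

lemma finite_involution_pairing:
  assumes "finite P" "\<And>x. x \<in> P \<Longrightarrow> \<tau> x \<in> P \<and> \<tau> x \<noteq> x \<and> \<tau> (\<tau> x) = x"
  shows "\<exists>(s :: nat) f. bij_betw f ({..<s} \<times> (UNIV :: bool set)) P \<and>
    (\<forall>i<s. f (i, True) = \<tau> (f (i, False)))"
  using assms
proof (induction "card P" arbitrary: P rule: less_induct)
  case less
  show ?case
  proof (cases "P = {}")
    case True
    then show ?thesis
      by (intro exI[of _ 0] exI[of _ undefined]) (auto simp: bij_betw_def)
  next
    case False
    then obtain x where x: "x \<in> P" by blast
    define Q where "Q = P - {x, \<tau> x}"
    have \<tau>x: "\<tau> x \<in> P" "\<tau> x \<noteq> x" "\<tau> (\<tau> x) = x"
      using less.prems(2)[OF x] by auto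
    have "Q \<subset> P" using x by (auto simp: Q_def)
    then have "card Q < card P"
      using less.prems(1) by (rule psubset_card_mono[rotated])
    moreover have "finite Q" using less.prems(1) by (simp add: Q_def)
    moreover have "\<tau> y \<in> Q \<and> \<tau> y \<noteq> y \<and> \<tau> (\<tau> y) = y" if y: "y \<in> Q" for y
    proof -
      have "y \<in> P" "y \<noteq> x" "y \<noteq> \<tau> x"
        using y by (auto simp: Q_def)
      note p = less.prems(2)[OF \<open>y \<in> P\<close>]
      have "\<tau> y \<noteq> x" using p \<open>y \<noteq> \<tau> x\<close> by metis
      moreover have "\<tau> y \<noteq> \<tau> x" using p \<tau>x(3) \<open>y \<noteq> x\<close> by metis
      ultimately show ?thesis using p by (auto simp: Q_def)
    qed
    ultimately obtain s f where f: "bij_betw f ({..<s :: nat} \<times> (UNIV :: bool set)) Q"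
      "\<forall>i<s. f (i, True) = \<tau> (f (i, False))"
      using less.hyps[of Q] by blast
    define g where "g = (\<lambda>(i, b). if i = s then (if b then \<tau> x else x) else f (i, b))"
    have "bij_betw g ({..<s} \<times> UNIV) Q"
      using f(1) by (subst bij_betw_cong[of _ g f]) (auto simp: g_def)
    moreover have "bij_betw g ({s} \<times> UNIV) {x, \<tau> x}"
      using \<tau>x(2) by (auto simp: bij_betw_def inj_on_def g_def UNIV_bool)
    moreover have "Q \<inter> {x, \<tau> x} = {}" by (auto simp: Q_def)
    ultimately have "bij_betw g ({..<s} \<times> UNIV \<union> {s} \<times> UNIV) (Q \<union> {x, \<tau> x})"
      by (rule bij_betw_combine)
    moreover have "{..<s} \<times> UNIV \<union> {s} \<times> UNIV = {..<Suc s} \<times> (UNIV :: bool set)"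
      by (auto simp: less_Suc_eq)
    moreover have "Q \<union> {x, \<tau> x} = P" using x \<tau>x by (auto simp: Q_def)
    moreover have "\<forall>i<Suc s. g (i, True) = \<tau> (g (i, False))"
      using f(2) by (auto simp: g_def less_Suc_eq)
    ultimately show ?thesis by metis
  qed
qed

context simple_graph
begin

text \<open>The second conclusion is meant for refutations: small closed sets that avoid
  \<open>c\<close>.\<close>

lemma closed_under_arcs_eq_V:
  assumes conn: "spans_from c V E" and W: "W \<subseteq> V" "w \<in> W" "\<And>u v. u \<in> W \<Longrightarrow> (u, v) \<in> E \<Longrightarrow> v \<in> W"
  shows "W = V" and "c \<in> W"
proof -
  have "(c, w) \<in> E\<^sup>*"
    using conn W by (auto simp: spans_from_def)
  then show c: "c \<in> W"
  proof (induction rule: converse_rtrancl_induct)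
    case (step y z)
    then show ?case using W(3) E_sym by blast
  qed (use W in auto)
  have "v \<in> W" if "v \<in> V" for v
  proof -
    have "(c, v) \<in> E\<^sup>*"
      using conn that by (auto simp: spans_from_def)
    then show ?thesis
      by (induction rule: rtrancl_induct) (use c W(3) in auto)
  qed
  then show "W = V" using W(1) by auto
qed

text \<open>A triangle avoiding \<open>c\<close> would use up the degrees of its vertices and be a
  component of its own. So every triangle contains \<open>c\<close>, and a neighbour of
  \<open>c\<close> lies in at most one; sending it to the third vertex is an involution
  \<open>\<tau>\<close> on \<open>P\<close>. Each element of \<open>P\<close> accounts for three
  ordered triangles, one for each position of \<open>c\<close>, whence
  \<open>card P = 2 * s\<close>.\<close>

lemma triangle_pairs:
  assumes c: "c \<in> V" and conn: "spans_from c V E"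
    and deg2: "\<And>v. v \<in> V - {c} \<Longrightarrow> deg E v \<le> 2" and tri: "card (triangles E) = 6 * s"
  shows "\<exists>f. inj_on f ({..<s} \<times> (UNIV :: bool set)) \<and>
    (\<forall>i<s. (\<forall>b. (c, f (i, b)) \<in> E) \<and> (f (i, False), f (i, True)) \<in> E)"
proof -
  define P where "P = {x. (c, x) \<in> E \<and> (\<exists>y. (c, y) \<in> E \<and> (x, y) \<in> E)}"
  have nbrs: "E `` {x} = {c, y}" if "(c, y) \<in> E" "(x, y) \<in> E" "(x, c) \<in> E" for x y
  proof -
    have "x \<in> V - {c}" "y \<noteq> c"
      using that E_sub E_irrefl by auto
    then have "card (E `` {x}) \<le> card {c, y}"
      using deg2[of x] by (simp add: deg_def)
    then have "{c, y} = E `` {x}"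
      using that finite_nbrs by (intro card_seteq) auto
    then show ?thesis ..
  qed
  have "P \<subseteq> E `` {c}"
    by (auto simp: P_def)
  then have finP: "finite P"
    using finite_nbrs by (rule finite_subset)
  define \<tau> where "\<tau> x = (THE y. (c, y) \<in> E \<and> (x, y) \<in> E)" for x
  have \<tau>_eq: "\<tau> x = y" if "(c, x) \<in> E" "(c, y) \<in> E" "(x, y) \<in> E" for x y
    unfolding \<tau>_def
  proof (rule the_equality)
    fix z assume z: "(c, z) \<in> E \<and> (x, z) \<in> E"
    have "z \<in> {c, y}"
      using nbrs[OF that(2,3)] E_sym[OF that(1)] z by auto
    then show "z = y"
      using z E_irrefl by auto
  qed (use that in auto)
  have \<tau>: "(c, x) \<in> E \<and> (c, \<tau> x) \<in> E \<and> (x, \<tau> x) \<in> E" if "x \<in> P" for x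
    using that \<tau>_eq by (auto simp: P_def)
  have invol: "\<tau> x \<in> P \<and> \<tau> x \<noteq> x \<and> \<tau> (\<tau> x) = x" if "x \<in> P" for x
  proof -
    note t = \<tau>[OF that]
    have "(\<tau> x, x) \<in> E" using t E_sym by blast
    then show ?thesis
      using t \<tau>_eq[of "\<tau> x" x] E_irrefl by (auto simp: P_def)
  qed
  let ?f1 = "\<lambda>x. (c, x, \<tau> x)"
  let ?f2 = "\<lambda>x. (x, c, \<tau> x)"
  let ?f3 = "\<lambda>x. (x, \<tau> x, c)"
  have cP: "c \<notin> P" using E_irrefl by (auto simp: P_def)
  have "triangles E \<subseteq> ?f1 ` P \<union> ?f2 ` P \<union> ?f3 ` P"
  proof
    fix t assume "t \<in> triangles E"
    then obtain u v w where t: "t = (u, v, w)" and e: "(u, v) \<in> E" "(v, w) \<in> E" "(w, u) \<in> E"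
      by (auto simp: triangles_def)
    note e' = e[THEN E_sym]
    have "c \<in> {u, v, w}"
    proof (rule ccontr)
      assume nc: "c \<notin> {u, v, w}"
      have only: "E `` {p} = {q, r}" if "(p, q) \<in> E" "(p, r) \<in> E" "q \<noteq> r" "p \<noteq> c" for p q r
      proof -
        have "p \<in> V - {c}"
          using that E_sub by auto
        then have "card (E `` {p}) \<le> card {q, r}"
          using deg2[of p] that(3) by (simp add: deg_def)
        then have "{q, r} = E `` {p}"
          using that finite_nbrs by (intro card_seteq) auto
        then show ?thesis ..
      qed
      have ne: "u \<noteq> v" "v \<noteq> w" "w \<noteq> u"
        using e E_irrefl by auto
      have "E `` {u} = {v, w}" "E `` {v} = {u, w}" "E `` {w} = {u, v}"
        using only e e' ne nc by auto
      then have "\<And>p q. p \<in> {u, v, w} \<Longrightarrow> (p, q) \<in> E \<Longrightarrow> q \<in> {u, v, w}"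
        by auto
      moreover have "{u, v, w} \<subseteq> V"
        using e E_sub by auto
      ultimately have "c \<in> {u, v, w}"
        by (intro closed_under_arcs_eq_V(2)[OF conn, of "{u, v, w}" u]) auto
      then show False using nc by simp
    qed
    then consider "u = c" | "v = c" | "w = c" by auto
    then show "t \<in> ?f1 ` P \<union> ?f2 ` P \<union> ?f3 ` P"
    proof cases
      case 1
      then have "v \<in> P" "\<tau> v = w"
        using e e' \<tau>_eq[of v w] by (auto simp: P_def)
      then show ?thesis using t 1 by auto
    next
      case 2
      then have "u \<in> P" "\<tau> u = w"
        using e e' \<tau>_eq[of u w] by (auto simp: P_def)
      then show ?thesis using t 2 by auto
    next
      case 3
      then have "u \<in> P" "\<tau> u = v"
        using e e' \<tau>_eq[of u v] by (auto simp: P_def)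
      then show ?thesis using t 3 by auto
    qed
  qed
  moreover have "?f1 ` P \<union> ?f2 ` P \<union> ?f3 ` P \<subseteq> triangles E"
    using \<tau> E_sym by (auto simp: triangles_def)
  ultimately have "triangles E = ?f1 ` P \<union> ?f2 ` P \<union> ?f3 ` P" by blast
  moreover have "card (?f1 ` P) = card P" "card (?f2 ` P) = card P" "card (?f3 ` P) = card P"
    by (auto intro!: card_image simp: inj_on_def)
  moreover have "?f1 ` P \<inter> ?f2 ` P = {}" "(?f1 ` P \<union> ?f2 ` P) \<inter> ?f3 ` P = {}"
    using cP invol by auto
  ultimately have cardP: "card P = 2 * s"
    using tri finP by (simp add: card_Un_disjoint)
  obtain s' f where f: "bij_betw f ({..<s' :: nat} \<times> (UNIV :: bool set)) P"
    "\<forall>i<s'. f (i, True) = \<tau> (f (i, False))"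
    using finite_involution_pairing[OF finP invol] by blast
  have "card P = s' * 2"
    using bij_betw_same_card[OF f(1)] by (simp add: card_cartesian_product)
  then have "s' = s" using cardP by simp
  moreover have "f (i, b) \<in> P" if "i < s'" for i b
    using f(1) that by (auto simp: bij_betw_def)
  ultimately show ?thesis
    using f \<tau> by (intro exI[of _ f]) (auto simp: bij_betw_def)
qed

end

text \<open>The image of the center is part of the notion because a leaf attached at
  \<open>c\<close> starts a new path, whereas one attached elsewhere lengthens an old path.\<close>

definition pf_iso :: "nat \<Rightarrow> nat list \<Rightarrow> (pf_vertex \<Rightarrow> 'a) \<Rightarrow> 'a \<Rightarrow> 'a set \<Rightarrow> ('a \<times> 'a) set \<Rightarrow> bool" where
  "pf_iso s ls \<phi> c V E \<longleftrightarrow> \<phi> Center = c \<and> bij_betw \<phi> (pf_verts s ls) V \<and>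
    (\<forall>u\<in>pf_verts s ls. \<forall>v\<in>pf_verts s ls. (u, v) \<in> pf_arcs s ls \<longleftrightarrow> (\<phi> u, \<phi> v) \<in> E)"

lemma pf_iso_deg:
  assumes "pf_iso s ls \<phi> c V E" "E \<subseteq> V \<times> V" "u \<in> pf_verts s ls"
  shows "deg E (\<phi> u) = deg (pf_arcs s ls) u"
proof -
  interpret P: simple_graph "pf_verts s ls" "pf_arcs s ls"
    by (rule simple_graph_pf)
  have bij: "bij_betw \<phi> (pf_verts s ls) V"
    and iff: "\<And>v. v \<in> pf_verts s ls \<Longrightarrow> (u, v) \<in> pf_arcs s ls \<longleftrightarrow> (\<phi> u, \<phi> v) \<in> E"
    using assms by (auto simp: pf_iso_def)
  have "E `` {\<phi> u} = \<phi> ` (pf_arcs s ls `` {u})"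
  proof
    show "E `` {\<phi> u} \<subseteq> \<phi> ` (pf_arcs s ls `` {u})"
    proof
      fix y assume y: "y \<in> E `` {\<phi> u}"
      then have "y \<in> V" using assms(2) by auto
      then obtain v where "v \<in> pf_verts s ls" "y = \<phi> v"
        using bij by (auto simp: bij_betw_def)
      then show "y \<in> \<phi> ` (pf_arcs s ls `` {u})"
        using iff y by auto
    qed
    show "\<phi> ` (pf_arcs s ls `` {u}) \<subseteq> E `` {\<phi> u}"
      using iff P.nbrs_sub[of u] by auto
  qed
  moreover have "inj_on \<phi> (pf_arcs s ls `` {u})"
    using bij P.nbrs_sub[of u] by (auto simp: bij_betw_def intro: inj_on_subset)
  ultimately show ?thesis
    by (simp add: deg_def card_image)
qed

text \<open>A leaf is added on both sides at corresponding vertices. Starting a path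
  (\<open>pf_append\<close>) and lengthening one (\<open>pf_lengthen\<close>) are both
  instances.\<close>

lemma pf_iso_extend:
  assumes iso: "pf_iso s ls \<phi> c V' E'" and E': "E' \<subseteq> V' \<times> V'" "l \<notin> V'" "p \<in> V'"
    and z: "z \<notin> pf_verts s ls" "z \<noteq> Center" "q \<in> pf_verts s ls" "\<phi> q = p"
    and verts: "pf_verts s ls' = insert z (pf_verts s ls)"
    and arcs: "pf_arcs s ls' = pf_arcs s ls \<union> {(z, q), (q, z)}"
  shows "pf_iso s ls' (\<phi>(z := l)) c (insert l V') (E' \<union> {(l, p), (p, l)})"
proof -
  interpret P: simple_graph "pf_verts s ls" "pf_arcs s ls"
    by (rule simple_graph_pf)
  let ?\<phi> = "\<phi>(z := l)"
  have bij: "bij_betw \<phi> (pf_verts s ls) V'" and c: "\<phi> Center = c"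
    and iff: "\<And>u v. u \<in> pf_verts s ls \<Longrightarrow> v \<in> pf_verts s ls \<Longrightarrow> (u, v) \<in> pf_arcs s ls \<longleftrightarrow> (\<phi> u, \<phi> v) \<in> E'"
    using iso by (auto simp: pf_iso_def)
  have img: "\<phi> u \<in> V'" if "u \<in> pf_verts s ls" for u
    using bij that by (auto simp: bij_betw_def)
  have inj: "\<phi> u = p \<longleftrightarrow> u = q" if "u \<in> pf_verts s ls" for u
    using bij that z(3,4) by (auto simp: bij_betw_def inj_on_def)
  have zq: "z \<noteq> q" using z by auto
  have old: "?\<phi> u = \<phi> u" "?\<phi> u \<noteq> l" "u \<noteq> z" if "u \<in> pf_verts s ls" for u
    using that z(1) img[OF that] E'(2) by auto
  have "bij_betw ?\<phi> (pf_verts s ls) V'"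
    using bij old(1) by (subst bij_betw_cong[of _ _ \<phi>]) auto
  moreover have "bij_betw ?\<phi> {z} {l}" by simp
  ultimately have "bij_betw ?\<phi> (pf_verts s ls \<union> {z}) (V' \<union> {l})"
    by (rule bij_betw_combine) (use E'(2) in auto)
  then have "bij_betw ?\<phi> (pf_verts s ls') (insert l V')"
    by (simp add: verts)
  moreover have "(u, v) \<in> pf_arcs s ls' \<longleftrightarrow> (?\<phi> u, ?\<phi> v) \<in> E' \<union> {(l, p), (p, l)}"
    if uv: "u \<in> pf_verts s ls'" "v \<in> pf_verts s ls'" for u v
  proof -
    have zarc: "(z, w) \<notin> pf_arcs s ls" "(w, z) \<notin> pf_arcs s ls" for w
      using z(1) P.E_sub by auto
    have larc: "(l, w) \<notin> E'" "(w, l) \<notin> E'" for w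
      using E' by auto
    have lp: "l \<noteq> p" using E' by auto
    consider "u = z" "v = z" | "u = z" "v \<in> pf_verts s ls" | "v = z" "u \<in> pf_verts s ls"
      | "u \<in> pf_verts s ls" "v \<in> pf_verts s ls"
      using uv unfolding verts by auto
    then show ?thesis
    proof cases
      case 1
      then show ?thesis using zarc larc lp zq by (simp add: arcs)
    next
      case 2
      then show ?thesis using zarc larc lp zq old[of v] inj[of v] by (simp add: arcs)
    next
      case 3
      then show ?thesis using zarc larc lp zq old[of u] inj[of u] by (simp add: arcs)
    next
      case 4
      then show ?thesis using iff old[of u] old[of v] by (simp add: arcs)
    qed
  qed
  ultimately show ?thesis
    using c z(2) by (auto simp: pf_iso_def)
qed

lemma pf_append:
  "pf_verts s (ls @ [1]) = insert (Pth (length ls) 1) (pf_verts s ls)"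
  "pf_arcs s (ls @ [1]) = pf_arcs s ls \<union> {(Pth (length ls) 1, Center), (Center, Pth (length ls) 1)}"
proof -
  have "v \<in> pf_verts s (ls @ [1]) \<longleftrightarrow> v \<in> insert (Pth (length ls) 1) (pf_verts s ls)" for v
    by (cases v) (auto simp: nth_append less_Suc_eq)
  then show "pf_verts s (ls @ [1]) = insert (Pth (length ls) 1) (pf_verts s ls)" by blast
  have "(u, v) \<in> pf_arcs s (ls @ [1]) \<longleftrightarrow>
      (u, v) \<in> pf_arcs s ls \<union> {(Pth (length ls) 1, Center), (Center, Pth (length ls) 1)}" for u v
    by (cases u; cases v) (auto simp: nth_append less_Suc_eq)
  then show "pf_arcs s (ls @ [1]) = pf_arcs s ls \<union> {(Pth (length ls) 1, Center), (Center, Pth (length ls) 1)}"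
    by (intro subset_antisym subrelI) blast+
qed

lemma pf_lengthen:
  assumes "j < length ls" "1 \<le> ls ! j"
  defines "m \<equiv> ls ! j"
  shows "pf_verts s (ls[j := Suc m]) = insert (Pth j (Suc m)) (pf_verts s ls)"
    and "pf_arcs s (ls[j := Suc m]) = pf_arcs s ls \<union> {(Pth j (Suc m), Pth j m), (Pth j m, Pth j (Suc m))}"
proof -
  have "v \<in> pf_verts s (ls[j := Suc m]) \<longleftrightarrow> v \<in> insert (Pth j (Suc m)) (pf_verts s ls)" for v
    using assms by (cases v) (auto simp: nth_list_update)
  then show "pf_verts s (ls[j := Suc m]) = insert (Pth j (Suc m)) (pf_verts s ls)" by blast
  have "(u, v) \<in> pf_arcs s (ls[j := Suc m]) \<longleftrightarrow>
      (u, v) \<in> pf_arcs s ls \<union> {(Pth j (Suc m), Pth j m), (Pth j m, Pth j (Suc m))}" for u v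
    using assms by (cases u; cases v) (auto simp: nth_list_update)
  then show "pf_arcs s (ls[j := Suc m]) = pf_arcs s ls \<union> {(Pth j (Suc m), Pth j m), (Pth j m, Pth j (Suc m))}"
    by (intro subset_antisym subrelI) blast+
qed

text \<open>The labelled triangle vertices exhaust the \<open>2 * s\<close> neighbours of
  \<open>c\<close>, and each of them already has its two neighbours inside its triangle, so nothing
  else is reachable.\<close>

lemma pf_iso_friendship:
  assumes G: "simple_graph V E" and c: "c \<in> V" and conn: "spans_from c V E"
    and deg2: "\<And>v. v \<in> V - {c} \<Longrightarrow> deg E v \<le> 2"
    and f: "inj_on f ({..<s} \<times> (UNIV :: bool set))"
      "\<And>i b. i < s \<Longrightarrow> (c, f (i, b)) \<in> E" "\<And>i. i < s \<Longrightarrow> (f (i, False), f (i, True)) \<in> E"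
    and degc: "deg E c = 2 * s"
  shows "pf_iso s [] (\<lambda>v. case v of Center \<Rightarrow> c | Tri i b \<Rightarrow> f (i, b) | Pth j m \<Rightarrow> c) c V E"
proof -
  interpret simple_graph V E by fact
  let ?I = "{..<s} \<times> (UNIV :: bool set)"
  have sub: "f ` ?I \<subseteq> E `` {c}"
    using f(2) by auto
  have "card (f ` ?I) = card (E `` {c})"
    using card_image[OF f(1)] degc by (simp add: deg_def card_cartesian_product)
  then have Nc: "E `` {c} = f ` ?I"
    using card_subset_eq[OF finite_nbrs sub] by simp
  have fc: "f (i, b) \<noteq> c" if "i < s" for i b
    using f(2)[OF that, of b] E_irrefl by auto
  have pair: "(f (i, b), f (i, \<not> b)) \<in> E" if "i < s" for i b
    using f(3)[OF that] E_sym by (cases b) auto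
  have Nf: "E `` {f (i, b)} = {c, f (i, \<not> b)}" if "i < s" for i b
  proof -
    have "f (i, b) \<in> V - {c}"
      using f(2)[OF that, of b] E_sub fc[OF that] by auto
    then have "card (E `` {f (i, b)}) \<le> card {c, f (i, \<not> b)}"
      using deg2[of "f (i, b)"] fc[OF that, of "\<not> b"] by (simp add: deg_def)
    moreover have "{c, f (i, \<not> b)} \<subseteq> E `` {f (i, b)}"
      using pair[OF that] E_sym[OF f(2)[OF that]] by auto
    ultimately show ?thesis
      using card_seteq[OF finite_nbrs] by metis
  qed
  let ?W = "insert c (f ` ?I)"
  have "?W = V"
  proof (rule closed_under_arcs_eq_V(1)[OF conn])
    show "?W \<subseteq> V" using c Nc nbrs_sub[of c] by auto
    show "v \<in> ?W" if uv: "u \<in> ?W" "(u, v) \<in> E" for u v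
    proof (cases "u = c")
      case True
      then show ?thesis using uv(2) Nc by auto
    next
      case False
      then obtain i b where "i < s" "u = f (i, b)"
        using uv(1) by auto
      then have "v \<in> {c, f (i, \<not> b)}"
        using Nf uv(2) by auto
      then show ?thesis using \<open>i < s\<close> by auto
    qed
  qed auto
  let ?\<phi> = "\<lambda>v. case v of Center \<Rightarrow> c | Tri i b \<Rightarrow> f (i, b) | Pth j m \<Rightarrow> c"
  have finj: "f (i, b) = f (i', b') \<longleftrightarrow> i = i' \<and> b = b'" if "i < s" "i' < s" for i i' b b'
    using f(1) that by (auto simp: inj_on_def)
  have "inj_on ?\<phi> (pf_verts s [])"
  proof (rule inj_onI)
    fix u v assume "u \<in> pf_verts s []" "v \<in> pf_verts s []" "?\<phi> u = ?\<phi> v"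
    then show "u = v"
      using fc fc[THEN not_sym] by (cases u; cases v) (auto simp: finj)
  qed
  moreover have "?\<phi> ` pf_verts s [] = V"
  proof -
    have "y \<in> ?\<phi> ` pf_verts s [] \<longleftrightarrow> y \<in> ?W" for y
    proof
      assume "y \<in> ?\<phi> ` pf_verts s []"
      then obtain v where "v \<in> pf_verts s []" "y = ?\<phi> v" by blast
      then show "y \<in> ?W" by (cases v) auto
    next
      assume "y \<in> ?W"
      then consider "y = ?\<phi> Center" | i b where "i < s" "y = ?\<phi> (Tri i b)" by auto
      then show "y \<in> ?\<phi> ` pf_verts s []"
        by cases (rule image_eqI, assumption, simp)+
    qed
    then show ?thesis using \<open>?W = V\<close> by blast
  qed
  moreover have "(u, v) \<in> pf_arcs s [] \<longleftrightarrow> (?\<phi> u, ?\<phi> v) \<in> E" if "u \<in> pf_verts s []" "v \<in> pf_verts s []" for u v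
  proof -
    have "(c, f (i, b)) \<in> E" "(f (i, b), c) \<in> E" if "i < s" for i b
      using f(2)[OF that] E_sym by auto
    moreover have "(f (i, b), f (i', b')) \<in> E \<longleftrightarrow> i' = i \<and> b' = (\<not> b)" if "i < s" "i' < s" for i i' b b'
    proof -
      have "(f (i, b), f (i', b')) \<in> E \<longleftrightarrow> f (i', b') \<in> {c, f (i, \<not> b)}"
        using Nf[OF that(1), of b] by blast
      then show ?thesis
        using fc[OF that(2)] finj[OF that(2,1)] by auto
    qed
    ultimately show ?thesis
      using that E_irrefl by (cases u; cases v) auto
  qed
  ultimately show ?thesis
    by (simp add: pf_iso_def bij_betw_def)
qed

text \<open>Induction by deleting a leaf \<open>l\<close> with neighbour \<open>p\<close>. If
  \<open>p = c\<close>, a path of length 1 disappears and \<open>k\<close> drops by 1; otherwise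
  \<open>p\<close> has degree 2 and becomes a leaf in place of \<open>l\<close>. The labelling
  \<open>f\<close> survives because a leaf lies in no triangle.\<close>

lemma path_friendship_structure:
  assumes "simple_graph V E" "c \<in> V" "spans_from c V E"
    and "\<And>v. v \<in> V - {c} \<Longrightarrow> deg E v \<in> {1, 2}"
    and "inj_on f ({..<s} \<times> (UNIV :: bool set))"
      "\<And>i b. i < s \<Longrightarrow> (c, f (i, b)) \<in> E" "\<And>i. i < s \<Longrightarrow> (f (i, False), f (i, True)) \<in> E"
    and "deg E c = 2 * s + k" "card {v \<in> V - {c}. deg E v = 1} = k"
  shows "\<exists>ls \<phi>. length ls = k \<and> (\<forall>l\<in>set ls. 1 \<le> l) \<and> pf_iso s ls \<phi> c V E"
  \<comment> \<open>The injectivity of \<open>f\<close> does not involve the graph and stays outside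
    the induction.\<close>
  using assms(1-4,6-9)
proof (induction "card V" arbitrary: V E k rule: less_induct)
  case less
  note c = less.prems(2) and conn = less.prems(3) and degs = less.prems(4)
    and fc = less.prems(5) and ff = less.prems(6) and degc = less.prems(7) and leaves = less.prems(8)
  interpret simple_graph V E by (rule less.prems(1))
  show ?case
  proof (cases "k = 0")
    case True
    have le2: "deg E v \<le> 2" if "v \<in> V - {c}" for v
      using degs[OF that] by auto
    have "deg E c = 2 * s"
      using degc True by simp
    then have "pf_iso s [] (\<lambda>v. case v of Center \<Rightarrow> c | Tri i b \<Rightarrow> f (i, b) | Pth j m \<Rightarrow> c) c V E"
      using fc ff by (intro pf_iso_friendship[OF less.prems(1) c conn le2 assms(5)])
    then show ?thesis
      using True by (intro exI[of _ "[]"]) auto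
  next
    case False
    then have "{v \<in> V - {c}. deg E v = 1} \<noteq> {}"
      using leaves card.empty by metis
    then obtain l where l: "l \<in> V" "l \<noteq> c" "deg E l = 1" by blast
    then obtain p where p: "E `` {l} = {p}"
      unfolding deg_def using card_1_singletonE by blast
    have lp: "(l, p) \<in> E" "(p, l) \<in> E" "p \<in> V" "p \<noteq> l"
      using p E_sym[of l p] E_sub E_irrefl[of l] by auto
    have only: "x = p" if "(l, x) \<in> E \<or> (x, l) \<in> E" for x
      using that p E_sym[of x l] by auto
    define V' where "V' = V - {l}"
    define E' where "E' = E - {(l, p), (p, l)}"
    have E'V': "E' \<subseteq> V' \<times> V'"
      using E_sub only by (auto simp: E'_def V'_def)
    have G': "simple_graph V' E'"
      using finite_V E'V' E_sym E_irrefl by unfold_locales (auto simp: V'_def E'_def)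
    have V: "V = insert l V'" and E: "E = E' \<union> {(l, p), (p, l)}"
      using l lp by (auto simp: V'_def E'_def)
    have card': "card V' < card V"
      unfolding V'_def using finite_V l(1) by (rule card_Diff1_less)
    have cV': "c \<in> V'" and pV': "p \<in> V'" and lV': "l \<notin> V'"
      using c l lp by (auto simp: V'_def)
    have deg_other: "deg E' v = deg E v" if "v \<noteq> l" "v \<noteq> p" for v
    proof -
      have "E' `` {v} = E `` {v}" using that by (auto simp: E'_def)
      then show ?thesis by (simp add: deg_def)
    qed
    have "E' `` {p} = E `` {p} - {l}"
      using lp(4) by (auto simp: E'_def)
    then have deg_p: "deg E' p = deg E p - 1"
      using lp(2) finite_nbrs by (simp add: deg_def)
    have conn': "spans_from c V' E'"
    proof -
      have "(v \<noteq> l \<longrightarrow> (c, v) \<in> E'\<^sup>*) \<and> (v = l \<longrightarrow> (c, p) \<in> E'\<^sup>*)" if "(c, v) \<in> E\<^sup>*" for v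
        using that
      proof (induction rule: rtrancl_induct)
        case base
        then show ?case using l by auto
      next
        case (step y z)
        show ?case
        proof (cases "y = l \<or> z = l")
          case True
          then show ?thesis
            using step only[of y] only[of z] lp(4) by auto
        next
          case False
          then have "(y, z) \<in> E'" using step(2) by (auto simp: E'_def)
          then show ?thesis using step(3) False by (meson rtrancl.rtrancl_into_rtrancl)
        qed
      qed
      then show ?thesis
        using conn by (auto simp: spans_from_def V'_def)
    qed
    have fl: "f (i, b) \<noteq> l" if "i < s" for i b
    proof
      assume eq: "f (i, b) = l"
      have "(f (i, b), f (i, \<not> b)) \<in> E"
        using ff[OF that] E_sym by (cases b) auto
      then have "f (i, \<not> b) = p" using eq only by auto
      moreover have "c = p"
        using fc[OF that, of b] eq only by auto
      ultimately show False
        using fc[OF that, of "\<not> b"] E_irrefl by auto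
    qed
    have fc': "(c, f (i, b)) \<in> E'" if "i < s" for i b
      using fc[OF that] fl[OF that] l(2) by (auto simp: E'_def)
    have ff': "(f (i, False), f (i, True)) \<in> E'" if "i < s" for i
      using ff[OF that] fl[OF that] by (auto simp: E'_def)
    show ?thesis
    proof (cases "p = c")
      case True
      have "deg E' c = 2 * s + (k - 1)"
        using deg_p degc True False by simp
      moreover have "{v \<in> V' - {c}. deg E' v = 1} = {v \<in> V - {c}. deg E v = 1} - {l}"
        using deg_other True by (auto simp: V'_def)
      then have "card {v \<in> V' - {c}. deg E' v = 1} = k - 1"
        using l leaves by simp
      moreover have "deg E' v \<in> {1, 2}" if "v \<in> V' - {c}" for v
        using degs[of v] deg_other[of v] that True by (auto simp: V'_def)
      ultimately obtain ls \<phi> where IH: "length ls = k - 1" "\<forall>l\<in>set ls. 1 \<le> l" "pf_iso s ls \<phi> c V' E'"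
        using less.hyps[OF card' G' cV' conn' _ fc' ff'] by blast
      have "pf_iso s (ls @ [1]) (\<phi>(Pth (length ls) 1 := l)) c (insert l V') (E' \<union> {(l, p), (p, l)})"
        using IH(3) True by (intro pf_iso_extend[OF IH(3) E'V' lV' pV' _ _ _ _ pf_append])
          (auto simp: pf_iso_def)
      then show ?thesis
        using IH False V E by (intro exI[of _ "ls @ [1]"] exI[of _ "\<phi>(Pth (length ls) 1 := l)"]) auto
    next
      case pc: False
      have "deg E p \<noteq> 1"
      proof
        assume "deg E p = 1"
        then obtain q where "E `` {p} = {q}"
          unfolding deg_def using card_1_singletonE by blast
        then have "E `` {p} = {l}" using lp(2) by auto
        then have "c \<in> {l, p}"
          using p lp(3) l(1) by (intro closed_under_arcs_eq_V(2)[OF conn, of "{l, p}" l]) auto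
        then show False using l pc by auto
      qed
      then have p2: "deg E p = 2"
        using degs[of p] lp(3) pc by auto
      have "deg E' c = 2 * s + k"
        using deg_other[of c] degc pc l by simp
      moreover have "{v \<in> V' - {c}. deg E' v = 1} = insert p ({v \<in> V - {c}. deg E v = 1} - {l})"
      proof -
        have "v \<in> {v \<in> V' - {c}. deg E' v = 1} \<longleftrightarrow> v \<in> insert p ({v \<in> V - {c}. deg E v = 1} - {l})" for v
          using deg_other[of v] deg_p p2 pc pV' by (cases "v = p") (auto simp: V'_def)
        then show ?thesis by blast
      qed
      then have "card {v \<in> V' - {c}. deg E' v = 1} = card (insert p ({v \<in> V - {c}. deg E v = 1} - {l}))"
        by simp
      then have "card {v \<in> V' - {c}. deg E' v = 1} = k"
        using l leaves p2 finite_V False by simp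
      moreover have "deg E' v \<in> {1, 2}" if "v \<in> V' - {c}" for v
        using degs[of v] deg_other[of v] that deg_p p2 by (cases "v = p") (auto simp: V'_def)
      ultimately obtain ls \<phi> where IH: "length ls = k" "\<forall>l\<in>set ls. 1 \<le> l" "pf_iso s ls \<phi> c V' E'"
        using less.hyps[OF card' G' cV' conn' _ fc' ff'] by blast
      have "p \<in> \<phi> ` pf_verts s ls"
        using IH(3) pV' by (auto simp: pf_iso_def bij_betw_def)
      then obtain u where u: "u \<in> pf_verts s ls" "\<phi> u = p" by auto
      have "deg (pf_arcs s ls) u = 1"
        using pf_iso_deg[OF IH(3) E'V' u(1)] u(2) deg_p p2 by simp
      moreover have "u \<noteq> Center"
        using u(2) IH(3) pc by (auto simp: pf_iso_def)
      ultimately have "u \<in> (\<lambda>j. Pth j (ls ! j)) ` {..<length ls}"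
        using leaves_pf[OF IH(2), of s] u(1) by blast
      then obtain j where j: "j < length ls" "u = Pth j (ls ! j)" by auto
      have pos: "1 \<le> ls ! j"
        using IH(2) nth_mem[OF j(1)] by blast
      have "pf_iso s (ls[j := Suc (ls ! j)]) (\<phi>(Pth j (Suc (ls ! j)) := l)) c (insert l V') (E' \<union> {(l, p), (p, l)})"
        using u j by (intro pf_iso_extend[OF IH(3) E'V' lV' pV' _ _ _ _ pf_lengthen[OF j(1) pos]]) auto
      moreover have "\<forall>l\<in>set (ls[j := Suc (ls ! j)]). 1 \<le> l"
        using IH(2) set_update_subset_insert[of ls j "Suc (ls ! j)"] by auto
      ultimately show ?thesis
        using IH(1) V E
        by (intro exI[of _ "ls[j := Suc (ls ! j)]"] exI[of _ "\<phi>(Pth j (Suc (ls ! j)) := l)"]) auto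
    qed
  qed
qed

section \<open>Passing between the concrete model and arbitrary graphs\<close>

lemma pf_iso_digraph_iso:
  assumes "pf_iso s ls \<phi> c (pverts H) (parcs H)" "pair_graph H"
  shows "digraph_iso (with_proj (path_friendship_graph s ls)) (with_proj H)"
proof -
  let ?P = "path_friendship_graph s ls"
  interpret P: pair_graph ?P by (rule pair_graph_path_friendship_graph)
  interpret H: simple_graph "pverts H" "parcs H" by (rule pair_graph_simple_graph[OF assms(2)])
  interpret PG: simple_graph "pverts ?P" "parcs ?P" by (rule simple_graph_pf)
  let ?h = "\<lparr>iso_verts = \<phi>, iso_arcs = map_prod \<phi> \<phi>, iso_head = snd, iso_tail = fst\<rparr>"
  have bij: "inj_on \<phi> (pverts ?P)" "\<phi> ` pverts ?P = pverts H"
    and iff: "\<And>u v. u \<in> pverts ?P \<Longrightarrow> v \<in> pverts ?P \<Longrightarrow> (u, v) \<in> parcs ?P \<longleftrightarrow> (\<phi> u, \<phi> v) \<in> parcs H"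
    using assms(1) by (auto simp: pf_iso_def bij_betw_def)
  have arcs: "map_prod \<phi> \<phi> ` parcs ?P = parcs H"
  proof
    show "map_prod \<phi> \<phi> ` parcs ?P \<subseteq> parcs H"
      using iff PG.E_sub by auto
    show "parcs H \<subseteq> map_prod \<phi> \<phi> ` parcs ?P"
    proof
      fix e assume e: "e \<in> parcs H"
      obtain x y where xy: "e = (x, y)" by (cases e)
      then have "x \<in> \<phi> ` pverts ?P" "y \<in> \<phi> ` pverts ?P"
        using e H.E_sub bij(2) by auto
      then obtain u v where "u \<in> pverts ?P" "v \<in> pverts ?P" "x = \<phi> u" "y = \<phi> v" by auto
      then show "e \<in> map_prod \<phi> \<phi> ` parcs ?P"
        using iff e xy by force
    qed
  qed
  have "inj_on (map_prod \<phi> \<phi>) (parcs ?P)"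
    using map_prod_inj_on[OF bij(1) bij(1)] PG.E_sub by (rule inj_on_subset)
  moreover have "wf_digraph (with_proj ?P)"
    by unfold_locales
  ultimately have "pre_digraph.digraph_isomorphism (with_proj ?P) ?h"
    using bij by (simp add: pre_digraph.digraph_isomorphism_def)
  moreover have "with_proj H = app_iso ?h (with_proj ?P)"
    using arcs bij by (simp add: app_iso_def with_proj_def)
  ultimately show ?thesis
    unfolding digraph_iso_def by blast
qed

text \<open>Corresponding enumerations give the same matrix. This allows \<open>G\<close> to be
  replaced by the concrete graph.\<close>

lemma digraph_iso_L_cospectral:
  assumes "pair_graph P" "digraph_iso (with_proj P) (with_proj G)"
  shows "L_cospectral P G"
proof -
  interpret P: simple_graph "pverts P" "parcs P" by (rule pair_graph_simple_graph[OF assms(1)])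
  obtain g where g: "pre_digraph.digraph_isomorphism (with_proj P) g" "with_proj G = app_iso g (with_proj P)"
    using assms(2) by (auto simp: digraph_iso_def)
  define \<phi> where "\<phi> = iso_verts g"
  have verts: "pverts G = \<phi> ` pverts P"
    using arg_cong[OF g(2), of verts] by (simp add: \<phi>_def)
  have ends: "iso_tail g = fst" "iso_head g = snd"
    using arg_cong[OF g(2), of tail] arg_cong[OF g(2), of head] by simp_all
  have inj: "inj_on \<phi> (pverts P)"
    using g(1) by (simp add: pre_digraph.digraph_isomorphism_def \<phi>_def)
  have "iso_arcs g a = map_prod \<phi> \<phi> a" if "a \<in> parcs P" for a
    using g(1) that by (intro prod_eqI) (auto simp: pre_digraph.digraph_isomorphism_def \<phi>_def ends)
  then have arcs: "parcs G = map_prod \<phi> \<phi> ` parcs P"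
    using arg_cong[OF g(2), of arcs] by (simp cong: image_cong)
  have iff: "(\<phi> u, \<phi> v) \<in> parcs G \<longleftrightarrow> (u, v) \<in> parcs P" if "u \<in> pverts P" "v \<in> pverts P" for u v
  proof
    assume "(\<phi> u, \<phi> v) \<in> parcs G"
    then obtain x y where "(x, y) \<in> parcs P" "\<phi> u = \<phi> x" "\<phi> v = \<phi> y"
      by (auto simp: arcs)
    moreover have "x \<in> pverts P" "y \<in> pverts P"
      using calculation P.E_sub by auto
    ultimately show "(u, v) \<in> parcs P"
      using inj that by (auto dest: inj_onD)
  qed (auto simp: arcs intro!: image_eqI[of _ _ "(u, v)"])
  have degs: "deg (parcs G) (\<phi> u) = deg (parcs P) u" if u: "u \<in> pverts P" for u
  proof -
    have "parcs G `` {\<phi> u} = \<phi> ` (parcs P `` {u})"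
    proof
      show "parcs G `` {\<phi> u} \<subseteq> \<phi> ` (parcs P `` {u})"
      proof
        fix y assume y: "y \<in> parcs G `` {\<phi> u}"
        then obtain v where "v \<in> pverts P" "y = \<phi> v"
          using P.E_sub by (auto simp: arcs)
        then show "y \<in> \<phi> ` (parcs P `` {u})"
          using iff[OF u] y by auto
      qed
      show "\<phi> ` (parcs P `` {u}) \<subseteq> parcs G `` {\<phi> u}"
        using iff[OF u] P.nbrs_sub[of u] by auto
    qed
    moreover have "inj_on \<phi> (parcs P `` {u})"
      using inj P.nbrs_sub by (rule inj_on_subset)
    ultimately show ?thesis
      by (simp add: deg_def card_image)
  qed
  have lap: "lap (parcs G) (\<phi> u) (\<phi> v) = lap (parcs P) u v" if "u \<in> pverts P" "v \<in> pverts P" for u v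
    using that inj iff degs by (auto simp: lap_def adj_def dest: inj_onD)
  obtain vs where vs: "distinct vs" "set vs = pverts P"
    using finite_distinct_list[OF P.finite_V] by blast
  have vs': "distinct (map \<phi> vs)" "set (map \<phi> vs) = pverts G"
    using vs inj by (auto simp: distinct_map verts)
  have "mat_on (map \<phi> vs) (\<lambda>u v. complex_of_real (lap (parcs G) u v)) =
      mat_on vs (\<lambda>u v. complex_of_real (lap (parcs P) u v))"
    by (rule eq_matI) (use lap[OF nth_mem[of _ vs, unfolded vs(2)] nth_mem[of _ vs, unfolded vs(2)]]
      in \<open>auto simp: mat_on_def\<close>)
  then show ?thesis
    by (simp add: L_cospectral_def laplacian_spectrum_mat_on[OF vs] laplacian_spectrum_mat_on[OF vs'])
qed

section \<open>Degree sequences\<close>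

context simple_graph
begin

lemma deg_less_card: "v \<in> V \<Longrightarrow> deg E v < card V"
proof -
  assume v: "v \<in> V"
  have "E `` {v} \<subset> V"
    using nbrs_sub[of v] E_irrefl[of v] v by auto
  then show ?thesis
    unfolding deg_def using finite_V by (rule psubset_card_mono[rotated])
qed

lemma deg_pos:
  assumes "spans_from c V E" "c \<in> V" "v \<in> V" "1 < card V"
  shows "1 \<le> deg E v"
proof (rule ccontr)
  assume "\<not> 1 \<le> deg E v"
  then have "E `` {v} = {}"
    using finite_nbrs[of v] by (auto simp: deg_def Suc_le_eq card_gt_0_iff)
  then have "{v} = V"
    using assms(3) by (intro closed_under_arcs_eq_V(1)[OF assms(1), of "{v}" v]) auto
  then show False
    using assms(4) by (metis card_1_singleton_iff One_nat_def less_irrefl)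
qed

text \<open>The function \<open>g\<close> is arbitrary: \<open>int\<close> yields the number of
  leaves, the falling factorials yield the moments of \<open>G\<close>.\<close>

lemma sum_deg_one_center:
  fixes g :: "nat \<Rightarrow> int"
  assumes c: "c \<in> V" and degs: "\<And>v. v \<in> V - {c} \<Longrightarrow> deg E v \<in> {1, 2}"
  shows "(\<Sum>v\<in>V. g (deg E v)) = g (deg E c) + int (card {v \<in> V - {c}. deg E v = 1}) * g 1 +
    (int (card V) - 1 - int (card {v \<in> V - {c}. deg E v = 1})) * g 2"
proof -
  let ?A = "{v \<in> V - {c}. deg E v = 1}"
  let ?B = "V - {c} - ?A"
  have fin: "finite ?A" "finite (V - {c})" "?A \<subseteq> V - {c}"
    using finite_V by auto
  have "(\<Sum>v\<in>V. g (deg E v)) = g (deg E c) + (\<Sum>v\<in>V - {c}. g (deg E v))"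
    using finite_V c by (rule sum.remove)
  also have "(\<Sum>v\<in>V - {c}. g (deg E v)) = (\<Sum>v\<in>?B. g (deg E v)) + (\<Sum>v\<in>?A. g (deg E v))"
    using fin by (intro sum.subset_diff) auto
  also have "(\<Sum>v\<in>?A. g (deg E v)) = int (card ?A) * g 1"
    by simp
  also have "(\<Sum>v\<in>?B. g (deg E v)) = (\<Sum>v\<in>?B. g 2)"
  proof (rule sum.cong[OF refl])
    fix v assume "v \<in> ?B"
    then have "v \<in> V - {c}" "deg E v \<noteq> 1" by auto
    then show "g (deg E v) = g 2"
      using degs[of v] by auto
  qed
  also have "\<dots> = int (card ?B) * g 2"
    by simp
  also have "int (card ?B) = int (card V) - 1 - int (card ?A)"
  proof -
    have "card ?B = card (V - {c}) - card ?A" "card ?A \<le> card (V - {c})"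
      using fin by (auto intro: card_Diff_subset card_mono)
    moreover have "card (V - {c}) = card V - 1" "card V > 0"
      using c finite_V by (auto simp: card_gt_0_iff)
    ultimately show ?thesis by linarith
  qed
  finally show ?thesis by simp
qed

end

text \<open>The first three moments of the degree sequence, written in terms of falling factorials of
  \<open>d - 1\<close>, which vanish at the degrees \<open>1\<close> and \<open>2\<close>.\<close>

lemma degree_sequence_cases:
  fixes d :: "'a \<Rightarrow> int" and D s n T :: int
  assumes fin: "finite W" and n: "n = int (card W)" and pos: "\<And>v. v \<in> W \<Longrightarrow> 1 \<le> d v"
    and s: "0 \<le> s" "2 * s \<le> D" "1 \<le> D" "D < n" and T: "0 \<le> T"
    and m1: "(\<Sum>v\<in>W. d v) = 2 * n + 2 * s - 2"
    and m2: "(\<Sum>v\<in>W. (d v - 1) * (d v - 2)) = (D - 1) * (D - 2)"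
    and m3: "(\<Sum>v\<in>W. (d v - 1) * (d v - 2) * (d v - 3)) - T = (D - 1) * (D - 2) * (D - 3) - 6 * s"
  obtains (center) c where "c \<in> W" "d c = D" "\<And>v. v \<in> W - {c} \<Longrightarrow> d v \<in> {1, 2}" "T = 6 * s"
  | (four_one) "D = 4" "s = 1" "T = 0"
  | (four_two) v where "D = 4" "s = 2" "v \<in> W" "d v = 1" "\<And>v. v \<in> W \<Longrightarrow> d v \<le> 3"
  | (five) u w where "D = 5" "s = 2" "T = 0" "u \<in> W" "w \<in> W" "u \<noteq> w" "d u = 4" "d w = 4"
      "\<And>v. v \<in> W - {u, w} \<Longrightarrow> d v \<le> 2"
proof -
  define q where "q v = (d v - 1) * (d v - 2)" for v
  have q0: "0 \<le> q v" if "v \<in> W" for v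
  proof (cases "d v = 1")
    case False
    then show ?thesis
      using pos[OF that] by (simp add: q_def)
  qed (simp add: q_def)
  have q_zero: "d v \<in> {1, 2}" if "q v = 0" for v
    using that by (auto simp: q_def)
  have m2': "(\<Sum>v\<in>W. q v) = (D - 1) * (D - 2)"
    using m2 by (simp add: q_def)
  have m3': "(\<Sum>v\<in>W. q v * (d v - 3)) - T = (D - 1) * (D - 2) * (D - 3) - 6 * s"
    using m3 by (simp add: q_def)
  consider "D \<le> 2" | "\<exists>c\<in>W. d c = D" "3 \<le> D" | "\<forall>v\<in>W. d v \<noteq> D" "3 \<le> D"
    by fastforce
  then show thesis
  proof cases
    case 1
    then have "(D - 1) * (D - 2) = 0"
      using s by (cases "D = 1") auto
    then have "\<forall>v\<in>W. q v = 0"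
      using m2' q0 sum_nonneg_eq_0_iff[OF fin, of q] by simp
    then have 12: "d v \<in> {1, 2}" if "v \<in> W" for v
      using q_zero that by blast
    have "(\<Sum>v\<in>W. q v * (d v - 3)) = 0"
      using \<open>\<forall>v\<in>W. q v = 0\<close> by (intro sum.neutral) auto
    then have "T = 6 * s"
      using m3' \<open>(D - 1) * (D - 2) = 0\<close> by simp
    moreover have "\<exists>c\<in>W. d c = D"
    proof (rule ccontr)
      \<comment> \<open>All degrees then equal the other element of \<open>{1, 2}\<close>. For
        \<open>D = 1\<close> the sum \<open>2 n\<close> exceeds \<open>2 n + 2 s - 2\<close>, as
        \<open>s = 0\<close>; for \<open>D = 2\<close> the sum \<open>n\<close> would give
        \<open>n \<le> 2\<close>, against \<open>D < n\<close>.\<close>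
      assume none: "\<not> (\<exists>c\<in>W. d c = D)"
      have "d v = 3 - D" if "v \<in> W" for v
        using 12[OF that] none that 1 s by auto
      then have "(\<Sum>v\<in>W. d v) = n * (3 - D)"
        using n by simp
      moreover have "D = 1 \<or> D = 2"
        using 1 s by linarith
      ultimately show False
        using m1 s by auto
    qed
    ultimately show thesis
      using center 12 by blast
  next
    case 2
    then obtain c where c: "c \<in> W" "d c = D" by blast
    \<comment> \<open>The vertex \<open>c\<close> alone exhausts the quadratic moment.\<close>
    have "(\<Sum>v\<in>W - {c}. q v) = 0"
      using m2' sum.remove[OF fin c(1), of q] c(2) by (simp add: q_def)
    then have "\<forall>v\<in>W - {c}. q v = 0"
      using q0 fin sum_nonneg_eq_0_iff[of "W - {c}" q] by simp
    moreover have "T = 6 * s"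
    proof -
      have "(\<Sum>v\<in>W - {c}. q v * (d v - 3)) = 0"
        using calculation by (intro sum.neutral) auto
      then show ?thesis
        using m3' sum.remove[OF fin c(1), of "\<lambda>v. q v * (d v - 3)"] c(2) by (simp add: q_def)
    qed
    ultimately show thesis
      using center[OF c] q_zero by blast
  next
    case 3
    \<comment> \<open>A single degree above \<open>D\<close> would exceed the whole quadratic
      moment.\<close>
    have less: "d v \<le> D - 1" if v: "v \<in> W" for v
    proof (rule ccontr)
      assume "\<not> d v \<le> D - 1"
      then have "D + 1 \<le> d v"
        using 3 v by force
      then have "(D + 1 - 1) * (D + 1 - 2) \<le> q v"
        unfolding q_def using 3(2) by (intro mult_mono) auto
      moreover have "q v \<le> (\<Sum>v\<in>W. q v)"
        using q0 fin v by (intro member_le_sum) auto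
      ultimately have "D * (D - 1) \<le> (D - 1) * (D - 2)"
        using m2' by simp
      then show False
        using 3(2) by (simp add: algebra_simps)
    qed
    have "(\<Sum>v\<in>W. q v * (d v - 3)) \<le> (\<Sum>v\<in>W. q v * (D - 4))"
      using less q0 by (intro sum_mono mult_left_mono) force+
    also have "\<dots> = (D - 1) * (D - 2) * (D - 4)"
      by (simp add: m2' flip: sum_distrib_right)
    finally have "T \<le> (D - 1) * (D - 2) * (D - 4) - (D - 1) * (D - 2) * (D - 3) + 6 * s"
      using m3' by linarith
    then have Tle: "T \<le> 6 * s - (D - 1) * (D - 2)"
      by (simp add: algebra_simps)
    \<comment> \<open>For \<open>D \<ge> 6\<close> one gets
      \<open>5 (D - 2) \<le> 6 s \<le> 3 D\<close>, which means \<open>D \<le> 5\<close>.\<close>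
    have "D \<le> 5"
    proof (rule ccontr)
      assume "\<not> D \<le> 5"
      then have "5 * (D - 2) \<le> (D - 1) * (D - 2)"
        by (intro mult_right_mono) auto
      also have "\<dots> \<le> 6 * s"
        using Tle T by simp
      finally show False
        using s(2) \<open>\<not> D \<le> 5\<close> by presburger
    qed
    then consider "D = 3" | "D = 4" | "D = 5"
      using 3(2) by linarith
    then show thesis
    proof cases
      case 1
      \<comment> \<open>Degrees at most 2 make the quadratic moment 0, but it is 2.\<close>
      have "q v = 0" if "v \<in> W" for v
        using pos[OF that] less[OF that] 1 by (cases "d v = 1") (auto simp: q_def)
      then have "(\<Sum>v\<in>W. q v) = 0" by simp
      then show thesis using m2' 1 by simp
    next
      case 2
      have d3: "d v \<le> 3" if "v \<in> W" for v
        using less[OF that] 2 by simp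
      have "q v * (d v - 3) = 0" if "v \<in> W" for v
        using pos[OF that] d3[OF that] by (cases "d v = 1"; cases "d v = 2"; cases "d v = 3") (auto simp: q_def)
      then have "(\<Sum>v\<in>W. q v * (d v - 3)) = 0" by simp
      then have T6: "T = 6 * s - 6"
        using m3' 2 by simp
      then consider "s = 1" | "s = 2"
        using T s 2 by linarith
      then show thesis
      proof cases
        case s1: 1
        then show thesis using four_one 2 T6 by simp
      next
        case s2: 2
        \<comment> \<open>If all degrees are 2 or 3, \<open>q\<close> agrees with the linear
          function \<open>2 (d - 2)\<close>; the degree sum then gives 4 for the quadratic moment,
          which is 6.\<close>
        have "\<exists>v\<in>W. d v = 1"
        proof (rule ccontr)
          assume none: "\<not> (\<exists>v\<in>W. d v = 1)"
          have "q v = 2 * (d v - 2)" if "v \<in> W" for v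
          proof -
            have "d v = 2 \<or> d v = 3"
              using pos[OF that] d3[OF that] none that by force
            then show ?thesis by (auto simp: q_def)
          qed
          then have "(\<Sum>v\<in>W. q v) = 2 * ((\<Sum>v\<in>W. d v) - 2 * n)"
            using n by (simp add: sum_subtractf flip: sum_distrib_left)
          then show False
            using m1 m2' 2 s2 by simp
        qed
        then show thesis
          using four_two[OF 2 s2] d3 by blast
      qed
    next
      case 5: 3
      define A where "A = {v \<in> W. d v = 4}"
      define B where "B = {v \<in> W. d v = 3}"
      have finAB: "finite A" "finite B" using fin by (auto simp: A_def B_def)
      have d4: "d v \<in> {1, 2, 3, 4}" if "v \<in> W" for v
        using pos[OF that] less[OF that] 5 by auto
      have "(\<Sum>v\<in>W. q v) = (\<Sum>v\<in>W. (if v \<in> A then 6 else 0) + (if v \<in> B then 2 else 0))"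
        using d4 by (intro sum.cong) (auto simp: q_def A_def B_def)
      also have "\<dots> = 6 * int (card A) + 2 * int (card B)"
        using fin by (simp add: sum.distrib A_def B_def sum.If_cases Int_def conj_commute)
      finally have e2: "6 * int (card A) + 2 * int (card B) = 12"
        using m2' 5 by simp
      have "(\<Sum>v\<in>W. q v * (d v - 3)) = (\<Sum>v\<in>W. if v \<in> A then 6 else 0)"
        using d4 by (intro sum.cong) (auto simp: q_def A_def)
      also have "\<dots> = 6 * int (card A)"
        using fin by (simp add: A_def sum.If_cases Int_def conj_commute)
      finally have e3: "6 * int (card A) - T = 24 - 6 * s"
        using m3' 5 by simp
      have "s \<le> 2" using s 5 by linarith
      \<comment> \<open>From \<open>e3\<close>, \<open>6 card A = T + 24 - 6 s\<close> is at least
        12, and from \<open>e2\<close> it is at most 12; so equality holds throughout.\<close>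
      then have A2: "card A = 2" and B0: "card B = 0" and "s = 2" "T = 0"
        using e2 e3 T by linarith+
      obtain u w where uw: "A = {u, w}" "u \<noteq> w"
        using A2 by (auto simp: card_2_iff)
      have "d v \<le> 2" if "v \<in> W - {u, w}" for v
      proof -
        have "v \<notin> A" "v \<notin> B"
          using that uw B0 finAB by auto
        then show ?thesis
          using d4[of v] that by (auto simp: A_def B_def)
      qed
      moreover have "u \<in> A" "w \<in> A" using uw by auto
      ultimately show thesis
        using five[OF 5 \<open>s = 2\<close> \<open>T = 0\<close>, of u w] uw(2) by (simp add: A_def)
    qed
  qed
qed

text \<open>With degree \<open>2 * s + k\<close> at \<open>c\<close> and degrees 1 and 2 elsewhere,
  the degree sum leaves exactly \<open>k\<close> vertices of degree 1, as the structure lemma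
  requires.\<close>

lemma path_friendship_of_center:
  assumes H: "simple_graph W F" and c: "c \<in> W" and conn: "spans_from c W F"
    and degs: "\<And>v. v \<in> W - {c} \<Longrightarrow> deg F v \<in> {1, 2}" and degc: "deg F c = 2 * s + k"
    and tri: "card (triangles F) = 6 * s"
    and m1: "(\<Sum>v\<in>W. int (deg F v)) = 2 * int (card W) + 2 * int s - 2"
  shows "\<exists>ls \<phi>. length ls = k \<and> (\<forall>l\<in>set ls. 1 \<le> l) \<and> pf_iso s ls \<phi> c W F"
proof -
  interpret simple_graph W F by fact
  have "int (card {v \<in> W - {c}. deg F v = 1}) = int k"
    using sum_deg_one_center[OF c degs, of int] m1 degc by simp
  then have leaves: "card {v \<in> W - {c}. deg F v = 1} = k" by simp
  have le2: "deg F v \<le> 2" if "v \<in> W - {c}" for v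
    using degs[OF that] by auto
  obtain f where f: "inj_on f ({..<s} \<times> (UNIV :: bool set))"
    "\<And>i b. i < s \<Longrightarrow> (c, f (i, b)) \<in> F" "\<And>i. i < s \<Longrightarrow> (f (i, False), f (i, True)) \<in> F"
    using triangle_pairs[OF c conn le2 tri] by blast
  show ?thesis
    by (rule path_friendship_structure[OF H c conn degs f degc leaves])
qed

theorem theorem3p9:
  fixes G :: "'a pair_pre_digraph" and H :: "'b pair_pre_digraph" and s k :: nat
  assumes "pair_graph G" and "is_path_friendship s k G"
    and "pair_graph H" and "L_cospectral G H"
  shows "is_path_friendship s k H"
proof -
  obtain ls where ls: "length ls = k" "\<forall>l\<in>set ls. 1 \<le> l"
    and iso: "digraph_iso (with_proj (path_friendship_graph s ls)) (with_proj G)"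
    using assms(2) by (auto simp: is_path_friendship_def)
  let ?P = "path_friendship_graph s ls"
  define V E W F where "V = pverts ?P" and "E = parcs ?P" and "W = pverts H" and "F = parcs H"
  have "L_cospectral ?P H"
    using digraph_iso_L_cospectral[OF pair_graph_path_friendship_graph iso] assms(4)
    by (simp add: L_cospectral_def)
  note inv = L_cospectral_invariants[OF pair_graph_path_friendship_graph assms(3) this,
      folded V_def E_def W_def F_def]
  have P: "simple_graph V E"
    unfolding V_def E_def by (rule simple_graph_pf)
  have H: "simple_graph W F"
    unfolding W_def F_def by (rule pair_graph_simple_graph[OF assms(3)])
  interpret P: simple_graph V E by (rule P)
  interpret H: simple_graph W F by (rule H)
  define D where "D = 2 * s + k"
  have cV: "Center \<in> V" by (simp add: V_def)
  have connP: "spans_from Center V E"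
    unfolding V_def E_def by (rule spans_from_Center[OF ls(2)])
  have degC: "deg E Center = D"
    unfolding E_def D_def using deg_Center[OF ls(2)] ls(1) by simp
  have degsP: "deg E v \<in> {1, 2}" if "v \<in> V - {Center}" for v
    using deg_non_Center that by (simp add: V_def E_def)
  have leavesP: "card {v \<in> V - {Center}. deg E v = 1} = k"
    unfolding V_def E_def using card_leaves_pf[OF ls(2)] ls(1) by simp
  have sumP: "(\<Sum>v\<in>V. g (deg E v)) = g D + int k * g 1 + (int (card V) - 1 - int k) * g 2" for g
    using P.sum_deg_one_center[OF cV degsP, of g] degC leavesP by simp
  have triP: "card (triangles E) = 6 * s"
    unfolding E_def by (rule card_triangles_pf)
  have Dn: "D < card W"
    using P.deg_less_card[OF cV] degC inv(1) by simp
  \<comment> \<open>Without paths the order of the graph is known; this settles the one-vertex graph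
    and gives \<open>n = 5\<close> for two triangles.\<close>
  have k0: "card W = 2 * s + 1" if "k = 0"
    using inv(1) card_verts_friendship[of s] ls(1) that by (simp add: V_def)
  have connH: "spans_from c W F" if "c \<in> W" for c
    using spans_from_transfer[OF P H inv(1,2) cV that connP] .
  let ?d = "\<lambda>v. int (deg F v)"
  have m1: "(\<Sum>v\<in>W. ?d v) = 2 * int (card W) + 2 * int s - 2"
    using inv(3) sumP[of int] inv(1) by (simp add: D_def)
  have m2: "(\<Sum>v\<in>W. (?d v - 1) * (?d v - 2)) = (int D - 1) * (int D - 2)"
  proof -
    have "(\<Sum>v\<in>W. (?d v - 1) * (?d v - 2)) = (\<Sum>v\<in>V. (int (deg E v) - 1) * (int (deg E v) - 2))"
      using inv(1,3,4)
      by (simp add: algebra_simps power2_eq_square sum.distrib sum_subtractf flip: sum_distrib_left sum_distrib_right)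
    then show ?thesis
      using sumP[of "\<lambda>d. (int d - 1) * (int d - 2)"] by simp
  qed
  have m3: "(\<Sum>v\<in>W. (?d v - 1) * (?d v - 2) * (?d v - 3)) - int (card (triangles F)) =
      (int D - 1) * (int D - 2) * (int D - 3) - 6 * int s"
  proof -
    have cubic: "(x - 1) * (x - 2) * (x - 3) = x ^ 3 - 6 * x\<^sup>2 + 11 * x - 6" for x :: int
      by (simp add: power2_eq_square power3_eq_cube algebra_simps)
    have "(\<Sum>v\<in>W. (?d v - 1) * (?d v - 2) * (?d v - 3)) - int (card (triangles F)) =
        (\<Sum>v\<in>V. (int (deg E v) - 1) * (int (deg E v) - 2) * (int (deg E v) - 3)) - int (card (triangles E))"
      unfolding cubic sum.distrib sum_subtractf sum_distrib_left[symmetric] using inv(1,3,4,5) by simp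
    then show ?thesis
      using sumP[of "\<lambda>d. (int d - 1) * (int d - 2) * (int d - 3)"] triP by simp
  qed
  have "W \<noteq> {}" using Dn by auto
  have "\<exists>c\<in>W. deg F c = D \<and> (\<forall>v\<in>W - {c}. deg F v \<in> {1, 2}) \<and> card (triangles F) = 6 * s"
  \<comment> \<open>For \<open>D = 0\<close> the graph is a single vertex, whose degree is not
    positive, so it is kept apart from the analysis of degree sequences.\<close>
  proof (cases "D = 0")
    case True
    then have "card W = 1"
      using k0 by (simp add: D_def)
    then obtain c where W: "W = {c}"
      by (metis card_1_singletonE)
    then have "deg F c = 0"
      using H.deg_less_card[of c] by simp
    then show ?thesis
      using m3 W True by (simp add: D_def)
  next
    case False
    obtain w0 where "w0 \<in> W" using \<open>W \<noteq> {}\<close> by blast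
    have pos: "1 \<le> ?d v" if "v \<in> W" for v
      using H.deg_pos[OF connH[OF \<open>w0 \<in> W\<close>] \<open>w0 \<in> W\<close> that] Dn False by simp
    have bounds: "0 \<le> int s" "2 * int s \<le> int D" "1 \<le> int D" "int D < int (card W)"
      "0 \<le> int (card (triangles F))"
      using False Dn by (auto simp: D_def)
    show ?thesis
    proof (rule degree_sequence_cases[OF H.finite_V refl pos bounds m1 m2 m3])
      fix c assume c: "c \<in> W" "?d c = int D" "\<And>v. v \<in> W - {c} \<Longrightarrow> ?d v \<in> {1, 2}"
        "int (card (triangles F)) = 6 * int s"
      have "deg F v \<in> {1, 2}" if "v \<in> W - {c}" for v
        using c(3)[OF that] by auto
      moreover have "card (triangles F) = 6 * s"
        using c(4) by linarith
      ultimately show ?thesis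
        using c(1,2) by auto
    next
      assume a: "int D = 4" "int s = 1" "int (card (triangles F)) = 0"
      have "finite (triangles F)"
      proof (rule finite_subset)
        show "triangles F \<subseteq> W \<times> W \<times> W"
          using H.E_sub by (auto simp: triangles_def)
      qed (simp add: H.finite_V)
      then have tri: "triangles F = {}"
        using a(3) by simp
      \<comment> \<open>For \<open>s = 1\<close> the degree sum is \<open>2 n\<close>: there are as
        many edges as vertices.\<close>
      have "int (card F) = 2 * int (card W)"
        using H.card_E m1 a(2) by simp
      then have "4 \<le> set_det (W - {w0}) (lap F)"
        using H.triangle_free_unicyclic_reduced_lap_det[OF \<open>w0 \<in> W\<close> connH[OF \<open>w0 \<in> W\<close>] _ tri] by simp
      moreover have "set_det (V - {Center}) (lap E) = 3"
        using reduced_lap_det_unicyclic_pf[OF ls(2)] a(2) by (simp add: V_def E_def)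
      ultimately show ?thesis
        using reduced_lap_det_eq[OF P H inv(1,2) cV \<open>w0 \<in> W\<close>] by simp
    next
      fix a assume a: "int D = 4" "int s = 2" "a \<in> W" "?d a = 1" "\<And>v. v \<in> W \<Longrightarrow> ?d v \<le> 3"
      have s2: "s = 2" and "k = 0"
        using a(1,2) by (auto simp: D_def)
      then have n5: "card W = 5"
        using k0 by simp
      have "card (F `` {a}) = 1"
        using a(4) by (simp add: deg_def)
      then obtain b where b: "F `` {a} = {b}"
        by (rule card_1_singletonE)
      then have "b \<in> W"
        using H.nbrs_sub[of a] by auto
      \<comment> \<open>Here \<open>n = 5\<close> and all degrees are at most 3, so the neighbour of
        the leaf misses some vertex.\<close>
      then have "deg F b < card W - 1"
        using a(5)[of b] n5 by simp
      then have "lap_char W F (card W) \<noteq> 0"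
        using H.leaf_imp_card_not_eigenvalue[OF a(3) b] n5 by simp
      moreover have "lap_char V E 5 = 0"
        using lap_char_friendship[of 2] ls(1) s2 \<open>k = 0\<close> by (simp add: V_def E_def)
      ultimately show ?thesis
        using inv(2)[of 5] n5 by simp
    next
      fix u w assume a: "int D = 5" "int s = 2" "int (card (triangles F)) = 0" "u \<in> W" "w \<in> W" "u \<noteq> w"
        "?d u = 4" "?d w = 4" "\<And>v. v \<in> W - {u, w} \<Longrightarrow> ?d v \<le> 2"
      have "finite (triangles F)"
      proof (rule finite_subset)
        show "triangles F \<subseteq> W \<times> W \<times> W"
          using H.E_sub by (auto simp: triangles_def)
      qed (simp add: H.finite_V)
      then have tri: "triangles F = {}"
        using a(3) by simp
      have "deg F v \<le> 2" if "v \<in> W - {u, w}" for v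
        using a(9)[OF that] by simp
      then have "0 \<le> lap_char W F 4"
        using a(7,8) by (intro H.lap_char_4_nonneg[OF a(4-6) _ _ connH[OF a(4)] _ tri]) auto
      moreover have "lap_char V E 4 < 0"
      proof (rule P.lap_char_4_neg[OF cV connP])
        show "deg E v \<le> 2" if "v \<in> V - {Center}" for v
          using degsP[OF that] by auto
        show "4 < deg E Center"
          using degC a(1) by simp
      qed
      ultimately show ?thesis
        using inv(2)[of 4] by simp
    qed
  qed
  then obtain c where c: "c \<in> W" "deg F c = D" "\<And>v. v \<in> W - {c} \<Longrightarrow> deg F v \<in> {1, 2}"
    "card (triangles F) = 6 * s"
    by blast
  then obtain ls' \<phi> where "length ls' = k" "\<forall>l\<in>set ls'. 1 \<le> l" "pf_iso s ls' \<phi> c W F"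
    using path_friendship_of_center[OF H c(1) connH[OF c(1)] c(3) _ c(4) m1] by (auto simp: D_def)
  then show ?thesis
    using pf_iso_digraph_iso[of s ls' \<phi> c H] assms(3)
    by (auto simp: is_path_friendship_def W_def F_def)
qed

end
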